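(* Let $K$ be a valued field of equicharacteristic zero, considered as a structure in a language $\mathcal{L}$ expanding the language of valued fields, and assume that $\mathrm{Th}_{\mathcal{L}}(K)$ is $\ell$-h-minimal for some integer $\ell\geq 0$. Let $\mathcal{L}'$ be an $\mathrm{RV}$-expansion of $\mathcal{L}$. Then $\mathrm{Th}_{\mathcal{L}'}(K)$ is still $\ell$-h-minimal.
   Context: The valuation is written multiplicatively $|\cdot|:K\to\Gamma_K=\Gamma_K^\times\cup\{0\}$. For $\lambda\le1$ in $\Gamma_K^\times$, $\mathrm{RV}_\lambda=(K^\times/(1+B_{<\lambda}(0)))\cup\{0\}$ with quotient map $\mathrm{rv}_\lambda:K\to\mathrm{RV}_\lambda$ ($\mathrm{rv}_\lambda(0)=0$), where $B_{<\lambda}(0)=\{x:|x|<\lambda\}$; $\mathrm{RV}=\mathrm{RV}_1$. An $\mathrm{RV}$-expansion of $\mathcal{L}$ is an expansion of $\mathcal{L}$ by arbitrary predicates on Cartesian powers of $\mathrm{RV}$. A set $X\subset K$ is $\lambda$-prepared by a finite $C\subset K$ if whenever $\mathrm{rv}_\lambda(x-c)=\mathrm{rv}_\lambda(x'-c)$ for all $c\in C$, then $x\in X\iff x'\in X$. A theory of equicharacteristic zero valued fields is $\ell$-h-minimal ($\ell$ a non-negative integer) if for every model $K$, every $\lambda\le1$ in $\Gamma_K^\times$, every $A\subset K$ and every $A'\subset\mathrm{RV}_\lambda$ with $\#A'\le\ell$, every $(A\cup\mathrm{RV}\cup A')$-definable $X\subset K$ is $\lambda$-prepared by some finite $A$-definable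 $C\subset K$. *)

theory Defs
  imports "HOL-Algebra.QuotRing" "HOL-Algebra.Subrings" "HOL-Library.Equipollence"
begin

section \<open>Structures expanding valued fields\<close>

text \<open>
  A structure on a valued field \<open>K\<close>: the ring operations, the valuation ring \<open>val_O K\<close>, and
  interpretations of further function and relation symbols on \<open>K\<close> and of predicate symbols on
  Cartesian powers of the (imaginary) sort \<open>RV\<close>, whose elements are subsets of \<open>K\<close>.
\<close>

record ('u, 'f, 'r, 'p) vstruct = "'u ring" +
  val_O :: "'u set"
  fn :: "'f \<Rightarrow> 'u list \<Rightarrow> 'u"
  rl :: "'r \<Rightarrow> 'u list set"
  rvp :: "'p \<Rightarrow> 'u set list set"

subsection \<open>Valued fields\<close>

definition char_zero :: "('u, 'm) ring_scheme \<Rightarrow> bool" where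
  "char_zero R \<longleftrightarrow> (\<forall>n::nat. n > 0 \<longrightarrow> [n] \<cdot>\<^bsub>R\<^esub> \<one>\<^bsub>R\<^esub> \<noteq> \<zero>\<^bsub>R\<^esub>)"

definition valued_field :: "('u, 'f, 'r, 'p) vstruct \<Rightarrow> bool" where
  "valued_field K \<longleftrightarrow> field K \<and> subring (val_O K) K \<and>
     (\<forall>x \<in> carrier K - {\<zero>\<^bsub>K\<^esub>}. x \<in> val_O K \<or> inv\<^bsub>K\<^esub> x \<in> val_O K)"

definition val_ring :: "('u, 'f, 'r, 'p) vstruct \<Rightarrow> ('u, 'f, 'r, 'p) vstruct" where
  "val_ring K = K\<lparr>carrier := val_O K\<rparr>"

text \<open>
  The valuation takes values in \<open>\<Gamma>\<^sub>K = K\<^sup>\<times>/O\<^sup>\<times> \<union> {0}\<close>, an element being represented by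
  the corresponding orbit of \<open>O\<^sup>\<times>\<close> in \<open>K\<close>; the value \<open>0\<close> is the orbit \<open>{\<zero>}\<close>.
\<close>

definition val :: "('u, 'f, 'r, 'p) vstruct \<Rightarrow> 'u \<Rightarrow> 'u set" where
  "val K x = {u \<otimes>\<^bsub>K\<^esub> x | u. u \<in> Units (val_ring K)}"

definition value_group :: "('u, 'f, 'r, 'p) vstruct \<Rightarrow> 'u set set" where
  "value_group K = val K ` (carrier K - {\<zero>\<^bsub>K\<^esub>})"

definition val_le :: "('u, 'f, 'r, 'p) vstruct \<Rightarrow> 'u set \<Rightarrow> 'u set \<Rightarrow> bool" where
  "val_le K \<gamma> \<delta> \<longleftrightarrow> (\<exists>x\<in>\<gamma>. \<exists>y\<in>\<delta>. \<exists>a\<in>val_O K. x = a \<otimes>\<^bsub>K\<^esub> y)"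

definition val_less :: "('u, 'f, 'r, 'p) vstruct \<Rightarrow> 'u set \<Rightarrow> 'u set \<Rightarrow> bool" where
  "val_less K \<gamma> \<delta> \<longleftrightarrow> val_le K \<gamma> \<delta> \<and> \<gamma> \<noteq> \<delta>"

definition val_one :: "('u, 'f, 'r, 'p) vstruct \<Rightarrow> 'u set" where
  "val_one K = val K \<one>\<^bsub>K\<^esub>"

text \<open>The open ball around 0 of radius \<open>\<gamma>\<close>.\<close>

definition open_ball0 :: "('u, 'f, 'r, 'p) vstruct \<Rightarrow> 'u set \<Rightarrow> 'u set" where
  "open_ball0 K \<gamma> = {x \<in> carrier K. val_less K (val K x) \<gamma>}"

definition residue_field :: "('u, 'f, 'r, 'p) vstruct \<Rightarrow> 'u set ring" where
  "residue_field K = val_ring K Quot open_ball0 K (val_one K)"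

definition equichar0_valued_field :: "('u, 'f, 'r, 'p) vstruct \<Rightarrow> bool" where
  "equichar0_valued_field K \<longleftrightarrow>
     valued_field K \<and> char_zero K \<and> char_zero (residue_field K)"

subsection \<open>The quotients \<open>RV\<^sub>\<lambda>\<close>\<close>

text \<open>
  For \<open>x \<noteq> 0\<close>, \<open>rv K \<gamma> x\<close> is the coset of \<open>x\<close> modulo \<open>1 + B\<^bsub><\<gamma>\<^esub>(0)\<close>; the element \<open>0\<close> of
  \<open>RV\<^sub>\<gamma>\<close> is \<open>rv K \<gamma> \<zero> = {\<zero>}\<close>.
\<close>

definition rv :: "('u, 'f, 'r, 'p) vstruct \<Rightarrow> 'u set \<Rightarrow> 'u \<Rightarrow> 'u set" where
  "rv K \<gamma> x = {x \<otimes>\<^bsub>K\<^esub> (\<one>\<^bsub>K\<^esub> \<oplus>\<^bsub>K\<^esub> b) | b. b \<in> open_ball0 K \<gamma>}"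

definition RV_at :: "('u, 'f, 'r, 'p) vstruct \<Rightarrow> 'u set \<Rightarrow> 'u set set" where
  "RV_at K \<gamma> = rv K \<gamma> ` carrier K"

definition RV :: "('u, 'f, 'r, 'p) vstruct \<Rightarrow> 'u set set" where
  "RV K = RV_at K (val_one K)"

text \<open>
  The imaginary sort that contains all \<open>RV\<^sub>\<gamma>\<close> with \<open>\<gamma> \<le> 1\<close>. A nonzero element
  determines \<open>\<gamma>\<close>, since it is a ball \<open>x + B\<^bsub><\<gamma>|x|\<^esub>(0)\<close>.
\<close>

definition RV_sort :: "('u, 'f, 'r, 'p) vstruct \<Rightarrow> 'u set set" where
  "RV_sort K = (\<Union>\<gamma> \<in> {\<gamma> \<in> value_group K. val_le K \<gamma> (val_one K)}. RV_at K \<gamma>)"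

section \<open>First-order logic\<close>

text \<open>
  A language consists of the language of valued fields (ring operations and a unary predicate for
  the valuation ring) together with the symbols below, given with their arities. The symbols in
  \<open>rvrels\<close> are predicates on Cartesian powers of \<open>RV\<close>.
\<close>

record ('f, 'r, 'p) lang =
  funs :: "('f \<times> nat) set"
  rels :: "('r \<times> nat) set"
  rvrels :: "('p \<times> nat) set"

definition is_structure :: "('f, 'r, 'p) lang \<Rightarrow> ('u, 'f, 'r, 'p) vstruct \<Rightarrow> bool" where
  "is_structure L K \<longleftrightarrow>
     \<zero>\<^bsub>K\<^esub> \<in> carrier K \<and> \<one>\<^bsub>K\<^esub> \<in> carrier K \<and>
     (\<forall>x\<in>carrier K. \<forall>y\<in>carrier K.
        x \<oplus>\<^bsub>K\<^esub> y \<in> carrier K \<and> x \<otimes>\<^bsub>K\<^esub> y \<in> carrier K) \<and>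
     val_O K \<subseteq> carrier K \<and>
     (\<forall>(f, n)\<in>funs L. \<forall>xs\<in>lists (carrier K). length xs = n \<longrightarrow> fn K f xs \<in> carrier K) \<and>
     (\<forall>(p, n)\<in>rvrels L. \<forall>\<xi>s\<in>rvp K p. length \<xi>s = n \<longrightarrow> \<xi>s \<in> lists (RV K))"

datatype 'f tm =
  Var nat | Zero | One | Add "'f tm" "'f tm" | Mul "'f tm" "'f tm" | Fun 'f "'f tm list"

text \<open>
  Formulas have variables of two sorts, \<open>K\<close> and \<open>RV_sort K\<close>. The atom \<open>InClass t j\<close> relates the
  two sorts: it holds if the value of \<open>t\<close> lies in the class denoted by the \<open>j\<close>-th imaginary
  variable, that is, if \<open>rv\<^sub>\<gamma>(t)\<close> equals this variable for the appropriate \<open>\<gamma>\<close>.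
\<close>

datatype ('f, 'r, 'p) fm =
    Eq "'f tm" "'f tm"
  | InO "'f tm"
  | Rel 'r "'f tm list"
  | RVRel 'p "nat list"
  | InClass "'f tm" nat
  | Neg "('f, 'r, 'p) fm"
  | Conj "('f, 'r, 'p) fm" "('f, 'r, 'p) fm"
  | Ex nat "('f, 'r, 'p) fm"
  | ExRV nat "('f, 'r, 'p) fm"

primrec eval :: "('u, 'f, 'r, 'p) vstruct \<Rightarrow> (nat \<Rightarrow> 'u) \<Rightarrow> 'f tm \<Rightarrow> 'u" where
  "eval K e (Var i) = e i"
| "eval K e Zero = \<zero>\<^bsub>K\<^esub>"
| "eval K e One = \<one>\<^bsub>K\<^esub>"
| "eval K e (Add s t) = eval K e s \<oplus>\<^bsub>K\<^esub> eval K e t"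
| "eval K e (Mul s t) = eval K e s \<otimes>\<^bsub>K\<^esub> eval K e t"
| "eval K e (Fun f ts) = fn K f (map (eval K e) ts)"

primrec sat :: "('u, 'f, 'r, 'p) vstruct \<Rightarrow> (nat \<Rightarrow> 'u) \<Rightarrow> (nat \<Rightarrow> 'u set) \<Rightarrow>
    ('f, 'r, 'p) fm \<Rightarrow> bool" where
  "sat K e z (Eq s t) \<longleftrightarrow> eval K e s = eval K e t"
| "sat K e z (InO t) \<longleftrightarrow> eval K e t \<in> val_O K"
| "sat K e z (Rel r ts) \<longleftrightarrow> map (eval K e) ts \<in> rl K r"
| "sat K e z (RVRel p js) \<longleftrightarrow> map z js \<in> rvp K p"
| "sat K e z (InClass t j) \<longleftrightarrow> eval K e t \<in> z j"
| "sat K e z (Neg \<phi>) \<longleftrightarrow> \<not> sat K e z \<phi>"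
| "sat K e z (Conj \<phi> \<psi>) \<longleftrightarrow> sat K e z \<phi> \<and> sat K e z \<psi>"
| "sat K e z (Ex i \<phi>) \<longleftrightarrow> (\<exists>x\<in>carrier K. sat K (e(i := x)) z \<phi>)"
| "sat K e z (ExRV j \<phi>) \<longleftrightarrow> (\<exists>\<xi>\<in>RV_sort K. sat K e (z(j := \<xi>)) \<phi>)"

primrec wf_tm :: "('f, 'r, 'p) lang \<Rightarrow> 'f tm \<Rightarrow> bool" where
  "wf_tm L (Var i) \<longleftrightarrow> True"
| "wf_tm L Zero \<longleftrightarrow> True"
| "wf_tm L One \<longleftrightarrow> True"
| "wf_tm L (Add s t) \<longleftrightarrow> wf_tm L s \<and> wf_tm L t"
| "wf_tm L (Mul s t) \<longleftrightarrow> wf_tm L s \<and> wf_tm L t"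
| "wf_tm L (Fun f ts) \<longleftrightarrow> (f, length ts) \<in> funs L \<and> list_all (wf_tm L) ts"

primrec wf_fm :: "('f, 'r, 'p) lang \<Rightarrow> ('f, 'r, 'p) fm \<Rightarrow> bool" where
  "wf_fm L (Eq s t) \<longleftrightarrow> wf_tm L s \<and> wf_tm L t"
| "wf_fm L (InO t) \<longleftrightarrow> wf_tm L t"
| "wf_fm L (Rel r ts) \<longleftrightarrow> (r, length ts) \<in> rels L \<and> list_all (wf_tm L) ts"
| "wf_fm L (RVRel p js) \<longleftrightarrow> (p, length js) \<in> rvrels L"
| "wf_fm L (InClass t j) \<longleftrightarrow> wf_tm L t"
| "wf_fm L (Neg \<phi>) \<longleftrightarrow> wf_fm L \<phi>"
| "wf_fm L (Conj \<phi> \<psi>) \<longleftrightarrow> wf_fm L \<phi> \<and> wf_fm L \<psi>"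
| "wf_fm L (Ex i \<phi>) \<longleftrightarrow> wf_fm L \<phi>"
| "wf_fm L (ExRV j \<phi>) \<longleftrightarrow> wf_fm L \<phi>"

primrec vars_tm :: "'f tm \<Rightarrow> nat set" where
  "vars_tm (Var i) = {i}"
| "vars_tm Zero = {}"
| "vars_tm One = {}"
| "vars_tm (Add s t) = vars_tm s \<union> vars_tm t"
| "vars_tm (Mul s t) = vars_tm s \<union> vars_tm t"
| "vars_tm (Fun f ts) = \<Union> (set (map vars_tm ts))"

text \<open>Free variables of the sort \<open>K\<close>, and of the imaginary sort.\<close>

primrec fv :: "('f, 'r, 'p) fm \<Rightarrow> nat set" where
  "fv (Eq s t) = vars_tm s \<union> vars_tm t"
| "fv (InO t) = vars_tm t"
| "fv (Rel r ts) = \<Union> (set (map vars_tm ts))"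
| "fv (RVRel p js) = {}"
| "fv (InClass t j) = vars_tm t"
| "fv (Neg \<phi>) = fv \<phi>"
| "fv (Conj \<phi> \<psi>) = fv \<phi> \<union> fv \<psi>"
| "fv (Ex i \<phi>) = fv \<phi> - {i}"
| "fv (ExRV j \<phi>) = fv \<phi>"

primrec fv_RV :: "('f, 'r, 'p) fm \<Rightarrow> nat set" where
  "fv_RV (Eq s t) = {}"
| "fv_RV (InO t) = {}"
| "fv_RV (Rel r ts) = {}"
| "fv_RV (RVRel p js) = set js"
| "fv_RV (InClass t j) = {j}"
| "fv_RV (Neg \<phi>) = fv_RV \<phi>"
| "fv_RV (Conj \<phi> \<psi>) = fv_RV \<phi> \<union> fv_RV \<psi>"
| "fv_RV (Ex i \<phi>) = fv_RV \<phi>"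
| "fv_RV (ExRV j \<phi>) = fv_RV \<phi> - {j}"

definition sentence :: "('f, 'r, 'p) lang \<Rightarrow> ('f, 'r, 'p) fm \<Rightarrow> bool" where
  "sentence L \<phi> \<longleftrightarrow> wf_fm L \<phi> \<and> fv \<phi> = {} \<and> fv_RV \<phi> = {}"

text \<open>Truth of sentences does not depend on the assignments.\<close>

definition holds :: "('u, 'f, 'r, 'p) vstruct \<Rightarrow> ('f, 'r, 'p) fm \<Rightarrow> bool" where
  "holds K \<phi> \<longleftrightarrow> (\<forall>e z. sat K e z \<phi>)"

definition Th :: "('f, 'r, 'p) lang \<Rightarrow> ('u, 'f, 'r, 'p) vstruct \<Rightarrow> ('f, 'r, 'p) fm set" where
  "Th L K = {\<phi>. sentence L \<phi> \<and> holds K \<phi>}"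

definition is_model :: "('f, 'r, 'p) lang \<Rightarrow> ('f, 'r, 'p) fm set \<Rightarrow>
    ('u, 'f, 'r, 'p) vstruct \<Rightarrow> bool" where
  "is_model L T M \<longleftrightarrow> is_structure L M \<and> (\<forall>\<phi>\<in>T. holds M \<phi>)"

text \<open>
  Definability of a subset \<open>X\<close> of \<open>K\<close> with parameters from \<open>A \<subseteq> K\<close> and \<open>Z \<subseteq> RV_sort K\<close>; the
  variable 0 of the sort \<open>K\<close> is the one that ranges over \<open>X\<close>.
\<close>

definition definable :: "('f, 'r, 'p) lang \<Rightarrow> ('u, 'f, 'r, 'p) vstruct \<Rightarrow>
    'u set \<Rightarrow> 'u set set \<Rightarrow> 'u set \<Rightarrow> bool" where
  "definable L K A Z X \<longleftrightarrow> (\<exists>\<phi> e z. wf_fm L \<phi> \<and>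
     (\<forall>i \<in> fv \<phi> - {0}. e i \<in> A) \<and> (\<forall>j \<in> fv_RV \<phi>. z j \<in> Z) \<and>
     X = {x \<in> carrier K. sat K (e(0 := x)) z \<phi>})"

section \<open>Hensel minimality\<close>

definition prepared :: "('u, 'f, 'r, 'p) vstruct \<Rightarrow> 'u set \<Rightarrow> 'u set \<Rightarrow> 'u set \<Rightarrow> bool" where
  "prepared K \<gamma> C X \<longleftrightarrow> (\<forall>x\<in>carrier K. \<forall>x'\<in>carrier K.
     (\<forall>c\<in>C. rv K \<gamma> (x \<ominus>\<^bsub>K\<^esub> c) = rv K \<gamma> (x' \<ominus>\<^bsub>K\<^esub> c)) \<longrightarrow> (x \<in> X \<longleftrightarrow> x' \<in> X))"

text \<open>
  A HOL definition cannot quantify over models in all types, so the models considered are those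
  with carrier a subset of a type \<open>'u\<close>. If \<open>'u\<close> is infinite and has at least as many elements as
  the language has symbols (see \<open>large_universe\<close> below), then the definition does not depend on
  \<open>'u\<close>: one may take \<open>A\<close> finite, and then a failure in one model is inherited by every elementary
  substructure containing \<open>A\<close>, representatives of the imaginary parameters and an element of
  value \<open>\<gamma>\<close>.
\<close>

definition h_minimal :: "'u itself \<Rightarrow> ('f, 'r, 'p) lang \<Rightarrow> nat \<Rightarrow> ('f, 'r, 'p) fm set \<Rightarrow> bool" where
  "h_minimal U L l T \<longleftrightarrow> (\<forall>K :: ('u, 'f, 'r, 'p) vstruct. is_model L T K \<longrightarrow>
     equichar0_valued_field K \<and>
     (\<forall>\<gamma> A A' X. \<gamma> \<in> value_group K \<and> val_le K \<gamma> (val_one K) \<and>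
        A \<subseteq> carrier K \<and> A' \<subseteq> RV_at K \<gamma> \<and> finite A' \<and> card A' \<le> l \<and>
        definable L K A (RV K \<union> A') X \<longrightarrow>
        (\<exists>C. finite C \<and> definable L K A {} C \<and> prepared K \<gamma> C X)))"

definition large_universe :: "'u itself \<Rightarrow> ('f, 'r, 'p) lang \<Rightarrow> bool" where
  "large_universe U L \<longleftrightarrow> infinite (UNIV :: 'u set) \<and>
     (funs L <+> rels L <+> rvrels L) \<lesssim> (UNIV :: 'u set)"

definition RV_expansion :: "('f, 'r, 'p) lang \<Rightarrow> ('f, 'r, 'p) lang \<Rightarrow> bool" where
  "RV_expansion L L' \<longleftrightarrow> funs L' = funs L \<and> rels L' = rels L \<and> rvrels L \<subseteq> rvrels L'"

end

theory Submission
  imports Defs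
begin

text \<open>
  It suffices to \<open>\<lambda>\<close>-prepare a set \<open>X\<close> that is definable in the expansion by a finite set that is
  definable in the original language. Over a saturated model one would move \<open>x\<close> to \<open>x'\<close> by an
  automorphism of the original structure that fixes the parameters and \<open>RV\<close> pointwise; it respects
  all predicates on \<open>RV\<close>. Here stable embeddedness of \<open>RV\<close> replaces the automorphism: the trace on
  \<open>RV\<close> of a formula of the original language with parameters in \<open>K\<close> is definable with parameters in
  \<open>RV\<close>, uniformly. To eliminate one parameter \<open>x\<close>, take a finite set \<open>C\<close>, definable from the other
  parameters, that prepares the formula for all values of its \<open>RV\<close>-variables. Then \<open>x\<close> matters only
  through \<open>rv(x - c)\<close> for the nearest \<open>c \<in> C\<close>, and finitely many elements of \<open>RV\<close> distinguish \<open>c\<close>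
  from those points of \<open>C\<close> that give a different trace. As one can quantify over codes of traces,
  induction on formulas shows that the truth of a formula of the expansion depends only on the trace
  of one formula of the original language.

  Uniformity comes from compactness. The models must live in the type \<open>'u\<close>, so the proof of
  compactness uses ultrapowers restricted to a set of functions that is closed under Skolem functions
  and has at most as many elements as \<open>'u\<close>.
\<close>

section \<open>Substitution of variables\<close>

text \<open>The obstacle is that the parameters \<open>A'\<close> lie in RV at \<lambda>, not in RV,
  while preparation admits only \<open>l\<close> of them. They are therefore treated like field
  variables: every imaginary element is given by a representative, the representatives are
  eliminated together with the other field variables, and only at the end they are quantified away,
  so that just the elements of \<open>A'\<close> themselves remain as parameters. A code of a trace
  is a tuple \<open>\<rho>\<close> of elements of RV, read by a formula without free field
  variables. In this form codes mean the same for all assignments of the field variables, can be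
  quantified over, and may enter a preparation as parameters, since RV is allowed there in full.
  Both applications of compactness, to preparation and to elimination, need the hypothesis in all
  models elementarily equivalent to the given one; this is why it is carried along in the locale
  \<open>hmin_model\<close>.\<close>

primrec ren_tm :: "'f tm \<Rightarrow> (nat \<Rightarrow> nat) \<Rightarrow> 'f tm" where
  "ren_tm (Var i) \<tau> = Var (\<tau> i)"
| "ren_tm Zero \<tau> = Zero"
| "ren_tm One \<tau> = One"
| "ren_tm (Add s t) \<tau> = Add (ren_tm s \<tau>) (ren_tm t \<tau>)"
| "ren_tm (Mul s t) \<tau> = Mul (ren_tm s \<tau>) (ren_tm t \<tau>)"
| "ren_tm (Fun f ts) \<tau> = Fun f (map (\<lambda>g. g \<tau>) (map ren_tm ts))"

definition fresh :: "nat set \<Rightarrow> nat" where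
  "fresh S = (SOME k. k \<notin> S)"

lemma fresh_notin: "finite S \<Longrightarrow> fresh S \<notin> S"
  unfolding fresh_def by (rule someI_ex) (metis ex_new_if_finite infinite_UNIV_nat)

text \<open>The maps need not be injective: later uses merge, move and shift variables. A bound
  variable is renamed to one outside the images of the other free variables, which excludes
  capture.\<close>

primrec ren :: "('f, 'r, 'p) fm \<Rightarrow> (nat \<Rightarrow> nat) \<Rightarrow> (nat \<Rightarrow> nat) \<Rightarrow> ('f, 'r, 'p) fm" where
  "ren (Eq s t) \<tau> \<sigma> = Eq (ren_tm s \<tau>) (ren_tm t \<tau>)"
| "ren (InO t) \<tau> \<sigma> = InO (ren_tm t \<tau>)"
| "ren (Rel r ts) \<tau> \<sigma> = Rel r (map (\<lambda>t. ren_tm t \<tau>) ts)"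
| "ren (RVRel p js) \<tau> \<sigma> = RVRel p (map \<sigma> js)"
| "ren (InClass t j) \<tau> \<sigma> = InClass (ren_tm t \<tau>) (\<sigma> j)"
| "ren (Neg \<phi>) \<tau> \<sigma> = Neg (ren \<phi> \<tau> \<sigma>)"
| "ren (Conj \<phi> \<psi>) \<tau> \<sigma> = Conj (ren \<phi> \<tau> \<sigma>) (ren \<psi> \<tau> \<sigma>)"
| "ren (Ex i \<phi>) \<tau> \<sigma> =
     (let k = fresh (\<tau> ` (fv \<phi> - {i})) in Ex k (ren \<phi> (\<tau>(i := k)) \<sigma>))"
| "ren (ExRV j \<phi>) \<tau> \<sigma> =
     (let k = fresh (\<sigma> ` (fv_RV \<phi> - {j})) in ExRV k (ren \<phi> \<tau> (\<sigma>(j := k))))"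

lemma finite_vars_tm: "finite (vars_tm t)"
  by (induction t) auto

lemma finite_fv: "finite (fv \<phi>)"
  by (induction \<phi>) (auto simp: finite_vars_tm)

lemma finite_fv_RV: "finite (fv_RV \<phi>)"
  by (induction \<phi>) auto

lemma eval_cong: "(\<And>i. i \<in> vars_tm t \<Longrightarrow> e i = e' i) \<Longrightarrow> eval N e t = eval N e' t"
proof (induction t)
  case (Fun f ts)
  then have "map (eval N e) ts = map (eval N e') ts"
    by (intro map_cong refl Fun.IH Fun.prems) auto
  then show ?case by (simp only: eval.simps)
qed auto

lemma sat_cong:
  assumes "\<And>i. i \<in> fv \<phi> \<Longrightarrow> e i = e' i" "\<And>j. j \<in> fv_RV \<phi> \<Longrightarrow> z j = z' j"
  shows "sat N e z \<phi> \<longleftrightarrow> sat N e' z' \<phi>"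
  using assms
proof (induction \<phi> arbitrary: e e' z z')
  case (Eq s t)
  then show ?case by (simp add: eval_cong[of s e e'] eval_cong[of t e e'])
next
  case (InO t)
  then show ?case by (simp add: eval_cong[of t e e'])
next
  case (Rel r ts)
  then have "map (eval N e) ts = map (eval N e') ts"
    by (intro map_cong refl eval_cong) auto
  then show ?case by (simp only: sat.simps)
next
  case (RVRel p js)
  then have "map z js = map z' js"
    by (intro map_cong refl) auto
  then show ?case by (simp only: sat.simps)
next
  case (InClass t j)
  then show ?case by (simp add: eval_cong[of t e e'])
next
  case (Neg \<phi>)
  from Neg.IH[of e e' z z'] Neg.prems show ?case by simp
next
  case (Conj \<phi> \<psi>)
  from Conj.IH(1)[of e e' z z'] Conj.IH(2)[of e e' z z'] Conj.prems show ?case by simp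
next
  case (Ex i \<phi>)
  have "sat N (e(i := x)) z \<phi> = sat N (e'(i := x)) z' \<phi>" for x
    by (rule Ex.IH) (use Ex.prems in auto)
  then show ?case by simp
next
  case (ExRV j \<phi>)
  have "sat N e (z(j := x)) \<phi> = sat N e' (z'(j := x)) \<phi>" for x
    by (rule ExRV.IH) (use ExRV.prems in auto)
  then show ?case by simp
qed

lemma eval_ren: "eval N e (ren_tm t \<tau>) = eval N (e \<circ> \<tau>) t"
proof (induction t)
  case (Fun f ts)
  then show ?case by (simp add: comp_def cong: map_cong)
qed auto

lemma sat_ren: "sat N e z (ren \<phi> \<tau> \<sigma>) \<longleftrightarrow> sat N (e \<circ> \<tau>) (z \<circ> \<sigma>) \<phi>"
proof (induction \<phi> arbitrary: e z \<tau> \<sigma>)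
  case (Rel r ts)
  have "map (eval N e) (map (\<lambda>t. ren_tm t \<tau>) ts) = map (eval N (e \<circ> \<tau>)) ts"
    by (simp add: eval_ren)
  then show ?case by (simp only: sat.simps ren.simps)
next
  case (Ex i \<phi>)
  define k where "k = fresh (\<tau> ` (fv \<phi> - {i}))"
  have k: "k \<notin> \<tau> ` (fv \<phi> - {i})"
    unfolding k_def by (rule fresh_notin) (simp add: finite_fv)
  have "sat N (e(k := x)) z (ren \<phi> (\<tau>(i := k)) \<sigma>) = sat N ((e \<circ> \<tau>)(i := x)) (z \<circ> \<sigma>) \<phi>" for x
    unfolding Ex.IH by (rule sat_cong) (use k in auto)
  then show ?case by (simp add: k_def[symmetric] Let_def comp_def)
next
  case (ExRV j \<phi>)
  define k where "k = fresh (\<sigma> ` (fv_RV \<phi> - {j}))"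
  have k: "k \<notin> \<sigma> ` (fv_RV \<phi> - {j})"
    unfolding k_def by (rule fresh_notin) (simp add: finite_fv_RV)
  have "sat N e (z(k := x)) (ren \<phi> \<tau> (\<sigma>(j := k))) = sat N (e \<circ> \<tau>) ((z \<circ> \<sigma>)(j := x)) \<phi>" for x
    unfolding ExRV.IH by (rule sat_cong) (use k in auto)
  then show ?case by (simp add: k_def[symmetric] Let_def comp_def)
qed (simp_all add: eval_ren)

lemma vars_ren: "vars_tm (ren_tm t \<tau>) = \<tau> ` vars_tm t"
  by (induction t) (auto simp: image_UN)

lemma fv_ren: "fv (ren \<phi> \<tau> \<sigma>) \<subseteq> \<tau> ` fv \<phi>"
proof (induction \<phi> arbitrary: \<tau> \<sigma>)
  case (Ex i \<phi>)
  define k where "k = fresh (\<tau> ` (fv \<phi> - {i}))"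
  have "(\<tau>(i := k)) ` fv \<phi> - {k} \<subseteq> \<tau> ` (fv \<phi> - {i})" by auto
  with Ex.IH[of "\<tau>(i := k)" \<sigma>] show ?case
    by (simp add: k_def[symmetric] Let_def del: fun_upd_apply) blast
next
  case (Conj \<phi> \<psi>)
  from Conj.IH(1)[of \<tau> \<sigma>] Conj.IH(2)[of \<tau> \<sigma>] show ?case by auto
next
  case (ExRV j \<phi>)
  show ?case
    using ExRV.IH[of \<tau> "\<sigma>(j := fresh (\<sigma> ` (fv_RV \<phi> - {j})))"] by (auto simp: Let_def simp del: fun_upd_apply)
qed (auto simp: vars_ren)

lemma fv_RV_ren: "fv_RV (ren \<phi> \<tau> \<sigma>) \<subseteq> \<sigma> ` fv_RV \<phi>"
proof (induction \<phi> arbitrary: \<tau> \<sigma>)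
  case (Ex i \<phi>)
  show ?case
    using Ex.IH[of "\<tau>(i := fresh (\<tau> ` (fv \<phi> - {i})))" \<sigma>] by (auto simp: Let_def simp del: fun_upd_apply)
next
  case (Conj \<phi> \<psi>)
  from Conj.IH(1)[of \<tau> \<sigma>] Conj.IH(2)[of \<tau> \<sigma>] show ?case by auto
next
  case (ExRV j \<phi>)
  define k where "k = fresh (\<sigma> ` (fv_RV \<phi> - {j}))"
  have "(\<sigma>(j := k)) ` fv_RV \<phi> - {k} \<subseteq> \<sigma> ` (fv_RV \<phi> - {j})" by auto
  with ExRV.IH[of \<tau> "\<sigma>(j := k)"] show ?case
    by (simp add: k_def[symmetric] Let_def del: fun_upd_apply) blast
qed auto

lemma wf_ren_tm: "wf_tm L t \<Longrightarrow> wf_tm L (ren_tm t \<tau>)"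
  by (induction t) (auto simp: list_all_iff)

lemma wf_ren: "wf_fm L \<phi> \<Longrightarrow> wf_fm L (ren \<phi> \<tau> \<sigma>)"
  by (induction \<phi> arbitrary: \<tau> \<sigma>) (auto simp: wf_ren_tm list_all_iff Let_def)

section \<open>Derived connectives\<close>

definition Iff :: "('f, 'r, 'p) fm \<Rightarrow> ('f, 'r, 'p) fm \<Rightarrow> ('f, 'r, 'p) fm" where
  "Iff \<phi> \<psi> = Conj (Neg (Conj \<phi> (Neg \<psi>))) (Neg (Conj \<psi> (Neg \<phi>)))"

definition Imp :: "('f, 'r, 'p) fm \<Rightarrow> ('f, 'r, 'p) fm \<Rightarrow> ('f, 'r, 'p) fm" where
  "Imp \<phi> \<psi> = Neg (Conj \<phi> (Neg \<psi>))"

definition Disj :: "('f, 'r, 'p) fm \<Rightarrow> ('f, 'r, 'p) fm \<Rightarrow> ('f, 'r, 'p) fm" where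
  "Disj \<phi> \<psi> = Neg (Conj (Neg \<phi>) (Neg \<psi>))"

definition All :: "nat \<Rightarrow> ('f, 'r, 'p) fm \<Rightarrow> ('f, 'r, 'p) fm" where
  "All i \<phi> = Neg (Ex i (Neg \<phi>))"

definition Conjs :: "('f, 'r, 'p) fm list \<Rightarrow> ('f, 'r, 'p) fm" where
  "Conjs \<phi>s = foldr Conj \<phi>s (Eq Zero Zero)"

definition Exs :: "nat list \<Rightarrow> ('f, 'r, 'p) fm \<Rightarrow> ('f, 'r, 'p) fm" where
  "Exs is \<phi> = foldr Ex is \<phi>"

lemma Iff_simps [simp]:
  "sat N e z (Iff \<phi> \<psi>) \<longleftrightarrow> (sat N e z \<phi> \<longleftrightarrow> sat N e z \<psi>)"
  "fv (Iff \<phi> \<psi>) = fv \<phi> \<union> fv \<psi>"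
  "fv_RV (Iff \<phi> \<psi>) = fv_RV \<phi> \<union> fv_RV \<psi>"
  "wf_fm L (Iff \<phi> \<psi>) \<longleftrightarrow> wf_fm L \<phi> \<and> wf_fm L \<psi>"
  by (auto simp: Iff_def)

lemma Imp_simps [simp]:
  "sat N e z (Imp \<phi> \<psi>) \<longleftrightarrow> (sat N e z \<phi> \<longrightarrow> sat N e z \<psi>)"
  "fv (Imp \<phi> \<psi>) = fv \<phi> \<union> fv \<psi>"
  "fv_RV (Imp \<phi> \<psi>) = fv_RV \<phi> \<union> fv_RV \<psi>"
  "wf_fm L (Imp \<phi> \<psi>) \<longleftrightarrow> wf_fm L \<phi> \<and> wf_fm L \<psi>"
  by (auto simp: Imp_def)

lemma Disj_simps [simp]:
  "sat N e z (Disj \<phi> \<psi>) \<longleftrightarrow> (sat N e z \<phi> \<or> sat N e z \<psi>)"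
  "fv (Disj \<phi> \<psi>) = fv \<phi> \<union> fv \<psi>"
  "fv_RV (Disj \<phi> \<psi>) = fv_RV \<phi> \<union> fv_RV \<psi>"
  "wf_fm L (Disj \<phi> \<psi>) \<longleftrightarrow> wf_fm L \<phi> \<and> wf_fm L \<psi>"
  by (auto simp: Disj_def)

lemma All_simps [simp]:
  "sat N e z (All i \<phi>) \<longleftrightarrow> (\<forall>x\<in>carrier N. sat N (e(i := x)) z \<phi>)"
  "fv (All i \<phi>) = fv \<phi> - {i}"
  "fv_RV (All i \<phi>) = fv_RV \<phi>"
  "wf_fm L (All i \<phi>) \<longleftrightarrow> wf_fm L \<phi>"
  by (auto simp: All_def)

lemma Conjs_simps [simp]:
  "sat N e z (Conjs \<phi>s) \<longleftrightarrow> (\<forall>\<phi>\<in>set \<phi>s. sat N e z \<phi>)"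
  "fv (Conjs \<phi>s) = \<Union> (fv ` set \<phi>s)"
  "fv_RV (Conjs \<phi>s) = \<Union> (fv_RV ` set \<phi>s)"
  "wf_fm L (Conjs \<phi>s) \<longleftrightarrow> (\<forall>\<phi>\<in>set \<phi>s. wf_fm L \<phi>)"
  by (induction \<phi>s) (auto simp: Conjs_def)

lemma Exs_simps [simp]:
  "fv (Exs is \<phi>) = fv \<phi> - set is"
  "fv_RV (Exs is \<phi>) = fv_RV \<phi>"
  "wf_fm L (Exs is \<phi>) \<longleftrightarrow> wf_fm L \<phi>"
  by (induction "is") (auto simp: Exs_def)

lemma sat_Exs:
  assumes "\<And>i. e i \<in> carrier N"
  shows "sat N e z (Exs is \<phi>) \<longleftrightarrow>
    (\<exists>e'. (\<forall>i. e' i \<in> carrier N) \<and> sat N (override_on e e' (set is)) z \<phi>)"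
  using assms
proof (induction "is" arbitrary: e)
  case Nil
  then show ?case by (auto simp: Exs_def)
next
  case (Cons i "is")
  have "sat N e z (Exs (i # is) \<phi>) \<longleftrightarrow> (\<exists>x\<in>carrier N. sat N (e(i := x)) z (Exs is \<phi>))"
    by (simp add: Exs_def)
  also have "\<dots> \<longleftrightarrow> (\<exists>x\<in>carrier N. \<exists>e'. (\<forall>i. e' i \<in> carrier N) \<and>
      sat N (override_on (e(i := x)) e' (set is)) z \<phi>)"
    by (intro bex_cong refl Cons.IH) (auto simp: Cons.prems)
  also have "\<dots> \<longleftrightarrow> (\<exists>e'. (\<forall>i. e' i \<in> carrier N) \<and>
      sat N (override_on e e' (set (i # is))) z \<phi>)" (is "?l \<longleftrightarrow> ?r")
  proof
    assume ?l
    then obtain x e' where x: "x \<in> carrier N" "\<forall>i. e' i \<in> carrier N"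
      "sat N (override_on (e(i := x)) e' (set is)) z \<phi>" by blast
    \<comment> \<open>\<open>is\<close> may contain \<open>i\<close> once more; then the inner
      quantifier determines its value and \<open>x\<close> is discarded.\<close>
    have "override_on (e(i := x)) e' (set is) =
        override_on e (if i \<in> set is then e' else e'(i := x)) (set (i # is))"
      by (auto simp: override_on_def)
    with x show ?r by (intro exI[of _ "if i \<in> set is then e' else e'(i := x)"]) auto
  next
    assume ?r
    then obtain e' where x: "\<forall>i. e' i \<in> carrier N"
      "sat N (override_on e e' (set (i # is))) z \<phi>" by blast
    have "override_on e e' (set (i # is)) = override_on (e(i := e' i)) e' (set is)"
      by (auto simp: override_on_def)
    with x show ?l by metis
  qed
  finally show ?case .
qed

section \<open>Valued fields\<close>

text \<open>The elements of absolute value below 1, described by ring operations and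
  \<open>val_O\<close> alone, as a formula on the field has to do.\<close>

definition max_ideal :: "('u, 'f, 'r, 'p) vstruct \<Rightarrow> 'u set" where
  "max_ideal N = {m \<in> val_O N. \<forall>u\<in>val_O N. m \<otimes>\<^bsub>N\<^esub> u \<noteq> \<one>\<^bsub>N\<^esub>}"

locale vfield =
  fixes N :: "('u, 'f, 'r, 'p) vstruct" (structure)
  assumes valued: "valued_field N"
begin

sublocale field N
  using valued by (simp add: valued_field_def)

lemma O_subring: "subring (val_O N) N"
  using valued by (simp add: valued_field_def)

lemma O_closed [simp]:
  "x \<in> val_O N \<Longrightarrow> x \<in> carrier N"
  "\<zero> \<in> val_O N" "\<one> \<in> val_O N"
  "x \<in> val_O N \<Longrightarrow> y \<in> val_O N \<Longrightarrow> x \<oplus> y \<in> val_O N"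
  "x \<in> val_O N \<Longrightarrow> y \<in> val_O N \<Longrightarrow> x \<otimes> y \<in> val_O N"
  "x \<in> val_O N \<Longrightarrow> \<ominus> x \<in> val_O N"
  using O_subring subringE[OF O_subring] by auto

lemma inv_nz [simp]:
  assumes "x \<in> carrier N" "x \<noteq> \<zero>"
  shows "inv x \<in> carrier N" "x \<otimes> inv x = \<one>" "inv x \<otimes> x = \<one>" "inv x \<noteq> \<zero>"
proof -
  have u: "x \<in> Units N" using assms by (simp add: field_Units)
  then show "inv x \<in> carrier N" "x \<otimes> inv x = \<one>" "inv x \<otimes> x = \<one>" by auto
  then show "inv x \<noteq> \<zero>" using assms by auto
qed

lemma inv_cancel [simp]:
  assumes "x \<in> carrier N" "x \<noteq> \<zero>" "y \<in> carrier N"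
  shows "x \<otimes> (inv x \<otimes> y) = y" "inv x \<otimes> (x \<otimes> y) = y"
  using assms by (simp_all add: m_assoc[symmetric])

lemma O_total: "x \<in> carrier N \<Longrightarrow> x \<noteq> \<zero> \<Longrightarrow> x \<in> val_O N \<or> inv x \<in> val_O N"
  using valued by (auto simp: valued_field_def)

lemma Units_val_ring:
  "u \<in> Units (val_ring N) \<longleftrightarrow> u \<in> val_O N \<and> (\<exists>v\<in>val_O N. u \<otimes> v = \<one>)"
  by (auto simp: Units_def val_ring_def m_comm)

lemma max_idealD [simp]: "m \<in> max_ideal N \<Longrightarrow> m \<in> val_O N" "m \<in> max_ideal N \<Longrightarrow> m \<in> carrier N"
  by (auto simp: max_ideal_def)

lemma zero_max_ideal [simp]: "\<zero> \<in> max_ideal N"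
  by (auto simp: max_ideal_def simp del: max_idealD)

lemma max_ideal_mult:
  assumes "m \<in> max_ideal N" "a \<in> val_O N"
  shows "m \<otimes> a \<in> max_ideal N" "a \<otimes> m \<in> max_ideal N"
proof -
  show 1: "m \<otimes> a \<in> max_ideal N"
    using assms by (auto simp: max_ideal_def m_assoc simp del: max_idealD)
  then show "a \<otimes> m \<in> max_ideal N"
    using assms by (simp add: m_comm[of a m])
qed

lemma max_ideal_neg: "m \<in> max_ideal N \<Longrightarrow> \<ominus> m \<in> max_ideal N"
  using max_ideal_mult(1)[of m "\<ominus> \<one>"] by (simp add: r_minus)

text \<open>Of two nonzero elements one is a multiple of the other by an element of
  \<open>val_O N\<close>, so the sum is a multiple of the larger one.\<close>

lemma max_ideal_add:
  assumes "m \<in> max_ideal N" "n \<in> max_ideal N"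
  shows "m \<oplus> n \<in> max_ideal N"
proof -
  have *: "x \<oplus> y \<in> max_ideal N"
    if xy: "x \<in> max_ideal N" "y \<in> max_ideal N" "y \<noteq> \<zero>" and a: "x \<otimes> inv y \<in> val_O N" for x y
  proof -
    have c: "x \<in> carrier N" "y \<in> carrier N" using xy by auto
    have "(x \<otimes> inv y \<oplus> \<one>) \<otimes> y = x \<otimes> (inv y \<otimes> y) \<oplus> y"
      using c xy(3) by (simp add: l_distr m_assoc)
    also have "\<dots> = x \<oplus> y" using c xy(3) by simp
    finally show ?thesis
      using max_ideal_mult(2)[OF xy(2), of "x \<otimes> inv y \<oplus> \<one>"] a by auto
  qed
  show ?thesis
  proof (cases "m = \<zero> \<or> n = \<zero>")
    case True
    then show ?thesis using assms by auto
  next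
    case False
    have c: "m \<in> carrier N" "n \<in> carrier N" using assms by auto
    have nz: "m \<otimes> inv n \<noteq> \<zero>"
      using False c by (simp add: integral_iff)
    have "(m \<otimes> inv n) \<otimes> (n \<otimes> inv m) = \<one>"
      using c False by (simp add: m_assoc)
    then have i: "inv (m \<otimes> inv n) = n \<otimes> inv m"
      using c False by (intro comm_inv_char) auto
    from O_total[OF _ nz] c False have "m \<otimes> inv n \<in> val_O N \<or> n \<otimes> inv m \<in> val_O N"
      by (simp add: i)
    then show ?thesis
      using *[of m n] *[of n m] assms False c by (auto simp: a_comm)
  qed
qed

lemma one_add_max_ideal:
  assumes "m \<in> max_ideal N"
  shows "\<exists>s\<in>val_O N. (\<one> \<oplus> m) \<otimes> s = \<one>"
proof (rule ccontr)
  assume "\<not> ?thesis"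
  then have "\<one> \<oplus> m \<in> max_ideal N" using assms max_idealD(1)[OF assms] by (auto simp: max_ideal_def simp del: max_idealD)
  then have "(\<one> \<oplus> m) \<oplus> \<ominus> m \<in> max_ideal N"
    by (rule max_ideal_add[OF _ max_ideal_neg[OF assms]])
  moreover have "(\<one> \<oplus> m) \<oplus> \<ominus> m = \<one>"
    using assms by (simp add: a_assoc r_neg)
  ultimately have "\<one> \<in> max_ideal N" by simp
  then show False using O_closed(3) by (auto simp: max_ideal_def simp del: max_idealD)
qed

end

text \<open>For \<open>scale N d\<close> this is membership of \<open>y\<close> in the class of
  \<open>c\<close> in RV at |d|: the elements smaller than |d| are the products m d with m in the
  maximal ideal. Neither values nor imaginary elements occur in this form, so it becomes the formula
  \<open>memF0\<close>.\<close>

definition near :: "('u, 'f, 'r, 'p) vstruct \<Rightarrow> 'u \<Rightarrow> 'u \<Rightarrow> 'u \<Rightarrow> bool" where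
  "near N d c y \<longleftrightarrow> (\<exists>m\<in>max_ideal N. y = c \<otimes>\<^bsub>N\<^esub> (\<one>\<^bsub>N\<^esub> \<oplus>\<^bsub>N\<^esub> m \<otimes>\<^bsub>N\<^esub> d))"

definition scale :: "('u, 'f, 'r, 'p) vstruct \<Rightarrow> 'u \<Rightarrow> bool" where
  "scale N d \<longleftrightarrow> d \<in> val_O N \<and> d \<noteq> \<zero>\<^bsub>N\<^esub>"

context vfield
begin

lemma scaleD [simp]: "scale N d \<Longrightarrow> d \<in> carrier N" "scale N d \<Longrightarrow> d \<in> val_O N" "scale N d \<Longrightarrow> d \<noteq> \<zero>"
  by (auto simp: scale_def)

lemma scale_one [simp]: "scale N \<one>"
  by (simp add: scale_def)

lemma near_closed: "near N d c y \<Longrightarrow> scale N d \<Longrightarrow> c \<in> carrier N \<Longrightarrow> y \<in> carrier N"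
  by (auto simp: near_def)

lemma near_refl: "scale N d \<Longrightarrow> c \<in> carrier N \<Longrightarrow> near N d c c"
  unfolding near_def by (rule bexI[of _ "\<zero>"]) auto

lemma near_trans:
  assumes "scale N d" "c \<in> carrier N" "near N d c x" "near N d x y"
  shows "near N d c y"
proof -
  from assms obtain m n where m: "m \<in> max_ideal N" "x = c \<otimes> (\<one> \<oplus> m \<otimes> d)"
    and n: "n \<in> max_ideal N" "y = x \<otimes> (\<one> \<oplus> n \<otimes> d)"
    by (auto simp: near_def)
  have cl: "m \<in> carrier N" "n \<in> carrier N" "d \<in> carrier N" using m n assms(1) by auto
  let ?k = "m \<oplus> n \<oplus> m \<otimes> n \<otimes> d"
  have "(\<one> \<oplus> m \<otimes> d) \<otimes> (\<one> \<oplus> n \<otimes> d) = \<one> \<oplus> ?k \<otimes> d"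
    using cl by algebra
  then have "y = c \<otimes> (\<one> \<oplus> ?k \<otimes> d)"
    using cl assms(2) by (simp add: m(2) n(2) m_assoc)
  moreover have "?k \<in> max_ideal N"
    using m n assms(1) by (intro max_ideal_add max_ideal_mult) auto
  ultimately show ?thesis by (auto simp: near_def)
qed

lemma near_sym:
  assumes "scale N d" "c \<in> carrier N" "near N d c x"
  shows "near N d x c"
proof -
  from assms obtain m where m: "m \<in> max_ideal N" "x = c \<otimes> (\<one> \<oplus> m \<otimes> d)"
    by (auto simp: near_def)
  have "m \<otimes> d \<in> max_ideal N"
    using m assms(1) by (intro max_ideal_mult) auto
  then obtain s where s: "s \<in> val_O N" "(\<one> \<oplus> m \<otimes> d) \<otimes> s = \<one>"
    using one_add_max_ideal by blast
  have cl: "m \<in> carrier N" "s \<in> carrier N" "d \<in> carrier N" using m s assms(1) by auto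
  \<comment> \<open>The inverse s = 1 - m s d of 1 + m d is again of the required form.\<close>
  have "\<one> \<oplus> (\<ominus> (m \<otimes> s)) \<otimes> d = s"
  proof -
    have "s \<oplus> m \<otimes> d \<otimes> s = \<one>" using s(2) cl by (simp add: l_distr)
    then have "\<one> \<oplus> (\<ominus> (m \<otimes> s)) \<otimes> d = (s \<oplus> m \<otimes> d \<otimes> s) \<oplus> (\<ominus> (m \<otimes> s)) \<otimes> d" by simp
    also have "\<dots> = s" using cl by algebra
    finally show ?thesis .
  qed
  then have "x \<otimes> (\<one> \<oplus> (\<ominus> (m \<otimes> s)) \<otimes> d) = c"
    using s(2) cl assms(2) by (simp add: m(2) m_assoc)
  moreover have "\<ominus> (m \<otimes> s) \<in> max_ideal N"
    using m s by (intro max_ideal_neg max_ideal_mult) auto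
  ultimately show ?thesis by (auto simp: near_def)
qed

section \<open>Values, balls and classes in terms of divisibility\<close>

lemma unit_cancel:
  assumes "u \<in> carrier N" "v \<in> carrier N" "u \<otimes> v = \<one>" "y \<in> carrier N"
  shows "u \<otimes> (v \<otimes> y) = y" "v \<otimes> (u \<otimes> y) = y"
  using assms by (simp_all add: m_assoc[symmetric] m_comm[of v u])

lemma val_eq_iff:
  assumes "x \<in> carrier N" "y \<in> carrier N"
  shows "val N x = val N y \<longleftrightarrow> (\<exists>u\<in>Units (val_ring N). x = u \<otimes> y)"
proof
  assume eq: "val N x = val N y"
  have "x \<in> val N x"
    using assms unfolding val_def by (auto simp: Units_val_ring intro!: exI[of _ "\<one>"])
  then show "\<exists>u\<in>Units (val_ring N). x = u \<otimes> y" unfolding eq by (auto simp: val_def)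
next
  assume "\<exists>u\<in>Units (val_ring N). x = u \<otimes> y"
  then obtain u v where u: "u \<in> val_O N" "v \<in> val_O N" "u \<otimes> v = \<one>" "x = u \<otimes> y"
    by (auto simp: Units_val_ring)
  have mult: "a \<otimes> b \<in> Units (val_ring N)" if "a \<in> Units (val_ring N)" "b \<in> Units (val_ring N)" for a b
  proof -
    from that obtain a' b' where *: "a \<in> val_O N" "b \<in> val_O N" "a' \<in> val_O N" "b' \<in> val_O N"
      "a \<otimes> a' = \<one>" "b \<otimes> b' = \<one>" by (auto simp: Units_val_ring)
    then have "(a \<otimes> b) \<otimes> (b' \<otimes> a') = \<one>" by (simp add: m_assoc unit_cancel(1)[of b b'])
    then show ?thesis
      unfolding Units_val_ring by (intro conjI bexI[of _ "b' \<otimes> a'"]) (use * in auto)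
  qed
  have U: "u \<in> Units (val_ring N)" "v \<in> Units (val_ring N)"
    using u m_comm[of v u] by (auto simp: Units_val_ring)
  have "a \<otimes> x \<in> val N y" if "a \<in> Units (val_ring N)" for a
  proof -
    have "a \<in> val_O N" using that by (simp add: Units_val_ring)
    then have "a \<otimes> x = (a \<otimes> u) \<otimes> y" using u assms by (simp add: m_assoc)
    then show ?thesis using mult[OF that U(1)] by (auto simp: val_def)
  qed
  moreover have "a \<otimes> y \<in> val N x" if "a \<in> Units (val_ring N)" for a
  proof -
    have "a \<in> val_O N" using that by (simp add: Units_val_ring)
    then have "a \<otimes> y = (a \<otimes> v) \<otimes> x"
      using u(1,2,3) assms by (simp add: u(4) m_assoc unit_cancel(2)[of u v])
    then show ?thesis using mult[OF that U(2)] by (auto simp: val_def)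
  qed
  ultimately show "val N x = val N y" by (auto simp: val_def)
qed

lemma val_le_iff:
  assumes "x \<in> carrier N" "y \<in> carrier N"
  shows "val_le N (val N x) (val N y) \<longleftrightarrow> (\<exists>a\<in>val_O N. x = a \<otimes> y)"
proof
  assume "val_le N (val N x) (val N y)"
  then obtain u v a where *: "u \<in> Units (val_ring N)" "v \<in> Units (val_ring N)" "a \<in> val_O N"
    "u \<otimes> x = a \<otimes> (v \<otimes> y)" by (auto simp: val_le_def val_def)
  then obtain u' where u': "u' \<in> val_O N" "u \<otimes> u' = \<one>" "u \<in> val_O N" "v \<in> val_O N"
    by (auto simp: Units_val_ring)
  have "x = u' \<otimes> (u \<otimes> x)" using unit_cancel(2)[of u u' x] u' assms by simp
  also have "\<dots> = (u' \<otimes> a \<otimes> v) \<otimes> y" using * u' assms by (simp add: m_assoc)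
  finally show "\<exists>a\<in>val_O N. x = a \<otimes> y" by (rule bexI) (use * u' in simp)
next
  assume "\<exists>a\<in>val_O N. x = a \<otimes> y"
  moreover have "x \<in> val N x" "y \<in> val N y"
    using assms unfolding val_def by (auto simp: Units_val_ring intro!: exI[of _ "\<one>"])
  ultimately show "val_le N (val N x) (val N y)" unfolding val_le_def by blast
qed

lemma val_le_one_iff: "d \<in> carrier N \<Longrightarrow> val_le N (val N d) (val_one N) \<longleftrightarrow> d \<in> val_O N"
  unfolding val_one_def by (subst val_le_iff) auto

lemma val_less_iff:
  assumes "b \<in> carrier N" "d \<in> carrier N" "d \<noteq> \<zero>"
  shows "val_less N (val N b) (val N d) \<longleftrightarrow> (\<exists>m\<in>max_ideal N. b = m \<otimes> d)"
proof
  assume "val_less N (val N b) (val N d)"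
  then obtain a where a: "a \<in> val_O N" "b = a \<otimes> d" and ne: "val N b \<noteq> val N d"
    using assms by (auto simp: val_less_def val_le_iff)
  have "a \<notin> Units (val_ring N)" using ne a(2) val_eq_iff[OF assms(1,2)] by auto
  then have "a \<in> max_ideal N" using a(1) by (auto simp: Units_val_ring max_ideal_def simp del: max_idealD)
  with a show "\<exists>m\<in>max_ideal N. b = m \<otimes> d" by blast
next
  assume "\<exists>m\<in>max_ideal N. b = m \<otimes> d"
  then obtain m where m: "m \<in> max_ideal N" "b = m \<otimes> d" by blast
  have "val N b \<noteq> val N d"
  proof
    assume "val N b = val N d"
    then obtain u where u: "u \<in> Units (val_ring N)" "b = u \<otimes> d"
      using assms by (auto simp: val_eq_iff)
    then have "m = u" using m assms m_rcancel[of d m u] by (auto simp: Units_val_ring)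
    with u(1) m(1) show False by (auto simp: Units_val_ring max_ideal_def simp del: max_idealD)
  qed
  then show "val_less N (val N b) (val N d)"
    using m assms by (auto simp: val_less_def val_le_iff)
qed

lemma rv_iff:
  assumes "scale N d" "c \<in> carrier N"
  shows "y \<in> rv N (val N d) c \<longleftrightarrow> near N d c y"
proof
  assume "y \<in> rv N (val N d) c"
  then show "near N d c y"
    using assms unfolding rv_def open_ball0_def near_def by (auto simp: val_less_iff)
next
  assume "near N d c y"
  then obtain m where m: "m \<in> max_ideal N" "y = c \<otimes> (\<one> \<oplus> m \<otimes> d)"
    by (auto simp: near_def)
  then have "m \<otimes> d \<in> open_ball0 N (val N d)"
    using assms by (auto simp: open_ball0_def val_less_iff)
  with m show "y \<in> rv N (val N d) c" by (auto simp: rv_def)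
qed

lemma rv_eq_iff:
  assumes "scale N d" "x \<in> carrier N" "y \<in> carrier N"
  shows "rv N (val N d) x = rv N (val N d) y \<longleftrightarrow> near N d x y"
proof
  assume "rv N (val N d) x = rv N (val N d) y"
  then show "near N d x y"
    using rv_iff[OF assms(1,2), of y] rv_iff[OF assms(1,3), of y] near_refl[OF assms(1,3)] by simp
next
  assume n: "near N d x y"
  show "rv N (val N d) x = rv N (val N d) y"
  proof (intro Set.set_eqI)
    fix t
    show "t \<in> rv N (val N d) x \<longleftrightarrow> t \<in> rv N (val N d) y"
      unfolding rv_iff[OF assms(1,2)] rv_iff[OF assms(1,3)]
      using near_trans[OF assms(1,2) n, of t] near_trans[OF assms(1,3) near_sym[OF assms(1,2) n], of t]
      by blast
  qed
qed

lemma value_group_iff: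
  "\<gamma> \<in> value_group N \<and> val_le N \<gamma> (val_one N) \<longleftrightarrow> (\<exists>d. scale N d \<and> \<gamma> = val N d)"
proof
  assume *: "\<gamma> \<in> value_group N \<and> val_le N \<gamma> (val_one N)"
  then obtain d where d: "d \<in> carrier N" "d \<noteq> \<zero>" "\<gamma> = val N d"
    unfolding value_group_def by blast
  then have "d \<in> val_O N" using * val_le_one_iff by blast
  then have "scale N d" using d(2) unfolding scale_def by blast
  with d show "\<exists>d. scale N d \<and> \<gamma> = val N d" by blast
next
  assume "\<exists>d. scale N d \<and> \<gamma> = val N d"
  then obtain d where d: "scale N d" "\<gamma> = val N d" by blast
  have "d \<in> carrier N - {\<zero>}" using d(1) by simp
  then show "\<gamma> \<in> value_group N \<and> val_le N \<gamma> (val_one N)"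
    unfolding value_group_def d(2) using val_le_one_iff[of d] scaleD(2)[OF d(1)] by blast
qed

lemma RV_sort_eq: "RV_sort N = {rv N (val N d) c | d c. scale N d \<and> c \<in> carrier N}"
  unfolding RV_sort_def RV_at_def value_group_iff by blast

lemma RV_eq: "RV N = rv N (val N \<one>) ` carrier N"
  by (simp add: RV_def RV_at_def val_one_def)

lemma RV_at_subset_sort: "scale N d \<Longrightarrow> RV_at N (val N d) \<subseteq> RV_sort N"
  unfolding RV_sort_eq RV_at_def by blast

lemma RV_subset_sort: "RV N \<subseteq> RV_sort N"
  using RV_at_subset_sort[OF scale_one] by (simp add: RV_def val_one_def)

lemma RV_sort_subset: "\<xi> \<in> RV_sort N \<Longrightarrow> \<xi> \<subseteq> carrier N"
  unfolding RV_sort_eq using rv_iff near_closed by blast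

lemma rv_zero: "scale N d \<Longrightarrow> rv N (val N d) \<zero> = {\<zero>}"
  using near_refl[of d \<zero>] by (auto simp: rv_iff near_def)

text \<open>A \<open>c\<close> that minimizes |x - c| works: if x - c and y - c agree in RV, then y
  - x = (x - c) m with m in the maximal ideal, which is smaller than every nonzero x - c', so that x
  - c' and y - c' agree as well. Thus one element of RV carries all that \<open>C\<close> sees of
  \<open>x\<close>.\<close>

lemma nearest_center:
  assumes "finite C" "C \<noteq> {}" "C \<subseteq> carrier N" "x \<in> carrier N"
  shows "\<exists>c\<in>C. \<forall>y\<in>carrier N. rv N (val N \<one>) (x \<ominus> c) = rv N (val N \<one>) (y \<ominus> c) \<longrightarrow>
    (\<forall>c'\<in>C. rv N (val N \<one>) (x \<ominus> c') = rv N (val N \<one>) (y \<ominus> c'))"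
proof -
  define le where "le a b \<longleftrightarrow> (\<exists>u\<in>val_O N. a = u \<otimes> b)" for a b
  have total: "le a b \<or> le b a" if ab: "a \<in> carrier N" "b \<in> carrier N" for a b
  proof (cases "a = \<zero> \<or> b = \<zero>")
    case True
    have "le \<zero> b" "le \<zero> a" unfolding le_def by (rule bexI[of _ "\<zero>"]; use ab in simp)+
    with True show ?thesis by auto
  next
    case False
    have 1: "a = (a \<otimes> inv b) \<otimes> b" "b = (b \<otimes> inv a) \<otimes> a"
      using ab False by (simp_all add: m_assoc)
    have "(a \<otimes> inv b) \<otimes> (b \<otimes> inv a) = \<one>"
      using ab False by (simp add: m_assoc)
    then have "inv (a \<otimes> inv b) = b \<otimes> inv a"
      using ab False by (intro comm_inv_char) auto
    moreover have "a \<otimes> inv b \<noteq> \<zero>" using ab False by (simp add: integral_iff)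
    ultimately have "a \<otimes> inv b \<in> val_O N \<or> b \<otimes> inv a \<in> val_O N"
      using O_total[of "a \<otimes> inv b"] ab False by auto
    with 1 show ?thesis unfolding le_def by metis
  qed
  have trans: "le a c" if "le a b" "le b c" "c \<in> carrier N" for a b c
    using that unfolding le_def by (metis O_closed(1) O_closed(5) m_assoc)
  have "\<exists>c\<in>C. \<forall>c'\<in>C. le (x \<ominus> c) (x \<ominus> c')"
    using assms(1-3)
  proof (induction rule: finite_ne_induct)
    case (singleton c)
    then show ?case using total[of "x \<ominus> c" "x \<ominus> c"] assms(4) by auto
  next
    case (insert b B)
    then obtain c where c: "c \<in> B" "\<forall>c'\<in>B. le (x \<ominus> c) (x \<ominus> c')" by auto
    have cl: "x \<ominus> b \<in> carrier N" "x \<ominus> c \<in> carrier N" "\<forall>c'\<in>B. x \<ominus> c' \<in> carrier N"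
      using insert c assms(4) by auto
    show ?case
    proof (cases "le (x \<ominus> c) (x \<ominus> b)")
      case True
      then show ?thesis using c by auto
    next
      case False
      then have "le (x \<ominus> b) (x \<ominus> c)" using total cl by blast
      moreover have "le (x \<ominus> b) (x \<ominus> b)" using total cl by blast
      ultimately show ?thesis using c trans cl by blast
    qed
  qed
  then obtain c where c: "c \<in> C" "\<forall>c'\<in>C. le (x \<ominus> c) (x \<ominus> c')" by blast
  have "rv N (val N \<one>) (x \<ominus> c') = rv N (val N \<one>) (y \<ominus> c')"
    if y: "y \<in> carrier N" "rv N (val N \<one>) (x \<ominus> c) = rv N (val N \<one>) (y \<ominus> c)" and c': "c' \<in> C" for y c'
  proof -
    have cl: "x \<in> carrier N" "y \<in> carrier N" "c \<in> carrier N" "c' \<in> carrier N"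
      using assms c c' y by auto
    from y(2) have "near N \<one> (x \<ominus> c) (y \<ominus> c)" using cl by (simp add: rv_eq_iff)
    then obtain m where m: "m \<in> max_ideal N" "y \<ominus> c = (x \<ominus> c) \<otimes> (\<one> \<oplus> m)"
      by (auto simp: near_def)
    obtain u where u: "u \<in> val_O N" "x \<ominus> c = u \<otimes> (x \<ominus> c')"
      using c c' unfolding le_def by blast
    have mc: "m \<in> carrier N" "u \<in> carrier N" using m u by auto
    have "y \<ominus> c' = (y \<ominus> c) \<oplus> (c \<ominus> c')" using cl by algebra
    also have "\<dots> = (x \<ominus> c) \<otimes> (\<one> \<oplus> m) \<oplus> (c \<ominus> c')" by (simp only: m(2))
    also have "\<dots> = (x \<ominus> c') \<oplus> (x \<ominus> c) \<otimes> m" using cl mc by algebra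
    also have "\<dots> = (x \<ominus> c') \<oplus> (u \<otimes> (x \<ominus> c')) \<otimes> m" by (simp only: u(2)[symmetric])
    also have "\<dots> = (x \<ominus> c') \<otimes> (\<one> \<oplus> (m \<otimes> u) \<otimes> \<one>)" using cl mc by algebra
    finally have "near N \<one> (x \<ominus> c') (y \<ominus> c')"
      unfolding near_def using max_ideal_mult(1)[OF m(1) u(1)] by blast
    then show ?thesis using cl by (simp add: rv_eq_iff)
  qed
  with c(1) show ?thesis by blast
qed

end

section \<open>Formulas about classes\<close>

text \<open>Replacing an unsuitable \<open>d\<close> by 1 makes every pair \<open>(c, d)\<close> a representative of an element of
  the imaginary sort.\<close>

definition rad :: "('u, 'f, 'r, 'p) vstruct \<Rightarrow> 'u \<Rightarrow> 'u" where
  "rad N d = (if scale N d then d else \<one>\<^bsub>N\<^esub>)"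

definition rvd :: "('u, 'f, 'r, 'p) vstruct \<Rightarrow> 'u \<Rightarrow> 'u \<Rightarrow> 'u set" where
  "rvd N d c = rv N (val N (rad N d)) c"

definition scaleF :: "nat \<Rightarrow> ('f, 'r, 'p) fm" where
  "scaleF d = Conj (InO (Var d)) (Neg (Eq (Var d) Zero))"

text \<open>Variables 0, 1, 2 are the radius, the centre and the element. Variable 5 takes the value
  of \<open>rad\<close>, whose case distinction is not a term; 3 is the factor in the maximal ideal
  and 4 a candidate for its inverse.\<close>

definition memF0 :: "('f, 'r, 'p) fm" where
  "memF0 = Ex 5 (Conj
     (Disj (Conj (scaleF 0) (Eq (Var 5) (Var 0))) (Conj (Neg (scaleF 0)) (Eq (Var 5) One)))
     (Ex 3 (Conj (Conj (InO (Var 3)) (Neg (Ex 4 (Conj (InO (Var 4)) (Eq (Mul (Var 3) (Var 4)) One)))))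
       (Eq (Var 2) (Mul (Var 1) (Add One (Mul (Var 3) (Var 5))))))))"

definition memF :: "nat \<Rightarrow> nat \<Rightarrow> nat \<Rightarrow> ('f, 'r, 'p) fm" where
  "memF d c y = ren memF0 (\<lambda>i. if i = 0 then d else if i = 1 then c else y) id"

text \<open>The imaginary sort has no equality atom, so an imaginary variable is compared with a
  class through its elements.\<close>

definition clsF :: "nat \<Rightarrow> nat \<Rightarrow> nat \<Rightarrow> ('f, 'r, 'p) fm" where
  "clsF j d c = ren (All 2 (Iff (InClass (Var 2) 0) memF0)) (\<lambda>i. if i = 0 then d else c) (\<lambda>_. j)"

definition atF :: "nat \<Rightarrow> nat \<Rightarrow> ('f, 'r, 'p) fm" where
  "atF j d = ren (Ex 1 (clsF 0 0 1)) (\<lambda>_. d) (\<lambda>_. j)"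

definition isRV :: "nat \<Rightarrow> ('f, 'r, 'p) fm" where
  "isRV j = Ex 0 (Conj (Eq (Var 0) One) (atF j 0))"

definition AllRVs :: "nat list \<Rightarrow> ('f, 'r, 'p) fm \<Rightarrow> ('f, 'r, 'p) fm" where
  "AllRVs js \<phi> = foldr (\<lambda>j \<phi>. Neg (ExRV j (Conj (isRV j) (Neg \<phi>)))) js \<phi>"

definition ExRVs :: "nat list \<Rightarrow> ('f, 'r, 'p) fm \<Rightarrow> ('f, 'r, 'p) fm" where
  "ExRVs js \<phi> = Neg (AllRVs js (Neg \<phi>))"

lemma ren_boundD: "i \<in> fv (ren \<phi> \<tau> \<sigma>) \<Longrightarrow> \<exists>k\<in>fv \<phi>. i = \<tau> k"
  using fv_ren[of \<phi> \<tau> \<sigma>] by auto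

lemma ren_RV_boundD: "j \<in> fv_RV (ren \<phi> \<tau> \<sigma>) \<Longrightarrow> \<exists>k\<in>fv_RV \<phi>. j = \<sigma> k"
  using fv_RV_ren[of \<phi> \<tau> \<sigma>] by auto

lemma fv_memF0: "fv memF0 = {0, 1, 2}" "fv_RV memF0 = {}" "wf_fm L memF0"
  by (auto simp: memF0_def scaleF_def)

lemma fv_memF:
  "fv (memF d c y) \<subseteq> {d, c, y}" "fv_RV (memF d c y) = {}" "wf_fm L (memF d c y)"
  unfolding memF_def by (auto dest!: ren_boundD ren_RV_boundD simp: fv_memF0 wf_ren split: if_splits)

lemma fv_clsF:
  "fv (clsF j d c) \<subseteq> {d, c}" "fv_RV (clsF j d c) \<subseteq> {j}" "wf_fm L (clsF j d c)"
  unfolding clsF_def by (auto dest!: ren_boundD ren_RV_boundD simp: fv_memF0 wf_ren split: if_splits)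

lemma fv_atF: "fv (atF j d) \<subseteq> {d}" "fv_RV (atF j d) \<subseteq> {j}" "wf_fm L (atF j d)"
proof -
  show "fv (atF j d) \<subseteq> {d}"
    unfolding atF_def by (rule order_trans[OF fv_ren]) auto
  have "fv_RV (Ex 1 (clsF 0 0 1)) \<subseteq> {0}" using fv_clsF(2) by auto
  then show "fv_RV (atF j d) \<subseteq> {j}"
    unfolding atF_def by (intro order_trans[OF fv_RV_ren]) auto
  show "wf_fm L (atF j d)" unfolding atF_def by (rule wf_ren) (simp add: fv_clsF)
qed

lemma fv_isRV [simp]: "fv (isRV j) = {}" "wf_fm L (isRV j)"
  using fv_atF(1)[of j 0] by (auto simp: isRV_def fv_atF)

lemma fv_RV_isRV: "fv_RV (isRV j) \<subseteq> {j}"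
  using fv_atF(2)[of j 0] by (auto simp: isRV_def)

lemma AllRVs_simps [simp]:
  "fv (AllRVs js \<phi>) = fv \<phi>"
  "fv_RV (AllRVs js \<phi>) = fv_RV \<phi> - set js"
  "wf_fm L (AllRVs js \<phi>) \<longleftrightarrow> wf_fm L \<phi>"
  unfolding AllRVs_def by (induction js) (use fv_RV_isRV in fastforce)+

lemma ExRVs_simps [simp]:
  "fv (ExRVs js \<phi>) = fv \<phi>"
  "fv_RV (ExRVs js \<phi>) = fv_RV \<phi> - set js"
  "wf_fm L (ExRVs js \<phi>) \<longleftrightarrow> wf_fm L \<phi>"
  by (auto simp: ExRVs_def)

section \<open>Assignments, and the meaning of the formulas about classes\<close>

definition kenv :: "('u, 'f, 'r, 'p) vstruct \<Rightarrow> (nat \<Rightarrow> 'u) \<Rightarrow> bool" where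
  "kenv N e \<longleftrightarrow> (\<forall>i. e i \<in> carrier N)"

definition ienv :: "('u, 'f, 'r, 'p) vstruct \<Rightarrow> (nat \<Rightarrow> 'u set) \<Rightarrow> bool" where
  "ienv N z \<longleftrightarrow> (\<forall>j. z j \<in> RV_sort N)"

definition renv :: "('u, 'f, 'r, 'p) vstruct \<Rightarrow> (nat \<Rightarrow> 'u set) \<Rightarrow> bool" where
  "renv N z \<longleftrightarrow> (\<forall>j. z j \<in> RV N)"

lemma kenvD: "kenv N e \<Longrightarrow> e i \<in> carrier N"
  by (simp add: kenv_def)

lemma kenv_upd: "kenv N e \<Longrightarrow> x \<in> carrier N \<Longrightarrow> kenv N (e(i := x))"
  by (simp add: kenv_def)

lemma kenv_override: "kenv N e \<Longrightarrow> kenv N e' \<Longrightarrow> kenv N (override_on e e' S)"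
  by (simp add: kenv_def override_on_def)

lemma ienv_override: "ienv N e \<Longrightarrow> ienv N e' \<Longrightarrow> ienv N (override_on e e' S)"
  by (simp add: ienv_def override_on_def)

lemma renv_override: "renv N e \<Longrightarrow> renv N e' \<Longrightarrow> renv N (override_on e e' S)"
  by (simp add: renv_def override_on_def)

context vfield
begin

lemma renv_ienv: "renv N z \<Longrightarrow> ienv N z"
  using RV_subset_sort by (auto simp: renv_def ienv_def)

lemma scale_rad [simp]: "scale N (rad N d)"
  by (simp add: rad_def)

lemma rvd_scale: "scale N d \<Longrightarrow> rvd N d c = rv N (val N d) c"
  by (simp add: rvd_def rad_def)

lemma rvd_in_sort: "c \<in> carrier N \<Longrightarrow> rvd N d c \<in> RV_sort N"
  unfolding rvd_def RV_sort_eq using scale_rad by blast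

lemma in_rvd: "c \<in> carrier N \<Longrightarrow> y \<in> rvd N d c \<longleftrightarrow> near N (rad N d) c y"
  unfolding rvd_def by (rule rv_iff) simp_all

lemma RV_sort_rvd: "\<xi> \<in> RV_sort N \<longleftrightarrow> (\<exists>c\<in>carrier N. \<exists>d\<in>carrier N. \<xi> = rvd N d c)"
proof
  assume "\<xi> \<in> RV_sort N"
  then obtain d c where "scale N d" "c \<in> carrier N" "\<xi> = rv N (val N d) c"
    unfolding RV_sort_eq by blast
  then show "\<exists>c\<in>carrier N. \<exists>d\<in>carrier N. \<xi> = rvd N d c"
    using rvd_scale scaleD(1) by metis
qed (auto simp: rvd_in_sort)

lemma sat_scaleF: "sat N e z (scaleF d) \<longleftrightarrow> scale N (e d)"
  by (simp add: scaleF_def scale_def del: scaleD O_closed)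

lemma sat_memF0:
  assumes "e 0 \<in> carrier N"
  shows "sat N e z memF0 \<longleftrightarrow> near N (rad N (e 0)) (e 1) (e 2)"
proof -
  have "sat N e z memF0 \<longleftrightarrow> (\<exists>r\<in>carrier N. r = rad N (e 0) \<and> (\<exists>m\<in>carrier N.
      (m \<in> val_O N \<and> \<not> (\<exists>u\<in>carrier N. u \<in> val_O N \<and> m \<otimes> u = \<one>)) \<and>
      e 2 = e 1 \<otimes> (\<one> \<oplus> m \<otimes> r)))"
    by (simp add: memF0_def sat_scaleF rad_def del: O_closed max_idealD scaleD)
  also have "\<dots> \<longleftrightarrow> (\<exists>m\<in>carrier N. m \<in> max_ideal N \<and> e 2 = e 1 \<otimes> (\<one> \<oplus> m \<otimes> rad N (e 0)))"
  proof -
    have "rad N (e 0) \<in> carrier N" using assms by (simp add: rad_def)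
    moreover have "m \<in> max_ideal N \<longleftrightarrow>
        m \<in> val_O N \<and> \<not> (\<exists>u\<in>carrier N. u \<in> val_O N \<and> m \<otimes> u = \<one>)" for m
      unfolding max_ideal_def using O_closed(1) by blast
    ultimately show ?thesis by blast
  qed
  also have "\<dots> \<longleftrightarrow> near N (rad N (e 0)) (e 1) (e 2)"
    unfolding near_def using max_idealD(2) by blast
  finally show ?thesis .
qed

lemma sat_memF:
  assumes "e d \<in> carrier N"
  shows "sat N e z (memF d c y) \<longleftrightarrow> near N (rad N (e d)) (e c) (e y)"
  unfolding memF_def sat_ren by (subst sat_memF0) (use assms in simp_all)

lemma sat_clsF:
  assumes "e d \<in> carrier N" "e c \<in> carrier N" "z j \<subseteq> carrier N"
  shows "sat N e z (clsF j d c) \<longleftrightarrow> z j = rvd N (e d) (e c)"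
proof -
  have "rvd N (e d) (e c) \<subseteq> carrier N"
    using rvd_in_sort RV_sort_subset assms by blast
  moreover have "sat N e z (clsF j d c) \<longleftrightarrow>
      (\<forall>y\<in>carrier N. y \<in> z j \<longleftrightarrow> y \<in> rvd N (e d) (e c))"
    unfolding clsF_def sat_ren using assms by (simp add: sat_memF0 in_rvd)
  ultimately show ?thesis using assms(3) by blast
qed

lemma sat_atF:
  assumes "e d \<in> carrier N" "z j \<subseteq> carrier N"
  shows "sat N e z (atF j d) \<longleftrightarrow> z j \<in> RV_at N (val N (rad N (e d)))"
proof -
  have "sat N e z (atF j d) \<longleftrightarrow> (\<exists>c\<in>carrier N. z j = rvd N (e d) c)"
    unfolding atF_def sat_ren using assms by (simp add: sat_clsF)
  then show ?thesis by (auto simp: RV_at_def rvd_def)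
qed

lemma rad_one [simp]: "rad N \<one> = \<one>"
  by (simp add: rad_def)

lemma sat_isRV:
  assumes "z j \<subseteq> carrier N"
  shows "sat N e z (isRV j) \<longleftrightarrow> z j \<in> RV N"
  unfolding isRV_def using assms by (simp add: sat_atF RV_def val_one_def)

lemma ienv_subset: "ienv N z \<Longrightarrow> z j \<subseteq> carrier N"
  using RV_sort_subset by (auto simp: ienv_def)

lemma sat_AllRVs:
  assumes "ienv N z"
  shows "sat N e z (AllRVs js \<phi>) \<longleftrightarrow> (\<forall>\<eta>. renv N \<eta> \<longrightarrow> sat N e (override_on z \<eta> (set js)) \<phi>)"
  using assms
proof (induction js arbitrary: z)
  case Nil
  have "renv N (\<lambda>_. rv N (val N \<one>) \<one>)" by (simp add: renv_def RV_eq)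
  then show ?case by (auto simp: AllRVs_def)
next
  case (Cons j js)
  have i: "ienv N (z(j := \<xi>))" if "\<xi> \<in> RV_sort N" for \<xi>
    using Cons.prems that by (simp add: ienv_def)
  have "sat N e z (AllRVs (j # js) \<phi>) \<longleftrightarrow> (\<forall>\<xi>\<in>RV_sort N. \<xi> \<in> RV N \<longrightarrow> sat N e (z(j := \<xi>)) (AllRVs js \<phi>))"
    by (simp add: AllRVs_def sat_isRV RV_sort_subset)
  also have "\<dots> \<longleftrightarrow> (\<forall>\<xi>\<in>RV N. sat N e (z(j := \<xi>)) (AllRVs js \<phi>))"
    using RV_subset_sort by blast
  also have "\<dots> \<longleftrightarrow> (\<forall>\<xi>\<in>RV N. \<forall>\<eta>. renv N \<eta> \<longrightarrow> sat N e (override_on (z(j := \<xi>)) \<eta> (set js)) \<phi>)"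
    using RV_subset_sort by (intro ball_cong refl Cons.IH i) blast
  also have "\<dots> \<longleftrightarrow> (\<forall>\<eta>. renv N \<eta> \<longrightarrow> sat N e (override_on z \<eta> (set (j # js))) \<phi>)" (is "?l \<longleftrightarrow> ?r")
  proof
    assume l: ?l
    show ?r
    proof (intro allI impI)
      fix \<eta> assume \<eta>: "renv N \<eta>"
      have "override_on z \<eta> (set (j # js)) = override_on (z(j := \<eta> j)) \<eta> (set js)"
        by (auto simp: override_on_def fun_eq_iff)
      with l \<eta> show "sat N e (override_on z \<eta> (set (j # js))) \<phi>"
        by (simp add: renv_def)
    qed
  next
    assume r: ?r
    show ?l
    proof (intro ballI allI impI)
      fix \<xi> \<eta> assume \<xi>: "\<xi> \<in> RV N" and \<eta>: "renv N \<eta>"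
      let ?\<eta> = "if j \<in> set js then \<eta> else \<eta>(j := \<xi>)"
      have "renv N ?\<eta>" using \<xi> \<eta> by (simp add: renv_def)
      moreover have "override_on (z(j := \<xi>)) \<eta> (set js) = override_on z ?\<eta> (set (j # js))"
        by (auto simp: override_on_def fun_eq_iff)
      ultimately show "sat N e (override_on (z(j := \<xi>)) \<eta> (set js)) \<phi>"
        using r by metis
    qed
  qed
  finally show ?case .
qed

lemma sat_ExRVs:
  assumes "ienv N z"
  shows "sat N e z (ExRVs js \<phi>) \<longleftrightarrow> (\<exists>\<eta>. renv N \<eta> \<and> sat N e (override_on z \<eta> (set js)) \<phi>)"
  using sat_AllRVs[OF assms] by (auto simp: ExRVs_def)

end

section \<open>Formulas about finite sets and preparation\<close>

definition solutions :: "('u, 'f, 'r, 'p) vstruct \<Rightarrow> (nat \<Rightarrow> 'u) \<Rightarrow> (nat \<Rightarrow> 'u set) \<Rightarrow>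
    ('f, 'r, 'p) fm \<Rightarrow> 'u set" where
  "solutions N e z \<phi> = {x \<in> carrier N. sat N (e(0 := x)) z \<phi>}"

text \<open>In the next two formulas the variable 0 of the given formulas becomes bound; it is the
  variable that runs through the set of solutions.\<close>

primrec atmost :: "nat \<Rightarrow> ('f, 'r, 'p) fm \<Rightarrow> ('f, 'r, 'p) fm" where
  "atmost 0 \<theta> = All 0 (Neg \<theta>)"
| "atmost (Suc n) \<theta> =
     (let k = fresh (insert 0 (fv \<theta>)) in Ex k (atmost n (Conj \<theta> (Neg (Eq (Var 0) (Var k))))))"

definition prepF :: "nat \<Rightarrow> ('f, 'r, 'p) fm \<Rightarrow> ('f, 'r, 'p) fm \<Rightarrow> ('f, 'r, 'p) fm" where
  "prepF d \<theta> \<chi> =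
    (let up = (\<lambda>\<phi> k. ren \<phi> (\<lambda>i. if i = 0 then k else i + 5) id) in
     ren (All 0 (All 1 (Imp
       (All 2 (Imp (up \<theta> 2)
         (Ex 3 (Ex 4 (Conj (Conj (Eq (Var 0) (Add (Var 2) (Var 3))) (Eq (Var 1) (Add (Var 2) (Var 4))))
           (memF (d + 5) 3 4))))))
       (Iff (up \<chi> 0) (up \<chi> 1))))) (\<lambda>i. i - 5) id)"

lemma atmost_simps [simp]:
  "fv_RV (atmost n \<theta>) = fv_RV \<theta>"
  "wf_fm L (atmost n \<theta>) \<longleftrightarrow> wf_fm L \<theta>"
  by (induction n arbitrary: \<theta>) (auto simp: Let_def)

lemma wf_prepF: "wf_fm L \<theta> \<Longrightarrow> wf_fm L \<chi> \<Longrightarrow> wf_fm L (prepF d \<theta> \<chi>)"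
  unfolding prepF_def Let_def by (intro wf_ren) (simp add: wf_ren fv_memF)

text \<open>Each quantifier removes one point from the solution set; if that set is empty there is
  still a point to name, because the carrier is nonempty.\<close>

lemma sat_atmost:
  assumes "carrier N \<noteq> {}"
  shows "sat N e z (atmost n \<theta>) \<longleftrightarrow> finite (solutions N e z \<theta>) \<and> card (solutions N e z \<theta>) \<le> n"
proof (induction n arbitrary: \<theta> e)
  case 0
  have "sat N e z (atmost 0 \<theta>) \<longleftrightarrow> solutions N e z \<theta> = {}" by (auto simp: solutions_def)
  then show ?case by auto
next
  case (Suc n)
  define k where "k = fresh (insert 0 (fv \<theta>))"
  have k: "k \<notin> insert 0 (fv \<theta>)" unfolding k_def by (rule fresh_notin) (simp add: finite_fv)
  have "solutions N (e(k := u)) z (Conj \<theta> (Neg (Eq (Var 0) (Var k)))) = solutions N e z \<theta> - {u}" for u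
  proof -
    have "sat N ((e(k := u))(0 := x)) z \<theta> = sat N (e(0 := x)) z \<theta>" for x
      by (rule sat_cong) (use k in auto)
    then show ?thesis using k by (auto simp: solutions_def)
  qed
  then have "sat N e z (atmost (Suc n) \<theta>) \<longleftrightarrow> (\<exists>u\<in>carrier N.
      finite (solutions N e z \<theta> - {u}) \<and> card (solutions N e z \<theta> - {u}) \<le> n)"
    by (simp add: k_def[symmetric] Let_def Suc.IH del: fun_upd_apply)
  also have "\<dots> \<longleftrightarrow> finite (solutions N e z \<theta>) \<and> card (solutions N e z \<theta>) \<le> Suc n"
  proof (cases "solutions N e z \<theta> = {}")
    case True
    then show ?thesis using assms by auto
  next
    case False
    then obtain u where u: "u \<in> solutions N e z \<theta>" by blast
    then have "u \<in> carrier N" by (simp add: solutions_def)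
    show ?thesis
    proof
      assume "\<exists>u\<in>carrier N. finite (solutions N e z \<theta> - {u}) \<and> card (solutions N e z \<theta> - {u}) \<le> n"
      then show "finite (solutions N e z \<theta>) \<and> card (solutions N e z \<theta>) \<le> Suc n"
        by (auto simp: card_Diff_singleton_if split: if_splits)
    next
      assume "finite (solutions N e z \<theta>) \<and> card (solutions N e z \<theta>) \<le> Suc n"
      with u \<open>u \<in> carrier N\<close> show "\<exists>u\<in>carrier N. finite (solutions N e z \<theta> - {u}) \<and>
          card (solutions N e z \<theta> - {u}) \<le> n"
        by (intro bexI[of _ u]) (auto simp: card_Diff_singleton_if)
    qed
  qed
  finally show ?case .
qed

lemma (in vfield) sat_prepF:
  assumes "kenv N e"
  shows "sat N e z (prepF d \<theta> \<chi>) \<longleftrightarrow>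
    prepared N (val N (rad N (e d))) (solutions N e z \<theta>) (solutions N e z \<chi>)"
proof -
  define up where "up = (\<lambda>(\<phi> :: ('f, 'r, 'p) fm) k. ren \<phi> (\<lambda>i. if i = 0 then k else i + 5) id)"
  define F :: "('f, 'r, 'p) fm" where "F = Ex 3 (Ex 4 (Conj (Conj (Eq (Var 0) (Add (Var 2) (Var 3))) (Eq (Var 1) (Add (Var 2) (Var 4))))
           (memF (d + 5) 3 4)))"
  \<comment> \<open>Variables 0 and 1 are the two points, 2 is the centre, and 3 and 4 are the
    differences from it, given by sums because terms have no subtraction. The variables of the given
    formulas move up by 5 to make room.\<close>
  define e' where "e' x y c = ((e \<circ> (\<lambda>i. i - 5))(0 := x, 1 := y, 2 := c))" for x y c
  have up: "sat N (e' x y c) z (up \<theta> 2) \<longleftrightarrow> sat N (e(0 := c)) z \<theta>"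
    "sat N ((e \<circ> (\<lambda>i. i - 5))(0 := x, 1 := y)) z (up \<chi> 0) \<longleftrightarrow> sat N (e(0 := x)) z \<chi>"
    "sat N ((e \<circ> (\<lambda>i. i - 5))(0 := x, 1 := y)) z (up \<chi> 1) \<longleftrightarrow> sat N (e(0 := y)) z \<chi>" for x y c
    unfolding up_def sat_ren e'_def by (rule sat_cong; auto)+
  have mid: "sat N (e' x y c) z F \<longleftrightarrow>
      rv N (val N (rad N (e d))) (x \<ominus> c) = rv N (val N (rad N (e d))) (y \<ominus> c)"
    if cl: "x \<in> carrier N" "y \<in> carrier N" "c \<in> carrier N" for x y c
  proof -
    have *: "x = c \<oplus> s \<longleftrightarrow> s = x \<ominus> c" if "s \<in> carrier N" "x \<in> carrier N" for s x
    proof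
      assume "x = c \<oplus> s"
      moreover have "s = (c \<oplus> s) \<ominus> c" using cl(3) that by algebra
      ultimately show "s = x \<ominus> c" by simp
    next
      assume "s = x \<ominus> c"
      moreover have "x = c \<oplus> (x \<ominus> c)" using cl(3) that by algebra
      ultimately show "x = c \<oplus> s" by simp
    qed
    have "sat N (e' x y c) z F \<longleftrightarrow>
      (\<exists>s\<in>carrier N. \<exists>t\<in>carrier N. (x = c \<oplus> s \<and> y = c \<oplus> t) \<and> near N (rad N (e d)) s t)"
      using kenvD[OF assms, of d] by (simp add: F_def e'_def sat_memF)
    also have "\<dots> \<longleftrightarrow> near N (rad N (e d)) (x \<ominus> c) (y \<ominus> c)"
      using cl * by (metis minus_closed)
    finally show ?thesis using cl by (simp add: rv_eq_iff)
  qed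
  have "sat N e z (prepF d \<theta> \<chi>) \<longleftrightarrow> (\<forall>x\<in>carrier N. \<forall>y\<in>carrier N.
     (\<forall>c\<in>carrier N. sat N (e' x y c) z (up \<theta> 2) \<longrightarrow> sat N (e' x y c) z F) \<longrightarrow>
     (sat N ((e \<circ> (\<lambda>i. i - 5))(0 := x, 1 := y)) z (up \<chi> 0) \<longleftrightarrow>
      sat N ((e \<circ> (\<lambda>i. i - 5))(0 := x, 1 := y)) z (up \<chi> 1)))"
    unfolding prepF_def Let_def sat_ren up_def[symmetric] F_def[symmetric] All_simps Imp_simps Iff_simps e'_def comp_id ..
  also have "\<dots> \<longleftrightarrow> (\<forall>x\<in>carrier N. \<forall>y\<in>carrier N.
     (\<forall>c\<in>carrier N. sat N (e(0 := c)) z \<theta> \<longrightarrow>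
        rv N (val N (rad N (e d))) (x \<ominus> c) = rv N (val N (rad N (e d))) (y \<ominus> c)) \<longrightarrow>
     (sat N (e(0 := x)) z \<chi> \<longleftrightarrow> sat N (e(0 := y)) z \<chi>))"
    unfolding up
    by (rule ball_cong[OF refl], rule ball_cong[OF refl], rule imp_cong[OF _ refl],
        rule ball_cong[OF refl], rule imp_cong[OF refl], rule mid)
  finally show ?thesis unfolding prepared_def solutions_def mem_Collect_eq by blast
qed

section \<open>Ultrafilters and cardinalities\<close>

definition ultra :: "'i filter \<Rightarrow> bool" where
  "ultra U \<longleftrightarrow> U \<noteq> bot \<and> (\<forall>P. eventually P U \<or> eventually (\<lambda>x. \<not> P x) U)"

text \<open>Zorn's lemma in the reverse order gives a minimal proper filter below \<open>F\<close>.
  It decides every \<open>P\<close>: unless \<open>P\<close> fails eventually, restricting the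
  filter to \<open>P\<close> leaves it proper, hence unchanged.\<close>

lemma ultra_exists:
  assumes "F \<noteq> bot"
  shows "\<exists>U\<le>F. ultra U"
proof -
  let ?A = "{G. G \<noteq> bot \<and> G \<le> F}"
  have "\<exists>m\<in>?A. \<forall>a\<in>?A. a \<le> m \<longrightarrow> a = m"
  proof (rule predicate_Zorn[where P = "\<lambda>x y. y \<le> x"])
    show "partial_order_on ?A (relation_of (\<lambda>x y. y \<le> x) ?A)"
      by (rule partial_order_on_relation_ofI) auto
  next
    fix C assume C: "C \<in> Chains (relation_of (\<lambda>x y. y \<le> x) ?A)"
    have sub: "C \<subseteq> ?A" using C by (auto simp: Chains_def relation_of_def)
    have lin: "x \<le> y \<or> y \<le> x" if "x \<in> C" "y \<in> C" for x y
      using C that by (auto simp: Chains_def relation_of_def)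
    show "\<exists>u\<in>?A. \<forall>a\<in>C. u \<le> a"
    proof (cases "C = {}")
      case True
      then show ?thesis using assms by auto
    next
      case False
      have "eventually P (Inf C) \<longleftrightarrow> (\<exists>b\<in>C. eventually P b)" for P
        using lin by (intro eventually_Inf_base False) (metis inf.absorb_iff1 inf.absorb_iff2 order_refl)
      then have "Inf C \<noteq> bot"
        using sub by (auto simp: trivial_limit_def)
      moreover obtain b where b: "b \<in> C" using False by blast
      have "Inf C \<le> b" by (rule Inf_lower[OF b])
      moreover have "b \<le> F" using b sub by blast
      ultimately have "Inf C \<in> ?A" by simp
      moreover have "\<forall>a\<in>C. Inf C \<le> a" by (intro ballI Inf_lower)
      ultimately show ?thesis by (rule bexI[rotated])
    qed
  qed
  then obtain U where U: "U \<noteq> bot" "U \<le> F" and min: "\<And>a. a \<noteq> bot \<Longrightarrow> a \<le> F \<Longrightarrow> a \<le> U \<Longrightarrow> a = U"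
    by auto
  have "eventually P U \<or> eventually (\<lambda>x. \<not> P x) U" for P
  proof (rule disjCI)
    assume "\<not> eventually (\<lambda>x. \<not> P x) U"
    then have "inf U (principal {x. P x}) \<noteq> bot"
      by (simp add: trivial_limit_def eventually_inf_principal)
    then have eq: "inf U (principal {x. P x}) = U"
      using U by (intro min) (auto intro: order_trans[OF inf_le1])
    have "eventually P (inf U (principal {x. P x}))"
      by (simp add: eventually_inf_principal)
    then show "eventually P U" by (simp only: eq)
  qed
  with U show ?thesis by (auto simp: ultra_def)
qed

lemma ultra_not:
  assumes "ultra U"
  shows "eventually (\<lambda>x. \<not> P x) U \<longleftrightarrow> \<not> eventually P U"
proof -
  have False if "eventually P U" "eventually (\<lambda>x. \<not> P x) U"
  proof -
    from that have "eventually (\<lambda>x. False) U" by eventually_elim simp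
    with assms show False by (simp add: ultra_def)
  qed
  with assms show ?thesis unfolding ultra_def by blast
qed

section \<open>Cardinality of the set of formulas and of closures under operations\<close>

lemma inj_nat:
  assumes "infinite (UNIV :: 'u set)"
  shows "\<exists>f :: nat \<Rightarrow> 'u. inj f"
  using infinite_countable_subset[OF assms] by auto

lemma inj_list:
  assumes "infinite (UNIV :: 'u set)"
  shows "\<exists>f :: 'u list \<Rightarrow> 'u. inj f"
proof -
  obtain q :: "'u \<times> 'u \<Rightarrow> 'u" where q: "bij_betw q (UNIV \<times> UNIV) UNIV"
    using card_of_Times_same_infinite[OF assms] card_of_ordIso by blast
  define p where "p a b = q (a, b)" for a b
  have p: "p a b = p c d \<longleftrightarrow> a = c \<and> b = d" for a b c d
    unfolding p_def using inj_on_eq_iff[OF bij_betw_imp_inj_on[OF q], of "(a, b)" "(c, d)"] by simp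
  obtain n :: "nat \<Rightarrow> 'u" where n: "inj n" using inj_nat[OF assms] by blast
  \<comment> \<open>The fold does not show where a list ends, so the length is stored as
    well.\<close>
  define f where "f xs = p (n (length xs)) (foldr p xs (n 0))" for xs
  have "xs = ys" if "length xs = length ys" "foldr p xs (n 0) = foldr p ys (n 0)" for xs ys
    using that by (induction xs ys rule: list_induct2) (auto simp: p)
  then have "inj f" by (auto simp: inj_def f_def p inj_eq[OF n])
  then show ?thesis by blast
qed

text \<open>A symbol is coded together with its arity, since a language is a set of such pairs and
  \<open>c\<close> will be injective on that set only; accordingly, injectivity of the coding is
  claimed for well-formed terms.\<close>

primrec enc_tm :: "(nat \<Rightarrow> 'u) \<Rightarrow> ('u list \<Rightarrow> 'u) \<Rightarrow> ('f \<times> nat \<Rightarrow> 'u) \<Rightarrow> 'f tm \<Rightarrow> 'u" where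
  "enc_tm n l c (Var i) = l [n 0, n i]"
| "enc_tm n l c Zero = l [n 1]"
| "enc_tm n l c One = l [n 2]"
| "enc_tm n l c (Add s t) = l [n 3, enc_tm n l c s, enc_tm n l c t]"
| "enc_tm n l c (Mul s t) = l [n 4, enc_tm n l c s, enc_tm n l c t]"
| "enc_tm n l c (Fun f ts) = l (n 5 # c (f, length ts) # map (enc_tm n l c) ts)"

primrec enc_fm :: "(nat \<Rightarrow> 'u) \<Rightarrow> ('u list \<Rightarrow> 'u) \<Rightarrow> ('f \<times> nat \<Rightarrow> 'u) \<Rightarrow> ('r \<times> nat \<Rightarrow> 'u) \<Rightarrow>
    ('p \<times> nat \<Rightarrow> 'u) \<Rightarrow> ('f, 'r, 'p) fm \<Rightarrow> 'u" where
  "enc_fm n l c d b (Eq s t) = l [n 0, enc_tm n l c s, enc_tm n l c t]"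
| "enc_fm n l c d b (InO t) = l [n 1, enc_tm n l c t]"
| "enc_fm n l c d b (Rel r ts) = l (n 2 # d (r, length ts) # map (enc_tm n l c) ts)"
| "enc_fm n l c d b (RVRel p js) = l (n 3 # b (p, length js) # map n js)"
| "enc_fm n l c d b (InClass t j) = l [n 4, enc_tm n l c t, n j]"
| "enc_fm n l c d b (Neg \<phi>) = l [n 5, enc_fm n l c d b \<phi>]"
| "enc_fm n l c d b (Conj \<phi> \<psi>) = l [n 6, enc_fm n l c d b \<phi>, enc_fm n l c d b \<psi>]"
| "enc_fm n l c d b (Ex i \<phi>) = l [n 7, n i, enc_fm n l c d b \<phi>]"
| "enc_fm n l c d b (ExRV i \<phi>) = l [n 8, n i, enc_fm n l c d b \<phi>]"

lemma map_eq_inj: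
  assumes "map f xs = map f ys" "\<And>x y. x \<in> set xs \<Longrightarrow> y \<in> set ys \<Longrightarrow> f x = f y \<Longrightarrow> x = y"
  shows "xs = ys"
proof -
  have "length xs = length ys" using assms(1) map_eq_imp_length_eq by blast
  then show ?thesis using assms by (induction xs ys rule: list_induct2) auto
qed

lemma enc_tm_inj:
  assumes "inj n" "inj l" "inj_on c (funs L)"
  shows "wf_tm L s \<Longrightarrow> wf_tm L t \<Longrightarrow> enc_tm n l c s = enc_tm n l c t \<Longrightarrow> s = t"
proof (induction s arbitrary: t)
  case (Fun f ts)
  then obtain g us where t: "t = Fun g us"
    by (cases t) (auto simp: inj_eq[OF assms(1)] inj_eq[OF assms(2)])
  with Fun.prems have *: "c (f, length ts) = c (g, length us)"
    "map (enc_tm n l c) ts = map (enc_tm n l c) us"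
    "(f, length ts) \<in> funs L" "(g, length us) \<in> funs L" "\<forall>t\<in>set ts. wf_tm L t" "\<forall>t\<in>set us. wf_tm L t"
    by (auto simp: inj_eq[OF assms(1)] inj_eq[OF assms(2)] list_all_iff)
  have "ts = us"
    by (rule map_eq_inj[OF *(2)]) (use Fun.IH * in blast)
  moreover have "f = g" using *(1,3,4) assms(3) by (auto simp: inj_on_def)
  ultimately show ?case by (simp add: t)
next
  case (Var i)
  then show ?case by (cases t) (auto simp: inj_eq[OF assms(1)] inj_eq[OF assms(2)])
next
  case Zero
  then show ?case by (cases t) (auto simp: inj_eq[OF assms(1)] inj_eq[OF assms(2)])
next
  case One
  then show ?case by (cases t) (auto simp: inj_eq[OF assms(1)] inj_eq[OF assms(2)])
next
  case (Add s s')
  then show ?case by (cases t) (auto simp: inj_eq[OF assms(1)] inj_eq[OF assms(2)])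
next
  case (Mul s s')
  then show ?case by (cases t) (auto simp: inj_eq[OF assms(1)] inj_eq[OF assms(2)])
qed

lemma enc_fm_inj:
  assumes "inj n" "inj l" "inj_on c (funs L)" "inj_on d (rels L)" "inj_on b (rvrels L)"
  shows "wf_fm L \<phi> \<Longrightarrow> wf_fm L \<psi> \<Longrightarrow> enc_fm n l c d b \<phi> = enc_fm n l c d b \<psi> \<Longrightarrow> \<phi> = \<psi>"
proof (induction \<phi> arbitrary: \<psi>)
  case (Eq s t)
  then show ?case using enc_tm_inj[OF assms(1-3)] by (cases \<psi>) (auto simp: inj_eq[OF assms(1)] inj_eq[OF assms(2)])
next
  case (InO t)
  then show ?case using enc_tm_inj[OF assms(1-3)] by (cases \<psi>) (auto simp: inj_eq[OF assms(1)] inj_eq[OF assms(2)])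
next
  case (Rel r ts)
  then obtain q us where t: "\<psi> = Rel q us"
    by (cases \<psi>) (auto simp: inj_eq[OF assms(1)] inj_eq[OF assms(2)])
  with Rel.prems have *: "d (r, length ts) = d (q, length us)"
    "map (enc_tm n l c) ts = map (enc_tm n l c) us"
    "(r, length ts) \<in> rels L" "(q, length us) \<in> rels L" "\<forall>t\<in>set ts. wf_tm L t" "\<forall>t\<in>set us. wf_tm L t"
    by (auto simp: inj_eq[OF assms(1)] inj_eq[OF assms(2)] list_all_iff)
  have "ts = us"
    by (rule map_eq_inj[OF *(2)]) (use enc_tm_inj[OF assms(1-3)] * in blast)
  moreover have "r = q" using *(1,3,4) assms(4) by (auto simp: inj_on_def)
  ultimately show ?case by (simp add: t)
next
  case (RVRel p js)
  then obtain q ks where t: "\<psi> = RVRel q ks"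
    by (cases \<psi>) (auto simp: inj_eq[OF assms(1)] inj_eq[OF assms(2)])
  with RVRel.prems have *: "b (p, length js) = b (q, length ks)" "map n js = map n ks"
    "(p, length js) \<in> rvrels L" "(q, length ks) \<in> rvrels L"
    by (auto simp: inj_eq[OF assms(1)] inj_eq[OF assms(2)])
  have "js = ks" using *(2) assms(1) by simp
  moreover have "p = q" using *(1,3,4) assms(5) by (auto simp: inj_on_def)
  ultimately show ?case by (simp add: t)
next
  case (InClass t j)
  then show ?case using enc_tm_inj[OF assms(1-3)] by (cases \<psi>) (auto simp: inj_eq[OF assms(1)] inj_eq[OF assms(2)])
next
  case (Neg \<phi>)
  then show ?case by (cases \<psi>) (auto simp: inj_eq[OF assms(1)] inj_eq[OF assms(2)])
next
  case (Conj \<phi>1 \<phi>2)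
  then show ?case by (cases \<psi>) (auto simp: inj_eq[OF assms(1)] inj_eq[OF assms(2)])
next
  case (Ex i \<phi>)
  then show ?case by (cases \<psi>) (auto simp: inj_eq[OF assms(1)] inj_eq[OF assms(2)])
next
  case (ExRV j \<phi>)
  then show ?case by (cases \<psi>) (auto simp: inj_eq[OF assms(1)] inj_eq[OF assms(2)])
qed

lemma lepoll_UNIV: "inj_on f A \<Longrightarrow> A \<lesssim> (UNIV :: 'u set)" for f :: "'a \<Rightarrow> 'u"
  unfolding lepoll_def by (rule exI[of _ f]) simp

lemma wf_fm_lepoll:
  fixes L :: "('f, 'r, 'p) lang"
  assumes "large_universe TYPE('u) L"
  shows "{\<phi>. wf_fm L \<phi>} \<lesssim> (UNIV :: 'u set)"
proof -
  have inf: "infinite (UNIV :: 'u set)" using assms by (simp add: large_universe_def)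
  obtain h :: "('f \<times> nat) + (('r \<times> nat) + ('p \<times> nat)) \<Rightarrow> 'u"
    where h: "inj_on h (funs L <+> rels L <+> rvrels L)"
    using assms unfolding large_universe_def lepoll_def by blast
  obtain n :: "nat \<Rightarrow> 'u" where n: "inj n" using inj_nat[OF inf] by blast
  obtain l :: "'u list \<Rightarrow> 'u" where l: "inj l" using inj_list[OF inf] by blast
  let ?c = "h \<circ> Inl" and ?d = "h \<circ> Inr \<circ> Inl" and ?b = "h \<circ> Inr \<circ> Inr"
  have "inj_on ?c (funs L)" "inj_on ?d (rels L)" "inj_on ?b (rvrels L)"
    using h by (auto simp: inj_on_def)
  then have "inj_on (enc_fm n l ?c ?d ?b) {\<phi>. wf_fm L \<phi>}"
    using enc_fm_inj[OF n l] by (intro inj_onI) blast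
  then show ?thesis by (rule lepoll_UNIV)
qed

lemma lepoll_Plus_infinite:
  assumes "infinite (UNIV :: 'u set)" "A \<lesssim> (UNIV :: 'u set)" "B \<lesssim> (UNIV :: 'u set)"
  shows "(A :: 'a set) <+> (B :: 'b set) \<lesssim> (UNIV :: 'u set)"
proof -
  obtain f :: "'a \<Rightarrow> 'u" where f: "inj_on f A"
    using assms(2) unfolding lepoll_def by (elim exE conjE)
  obtain g :: "'b \<Rightarrow> 'u" where g: "inj_on g B"
    using assms(3) unfolding lepoll_def by (elim exE conjE)
  obtain n :: "nat \<Rightarrow> 'u" where n: "inj n" using inj_nat[OF assms(1)] by blast
  obtain l :: "'u list \<Rightarrow> 'u" where l: "inj l" using inj_list[OF assms(1)] by blast
  have "inj_on (case_sum (\<lambda>a. l [n 0, f a]) (\<lambda>b. l [n 1, g b])) (A <+> B)"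
    by (rule inj_onI)
      (auto elim!: PlusE simp: inj_eq[OF l] inj_eq[OF n] dest: inj_onD[OF f] inj_onD[OF g])
  then show ?thesis by (rule lepoll_UNIV)
qed

lemma lepoll_Times_infinite:
  assumes "infinite (UNIV :: 'u set)" "A \<lesssim> (UNIV :: 'u set)" "B \<lesssim> (UNIV :: 'u set)"
  shows "(A :: 'a set) \<times> (B :: 'b set) \<lesssim> (UNIV :: 'u set)"
proof -
  obtain f :: "'a \<Rightarrow> 'u" where f: "inj_on f A"
    using assms(2) unfolding lepoll_def by (elim exE conjE)
  obtain g :: "'b \<Rightarrow> 'u" where g: "inj_on g B"
    using assms(3) unfolding lepoll_def by (elim exE conjE)
  obtain l :: "'u list \<Rightarrow> 'u" where l: "inj l" using inj_list[OF assms(1)] by blast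
  have "inj_on (\<lambda>(a, b). l [f a, g b]) (A \<times> B)"
    by (rule inj_onI) (auto simp: inj_eq[OF l] dest: inj_onD[OF f] inj_onD[OF g])
  then show ?thesis by (rule lepoll_UNIV)
qed

text \<open>Formal terms over operations on lists. There are no variables: a generator is an
  operation applied to the empty list.\<close>

datatype 'l op_tree = Op 'l "'l op_tree list"

primrec op_val :: "('l \<Rightarrow> 'b list \<Rightarrow> 'b) \<Rightarrow> 'l op_tree \<Rightarrow> 'b" where
  "op_val f (Op a ts) = f a (map (op_val f) ts)"

primrec op_enc :: "('u list \<Rightarrow> 'u) \<Rightarrow> ('l \<Rightarrow> 'u) \<Rightarrow> 'l op_tree \<Rightarrow> 'u" where
  "op_enc l c (Op a ts) = l (c a # map (op_enc l c) ts)"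

text \<open>The values of the formal terms with labels in \<open>I\<close> are closed under the
  operations, and these terms inject into \<open>'u\<close> because \<open>I\<close> and the lists
  over \<open>'u\<close> do. This is the counting in the downward Loewenheim-Skolem theorem.\<close>

lemma closure_lepoll:
  fixes f :: "'l \<Rightarrow> 'b list \<Rightarrow> 'b"
  assumes inf: "infinite (UNIV :: 'u set)" and "I \<lesssim> (UNIV :: 'u set)"
  shows "\<exists>H. H \<lesssim> (UNIV :: 'u set) \<and> (\<forall>a\<in>I. \<forall>xs\<in>lists H. f a xs \<in> H)"
proof -
  obtain c :: "'l \<Rightarrow> 'u" where c: "inj_on c I" using assms(2) unfolding lepoll_def by blast
  obtain l :: "'u list \<Rightarrow> 'u" where l: "inj l" using inj_list[OF inf] by blast
  let ?T = "{t. set_op_tree t \<subseteq> I}"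
  have "set_op_tree s \<subseteq> I \<Longrightarrow> set_op_tree t \<subseteq> I \<Longrightarrow> op_enc l c s = op_enc l c t \<Longrightarrow> s = t" for s t
  proof (induction s arbitrary: t)
    case (Op a ss)
    obtain b ts where t: "t = Op b ts" by (cases t)
    have *: "c a = c b" "map (op_enc l c) ss = map (op_enc l c) ts"
      using Op.prems(3) by (auto simp: t inj_eq[OF l])
    have "ss = ts"
      by (rule map_eq_inj[OF *(2)], rule Op.IH) (use Op.prems t in auto)
    moreover have "a = b" using *(1) c Op.prems by (auto simp: t inj_on_def)
    ultimately show ?case by (simp add: t)
  qed
  then have "?T \<lesssim> (UNIV :: 'u set)"
    unfolding lepoll_def by (intro exI[of _ "op_enc l c"] conjI inj_onI subset_UNIV) blast
  then have 1: "op_val f ` ?T \<lesssim> (UNIV :: 'u set)"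
    by (rule lepoll_trans[OF image_lepoll])
  have lift: "\<exists>ts. xs = map (op_val f) ts \<and> set ts \<subseteq> ?T" if "xs \<in> lists (op_val f ` ?T)" for xs
    using that
  proof (induction xs)
    case (Cons x xs)
    then obtain t ts where "t \<in> ?T" "x = op_val f t" "xs = map (op_val f) ts" "set ts \<subseteq> ?T" by auto
    then show ?case by (intro exI[of _ "t # ts"]) auto
  qed auto
  have "f a xs \<in> op_val f ` ?T" if a: "a \<in> I" and xs: "xs \<in> lists (op_val f ` ?T)" for a xs
  proof -
    obtain ts where ts: "xs = map (op_val f) ts" "set ts \<subseteq> ?T" using lift[OF xs] by blast
    then have "Op a ts \<in> ?T" using a by auto
    moreover have "f a xs = op_val f (Op a ts)" by (simp add: ts(1))
    ultimately show ?thesis by blast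
  qed
  with 1 show ?thesis by blast
qed

section \<open>Assignments by representatives\<close>

text \<open>One assignment of elements of \<open>K\<close> codes an assignment for both sorts: an element of the
  imaginary sort is represented by a pair \<open>(c, d)\<close> standing for the class of \<open>c\<close> in \<open>RV\<close> at \<open>|d|\<close>.\<close>

definition kpart :: "(nat \<Rightarrow> 'u) \<Rightarrow> nat \<Rightarrow> 'u" where
  "kpart w = (\<lambda>i. w (3 * i))"

definition ipart :: "('u, 'f, 'r, 'p) vstruct \<Rightarrow> (nat \<Rightarrow> 'u) \<Rightarrow> nat \<Rightarrow> 'u set" where
  "ipart N w = (\<lambda>j. rvd N (w (3 * j + 2)) (w (3 * j + 1)))"

definition psat :: "('u, 'f, 'r, 'p) vstruct \<Rightarrow> (nat \<Rightarrow> 'u) \<Rightarrow> ('f, 'r, 'p) fm \<Rightarrow> bool" where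
  "psat N w \<phi> \<longleftrightarrow> sat N (kpart w) (ipart N w) \<phi>"

lemma kpart_upd [simp]:
  "kpart (w(3 * i := x)) = (kpart w)(i := x)"
  "kpart (w(3 * i + 1 := x)) = kpart w"
  "kpart (w(3 * i + 2 := x)) = kpart w"
proof -
  show "kpart (w(3 * i := x)) = (kpart w)(i := x)" by (auto simp: kpart_def)
  have "3 * k \<noteq> 3 * i + 1" "3 * k \<noteq> 3 * i + 2" for k by presburger+
  then show "kpart (w(3 * i + 1 := x)) = kpart w" "kpart (w(3 * i + 2 := x)) = kpart w"
    unfolding kpart_def by simp_all
qed

lemma ipart_upd [simp]:
  "ipart N (w(3 * i := x)) = ipart N w"
  "ipart N (w(3 * j + 1 := c, 3 * j + 2 := d)) = (ipart N w)(j := rvd N d c)"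
proof -
  have *: "3 * k + 1 \<noteq> 3 * i" "3 * k + 2 \<noteq> 3 * i" for k i :: nat by presburger+
  then show "ipart N (w(3 * i := x)) = ipart N w" unfolding ipart_def by simp
  have "3 * k + 1 \<noteq> 3 * j + 2" "3 * k + 2 \<noteq> 3 * j + 1" for k by presburger+
  then show "ipart N (w(3 * j + 1 := c, 3 * j + 2 := d)) = (ipart N w)(j := rvd N d c)"
    unfolding ipart_def by (auto simp: fun_eq_iff)
qed

lemma psat_cong:
  assumes "\<And>i. i \<in> fv \<phi> \<Longrightarrow> w (3 * i) = w' (3 * i)"
    "\<And>j. j \<in> fv_RV \<phi> \<Longrightarrow> w (3 * j + 1) = w' (3 * j + 1)"
    "\<And>j. j \<in> fv_RV \<phi> \<Longrightarrow> w (3 * j + 2) = w' (3 * j + 2)"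
  shows "psat N w \<phi> \<longleftrightarrow> psat N w' \<phi>"
  unfolding psat_def by (rule sat_cong) (simp_all only: kpart_def ipart_def assms)

text \<open>As a formula reads only finitely many entries, its Skolem functions can be given as
  operations on finite lists.\<close>

lemma psat_bounded:
  "\<exists>n. \<forall>w w'. (\<forall>i<n. w i = w' i) \<longrightarrow> psat N w \<phi> = psat N w' \<phi>"
proof -
  obtain n where n: "\<forall>i\<in>fv \<phi> \<union> fv_RV \<phi>. i < n"
    using finite_nat_set_iff_bounded finite_fv finite_fv_RV by (metis finite_UnI)
  have "psat N w \<phi> = psat N w' \<phi>" if "\<forall>i<3 * n + 3. w i = w' i" for w w'
  proof (rule psat_cong)
    fix i assume "i \<in> fv \<phi>"
    then have "i < n" using n by blast
    then show "w (3 * i) = w' (3 * i)" by (intro that[rule_format]) simp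
  next
    fix j assume "j \<in> fv_RV \<phi>"
    then have "j < n" using n by blast
    then show "w (3 * j + 1) = w' (3 * j + 1)" "w (3 * j + 2) = w' (3 * j + 2)"
      by (intro that[rule_format]; simp)+
  qed
  then show ?thesis by blast
qed

lemma psat_simps:
  "psat N w (Neg \<phi>) \<longleftrightarrow> \<not> psat N w \<phi>"
  "psat N w (Conj \<phi> \<psi>) \<longleftrightarrow> psat N w \<phi> \<and> psat N w \<psi>"
  by (simp_all add: psat_def)

lemma psat_Ex: "psat N w (Ex i \<phi>) \<longleftrightarrow> (\<exists>x\<in>carrier N. psat N (w(3 * i := x)) \<phi>)"
  unfolding psat_def by simp

text \<open>An imaginary quantifier becomes two field quantifiers, for centre and radius; every pair
  is admissible because \<open>rvd\<close> corrects unsuitable radii.\<close>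

lemma (in vfield) psat_ExRV:
  "psat N w (ExRV j \<phi>) \<longleftrightarrow>
    (\<exists>c\<in>carrier N. \<exists>d\<in>carrier N. psat N (w(3 * j + 1 := c, 3 * j + 2 := d)) \<phi>)"
proof -
  have k: "kpart (w(3 * j + 1 := c, 3 * j + 2 := d)) = kpart w" for c d
    by (simp only: kpart_upd)
  have "psat N w (ExRV j \<phi>) \<longleftrightarrow> (\<exists>\<xi>\<in>RV_sort N. sat N (kpart w) ((ipart N w)(j := \<xi>)) \<phi>)"
    by (simp add: psat_def)
  also have "\<dots> \<longleftrightarrow> (\<exists>c\<in>carrier N. \<exists>d\<in>carrier N. sat N (kpart w) ((ipart N w)(j := rvd N d c)) \<phi>)"
    by (simp only: Bex_def RV_sort_rvd) blast
  finally show ?thesis unfolding psat_def k ipart_upd .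
qed

text \<open>Los's theorem holds for these formulas before anything is known about the classes of the
  ultrapower, and yields that it is a valued field with the expected classes.\<close>

primrec konly :: "('f, 'r, 'p) fm \<Rightarrow> bool" where
  "konly (Eq s t) \<longleftrightarrow> True"
| "konly (InO t) \<longleftrightarrow> True"
| "konly (Rel r ts) \<longleftrightarrow> True"
| "konly (RVRel p js) \<longleftrightarrow> False"
| "konly (InClass t j) \<longleftrightarrow> False"
| "konly (Neg \<phi>) \<longleftrightarrow> konly \<phi>"
| "konly (Conj \<phi> \<psi>) \<longleftrightarrow> konly \<phi> \<and> konly \<psi>"
| "konly (Ex i \<phi>) \<longleftrightarrow> konly \<phi>"
| "konly (ExRV j \<phi>) \<longleftrightarrow> False"

lemma konly_fv_RV: "konly \<phi> \<Longrightarrow> fv_RV \<phi> = {}"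
  by (induction \<phi>) auto

lemma konly_ren: "konly \<phi> \<Longrightarrow> konly (ren \<phi> \<tau> \<sigma>)"
  by (induction \<phi> arbitrary: \<tau> \<sigma>) (auto simp: Let_def)

lemma konly_derived [simp]:
  "konly (Iff \<phi> \<psi>) \<longleftrightarrow> konly \<phi> \<and> konly \<psi>"
  "konly (Imp \<phi> \<psi>) \<longleftrightarrow> konly \<phi> \<and> konly \<psi>"
  "konly (Disj \<phi> \<psi>) \<longleftrightarrow> konly \<phi> \<and> konly \<psi>"
  "konly (All i \<phi>) \<longleftrightarrow> konly \<phi>"
  by (auto simp: Iff_def Imp_def Disj_def All_def)

lemma konly_memF [simp]: "konly (memF d c y)"
  unfolding memF_def by (rule konly_ren) (simp add: memF0_def scaleF_def)

lemma eval_closed: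
  assumes "is_structure L N" "wf_tm L t" "\<And>i. e i \<in> carrier N"
  shows "eval N e t \<in> carrier N"
  using assms(2)
proof (induction t)
  case (Fun f ts)
  then have l: "map (eval N e) ts \<in> lists (carrier N)" by (auto simp: list_all_iff)
  have "(f, length ts) \<in> funs L" using Fun.prems by simp
  moreover have "\<forall>(f, n)\<in>funs L. \<forall>xs\<in>lists (carrier N). length xs = n \<longrightarrow> fn N f xs \<in> carrier N"
    using assms(1) by (simp add: is_structure_def)
  ultimately have "\<forall>xs\<in>lists (carrier N). length xs = length ts \<longrightarrow> fn N f xs \<in> carrier N"
    by blast
  from bspec[OF this l] have "fn N f (map (eval N e) ts) \<in> carrier N" by simp
  then show ?case by simp
next
  case Zero
  show ?case using assms(1) unfolding is_structure_def eval.simps by blast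
next
  case One
  show ?case using assms(1) unfolding is_structure_def eval.simps by blast
next
  case (Add s t)
  then have "eval N e s \<in> carrier N" "eval N e t \<in> carrier N" by simp_all
  with assms(1) show ?case unfolding is_structure_def eval.simps by blast
next
  case (Mul s t)
  then have "eval N e s \<in> carrier N" "eval N e t \<in> carrier N" by simp_all
  with assms(1) show ?case unfolding is_structure_def eval.simps by blast
qed (simp add: assms(3))

section \<open>Restricted ultrapowers\<close>

text \<open>The universe \<open>H\<close> of functions is closed under Skolem functions but need not contain all
  functions, which allows the ultrapower to stay small.\<close>

definition sec :: "(nat \<Rightarrow> 'i \<Rightarrow> 'u) \<Rightarrow> 'i \<Rightarrow> nat \<Rightarrow> 'u" where
  "sec w F = (\<lambda>i. w i F)"

lemma sec_upd [simp]: "sec (w(i := h)) F = (sec w F)(i := h F)"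
  by (auto simp: sec_def)

text \<open>\<open>skolem\<close> provides a witness for one of two quantifiers and leaves the other
  in place, as the pair that represents an imaginary quantifier requires; for \<open>k = k'\<close>
  the update at \<open>k\<close> prevails and a single quantifier remains. \<open>\<pi>\<close>
  picks a point of \<open>'u\<close> for each class of functions, which places the ultrapower in
  \<open>'u\<close>.\<close>

locale ultrapower = vfield M
  for M :: "('u, 'f, 'r, 'p) vstruct" (structure) +
  fixes L :: "('f, 'r, 'p) lang" and U :: "'i filter" and H :: "('i \<Rightarrow> 'u) set"
    and \<pi> :: "('i \<Rightarrow> 'u) \<Rightarrow> 'u"
  assumes struct: "is_structure L M" and ultra: "ultra U"
    and H_car: "\<And>g F. g \<in> H \<Longrightarrow> g F \<in> carrier M"
    and H_ne: "H \<noteq> {}"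
    and skolem: "\<And>\<phi> w k k'. wf_fm L \<phi> \<Longrightarrow> (\<And>i. w i \<in> H) \<Longrightarrow>
      \<exists>h\<in>H. \<forall>F. (\<exists>x\<in>carrier M. \<exists>y\<in>carrier M. psat M ((sec w F)(k' := y, k := x)) \<phi>) \<longrightarrow>
        (\<exists>y\<in>carrier M. psat M ((sec w F)(k' := y, k := h F)) \<phi>)"
    and \<pi>_eq: "\<And>g h. g \<in> H \<Longrightarrow> h \<in> H \<Longrightarrow> \<pi> g = \<pi> h \<longleftrightarrow> eventually (\<lambda>F. g F = h F) U"
begin

text \<open>A Skolem function of \<open>Eq (Var k) t\<close> for a fresh \<open>k\<close> can only
  be the value of \<open>t\<close>.\<close>

lemma eval_H:
  assumes "wf_tm L t" "\<And>i. e i \<in> H"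
  shows "(\<lambda>F. eval M (sec e F) t) \<in> H"
proof -
  define k where "k = fresh (vars_tm t)"
  have k: "k \<notin> vars_tm t" unfolding k_def by (rule fresh_notin) (rule finite_vars_tm)
  \<comment> \<open>Dividing by 3 puts \<open>e i\<close> where \<open>kpart\<close> reads variable
    \<open>i\<close>.\<close>
  define w where "w = (\<lambda>i. e (i div 3))"
  have w: "kpart (sec w F) = sec e F" for F by (auto simp: kpart_def sec_def w_def)
  have ev: "eval M ((sec e F)(k := x)) t = eval M (sec e F) t" for F x
    by (rule eval_cong) (use k in auto)
  have ps: "psat M ((sec w F)(3 * k := y, 3 * k := x)) (Eq (Var k) t) \<longleftrightarrow> x = eval M (sec e F) t" for x y F
    unfolding psat_def by (simp add: w ev del: fun_upd_apply) (simp add: ev)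
  obtain h where h: "h \<in> H" "\<forall>F. (\<exists>x\<in>carrier M. \<exists>y\<in>carrier M. x = eval M (sec e F) t) \<longrightarrow>
        (\<exists>y\<in>carrier M. h F = eval M (sec e F) t)"
    using skolem[of "Eq (Var k) t" w "3 * k" "3 * k"] assms unfolding ps by (auto simp: w_def)
  have "eval M (sec e F) t \<in> carrier M" for F
    using assms by (intro eval_closed[OF struct]) (auto simp: sec_def H_car)
  with h(2) have "h = (\<lambda>F. eval M (sec e F) t)" by blast
  with h(1) show ?thesis by simp
qed

definition rp :: "'u \<Rightarrow> 'i \<Rightarrow> 'u" where
  "rp = inv_into H \<pi>"

lemma rp_H: "x \<in> \<pi> ` H \<Longrightarrow> rp x \<in> H"
  unfolding rp_def by (rule inv_into_into)

lemma \<pi>_rp: "x \<in> \<pi> ` H \<Longrightarrow> \<pi> (rp x) = x"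
  using f_inv_into_f[of x \<pi> H] by (simp add: rp_def)

lemma rp_ev: "g \<in> H \<Longrightarrow> eventually (\<lambda>F. rp (\<pi> g) F = g F) U"
  using \<pi>_eq[of "rp (\<pi> g)" g] rp_H[of "\<pi> g"] \<pi>_rp[of "\<pi> g"] by auto

text \<open>The predicates on RV have to be described by classes of the ultrapower, so their
  interpretation is left as a parameter until these classes are understood.\<close>

definition upow :: "('p \<Rightarrow> 'u set list set) \<Rightarrow> ('u, 'f, 'r, 'p) vstruct" where
  "upow P = \<lparr>carrier = \<pi> ` H, monoid.mult = (\<lambda>a b. \<pi> (\<lambda>F. rp a F \<otimes> rp b F)), one = \<pi> (\<lambda>_. \<one>),
     zero = \<pi> (\<lambda>_. \<zero>), add = (\<lambda>a b. \<pi> (\<lambda>F. rp a F \<oplus> rp b F)),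
     val_O = \<pi> ` {g \<in> H. eventually (\<lambda>F. g F \<in> val_O M) U},
     fn = (\<lambda>f xs. \<pi> (\<lambda>F. fn M f (map (\<lambda>x. rp x F) xs))),
     rl = (\<lambda>r. {map \<pi> gs | gs. set gs \<subseteq> H \<and> eventually (\<lambda>F. map (\<lambda>g. g F) gs \<in> rl M r) U}),
     rvp = P\<rparr>"

lemma upow_carrier: "carrier (upow P) = \<pi> ` H"
  by (simp add: upow_def)

lemma los_eval:
  assumes "wf_tm L t" "\<And>i. e i \<in> H"
  shows "eval (upow P) (\<pi> \<circ> e) t = \<pi> (\<lambda>F. eval M (sec e F) t)"
  using assms(1)
proof (induction t)
  case (Var i)
  then show ?case by (simp add: sec_def)
next
  case Zero
  then show ?case by (simp add: upow_def)
next
  case One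
  then show ?case by (simp add: upow_def)
next
  case (Add s t)
  let ?s = "\<lambda>F. eval M (sec e F) s" and ?t = "\<lambda>F. eval M (sec e F) t"
  have st: "?s \<in> H" "?t \<in> H" using Add.prems assms(2) by (auto intro: eval_H)
  \<comment> \<open>\<open>\<pi>_eq\<close> speaks of members of \<open>H\<close>, so the pointwise
    sum of the representatives first has to be recognized as the value of a term.\<close>
  have "(\<lambda>F. eval M (sec (\<lambda>i. if i = 0 then rp (\<pi> ?s) else rp (\<pi> ?t)) F) (Add (Var 0) (Var 1))) \<in> H"
    using st by (intro eval_H) (auto intro: rp_H)
  then have "(\<lambda>F. rp (\<pi> ?s) F \<oplus> rp (\<pi> ?t) F) \<in> H" by (simp add: sec_def)
  moreover have "(\<lambda>F. ?s F \<oplus> ?t F) \<in> H"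
    using eval_H[OF Add.prems assms(2)] by simp
  ultimately have "\<pi> (\<lambda>F. rp (\<pi> ?s) F \<oplus> rp (\<pi> ?t) F) = \<pi> (\<lambda>F. ?s F \<oplus> ?t F)"
    using rp_ev[OF st(1)] rp_ev[OF st(2)] by (subst \<pi>_eq) (auto elim: eventually_elim2)
  then show ?case using Add by (simp add: upow_def)
next
  case (Mul s t)
  let ?s = "\<lambda>F. eval M (sec e F) s" and ?t = "\<lambda>F. eval M (sec e F) t"
  have st: "?s \<in> H" "?t \<in> H" using Mul.prems assms(2) by (auto intro: eval_H)
  have "(\<lambda>F. eval M (sec (\<lambda>i. if i = 0 then rp (\<pi> ?s) else rp (\<pi> ?t)) F) (Mul (Var 0) (Var 1))) \<in> H"
    using st by (intro eval_H) (auto intro: rp_H)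
  then have "(\<lambda>F. rp (\<pi> ?s) F \<otimes> rp (\<pi> ?t) F) \<in> H" by (simp add: sec_def)
  moreover have "(\<lambda>F. ?s F \<otimes> ?t F) \<in> H"
    using eval_H[OF Mul.prems assms(2)] by simp
  ultimately have "\<pi> (\<lambda>F. rp (\<pi> ?s) F \<otimes> rp (\<pi> ?t) F) = \<pi> (\<lambda>F. ?s F \<otimes> ?t F)"
    using rp_ev[OF st(1)] rp_ev[OF st(2)] by (subst \<pi>_eq) (auto elim: eventually_elim2)
  then show ?case using Mul by (simp add: upow_def)
next
  case (Fun f ts)
  let ?g = "\<lambda>t F. eval M (sec e F) t"
  have f: "(f, length ts) \<in> funs L" and wf: "\<And>t. t \<in> set ts \<Longrightarrow> wf_tm L t"
    using Fun.prems by (auto simp: list_all_iff)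
  have g: "?g t \<in> H" if "t \<in> set ts" for t using wf[OF that] assms(2) by (rule eval_H)
  have IH: "map (eval (upow P) (\<pi> \<circ> e)) ts = map (\<lambda>t. \<pi> (?g t)) ts"
    by (intro map_cong refl Fun.IH wf)
  obtain h0 where h0: "h0 \<in> H" using H_ne by blast
  let ?e = "\<lambda>i. if i < length ts then rp (\<pi> (?g (ts ! i))) else h0"
  have "(\<lambda>F. eval M (sec ?e F) (Fun f (map Var [0..<length ts]))) \<in> H"
    using f h0 g by (intro eval_H) (auto intro: rp_H simp: list_all_iff)
  moreover have "map (eval M (sec ?e F)) (map Var [0..<length ts]) = map (\<lambda>t. rp (\<pi> (?g t)) F) ts" for F
    by (rule nth_equalityI) (auto simp: sec_def)
  ultimately have "(\<lambda>F. fn M f (map (\<lambda>t. rp (\<pi> (?g t)) F) ts)) \<in> H"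
    by (simp only: eval.simps)
  moreover have "(\<lambda>F. fn M f (map (\<lambda>t. ?g t F) ts)) \<in> H"
    using eval_H[OF Fun.prems assms(2)] by simp
  moreover have "eventually (\<lambda>F. fn M f (map (\<lambda>t. rp (\<pi> (?g t)) F) ts) = fn M f (map (\<lambda>t. ?g t F) ts)) U"
  proof -
    have "eventually (\<lambda>F. \<forall>t\<in>set ts. rp (\<pi> (?g t)) F = ?g t F) U"
      by (intro eventually_ball_finite ballI rp_ev g) auto
    then show ?thesis
    proof eventually_elim
      case (elim F)
      then have "map (\<lambda>t. rp (\<pi> (?g t)) F) ts = map (\<lambda>t. ?g t F) ts" by (intro map_cong refl) blast
      then show ?case by (simp only:)
    qed
  qed
  ultimately have e2: "\<pi> (\<lambda>F. fn M f (map (\<lambda>t. rp (\<pi> (?g t)) F) ts)) = \<pi> (\<lambda>F. fn M f (map (\<lambda>t. ?g t F) ts))"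
    by (subst \<pi>_eq)
  have e1: "eval (upow P) (\<pi> \<circ> e) (Fun f ts) = \<pi> (\<lambda>F. fn M f (map (\<lambda>t. rp (\<pi> (?g t)) F) ts))"
    unfolding eval.simps IH by (simp add: upow_def comp_def)
  show ?case unfolding e1 e2 by simp
qed

section \<open>Los's theorem for the restricted ultrapower\<close>

lemma \<pi>_lists:
  assumes "map \<pi> gs = map \<pi> hs" "set gs \<subseteq> H" "set hs \<subseteq> H"
  shows "eventually (\<lambda>F. map (\<lambda>g. g F) gs = map (\<lambda>g. g F) hs) U"
proof -
  have "length gs = length hs" using assms(1) map_eq_imp_length_eq by blast
  then show ?thesis using assms
  proof (induction gs hs rule: list_induct2)
    case (Cons g gs h hs)
    then have "eventually (\<lambda>F. g F = h F) U" "eventually (\<lambda>F. map (\<lambda>g. g F) gs = map (\<lambda>g. g F) hs) U"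
      using \<pi>_eq by auto
    then show ?case by eventually_elim simp
  qed simp
qed

lemma eventually_eq_cong:
  assumes "eventually (\<lambda>F. f F = g F) U"
  shows "eventually (\<lambda>F. P (f F)) U \<longleftrightarrow> eventually (\<lambda>F. P (g F)) U"
proof
  assume "eventually (\<lambda>F. P (f F)) U"
  with assms show "eventually (\<lambda>F. P (g F)) U" by eventually_elim simp
next
  assume "eventually (\<lambda>F. P (g F)) U"
  with assms show "eventually (\<lambda>F. P (f F)) U" by eventually_elim simp
qed

lemma upow_O: "g \<in> H \<Longrightarrow> \<pi> g \<in> val_O (upow P) \<longleftrightarrow> eventually (\<lambda>F. g F \<in> val_O M) U"
proof
  assume g: "g \<in> H" and "\<pi> g \<in> val_O (upow P)"
  then obtain h where h: "h \<in> H" "eventually (\<lambda>F. h F \<in> val_O M) U" "\<pi> g = \<pi> h"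
    by (auto simp: upow_def)
  then show "eventually (\<lambda>F. g F \<in> val_O M) U"
    using \<pi>_eq[OF g h(1)] eventually_eq_cong[of g h "\<lambda>x. x \<in> val_O M"] by blast
qed (auto simp: upow_def)

lemma upow_rl:
  assumes "set gs \<subseteq> H"
  shows "map \<pi> gs \<in> rl (upow P) r \<longleftrightarrow> eventually (\<lambda>F. map (\<lambda>g. g F) gs \<in> rl M r) U"
proof
  assume "map \<pi> gs \<in> rl (upow P) r"
  then obtain hs where h: "set hs \<subseteq> H" "eventually (\<lambda>F. map (\<lambda>g. g F) hs \<in> rl M r) U" "map \<pi> gs = map \<pi> hs"
    by (auto simp: upow_def)
  then show "eventually (\<lambda>F. map (\<lambda>g. g F) gs \<in> rl M r) U"
    using eventually_eq_cong[OF \<pi>_lists[OF h(3) assms h(1)], of "\<lambda>x. x \<in> rl M r"] by blast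
qed (use assms in \<open>auto simp: upow_def\<close>)

text \<open>\<open>class_ok\<close> and \<open>rvp_ok\<close> amount to Los's theorem for the two
  atoms with imaginary variables. They will be derived from the theorem for \<open>konly\<close>
  formulas, so the theorem assumes them only for the remaining formulas.\<close>

definition class_ok :: "('p \<Rightarrow> 'u set list set) \<Rightarrow> bool" where
  "class_ok P \<longleftrightarrow> valued_field (upow P) \<and>
    (\<forall>y\<in>H. \<forall>c\<in>H. \<forall>d\<in>H. \<pi> y \<in> rvd (upow P) (\<pi> d) (\<pi> c) \<longleftrightarrow> eventually (\<lambda>F. y F \<in> rvd M (d F) (c F)) U)"

definition rvp_ok :: "('p \<Rightarrow> 'u set list set) \<Rightarrow> bool" where
  "rvp_ok P \<longleftrightarrow> (\<forall>w p js. (\<forall>i. w i \<in> H) \<longrightarrow>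
    (map (ipart (upow P) (\<pi> \<circ> w)) js \<in> P p \<longleftrightarrow> eventually (\<lambda>F. map (ipart M (sec w F)) js \<in> rvp M p) U))"

lemma comp_upd: "(\<pi> \<circ> w)(i := \<pi> h) = \<pi> \<circ> (w(i := h))"
  by auto

lemma Los_theorem:
  assumes "wf_fm L \<phi>" "\<And>i. w i \<in> H" "konly \<phi> \<or> class_ok P \<and> rvp_ok P"
  shows "psat (upow P) (\<pi> \<circ> w) \<phi> \<longleftrightarrow> eventually (\<lambda>F. psat M (sec w F) \<phi>) U"
  using assms
proof (induction \<phi> arbitrary: w)
  case (Eq s t)
  have k: "kpart (\<pi> \<circ> w) = \<pi> \<circ> kpart w" "\<And>F. kpart (sec w F) = sec (kpart w) F"
    by (auto simp: kpart_def sec_def)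
  have H: "kpart w i \<in> H" for i by (simp add: kpart_def Eq)
  have "(\<lambda>F. eval M (sec (kpart w) F) s) \<in> H" "(\<lambda>F. eval M (sec (kpart w) F) t) \<in> H"
    using Eq.prems H by (auto intro: eval_H)
  from \<pi>_eq[OF this] show ?case
    using Eq.prems H unfolding psat_def k sat.simps wf_fm.simps by (simp add: los_eval)
next
  case (InO t)
  have k: "kpart (\<pi> \<circ> w) = \<pi> \<circ> kpart w" "\<And>F. kpart (sec w F) = sec (kpart w) F"
    by (auto simp: kpart_def sec_def)
  have H: "kpart w i \<in> H" for i by (simp add: kpart_def InO)
  have "(\<lambda>F. eval M (sec (kpart w) F) t) \<in> H"
    using InO.prems H by (auto intro: eval_H)
  from upow_O[OF this] show ?case
    using InO.prems H unfolding psat_def k sat.simps wf_fm.simps by (simp add: los_eval)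
next
  case (Rel r ts)
  have k: "kpart (\<pi> \<circ> w) = \<pi> \<circ> kpart w" "\<And>F. kpart (sec w F) = sec (kpart w) F"
    by (auto simp: kpart_def sec_def)
  have H: "kpart w i \<in> H" for i by (simp add: kpart_def Rel)
  have wf: "\<And>t. t \<in> set ts \<Longrightarrow> wf_tm L t" using Rel.prems by (auto simp: list_all_iff)
  let ?gs = "map (\<lambda>t F. eval M (sec (kpart w) F) t) ts"
  have gs: "set ?gs \<subseteq> H" using wf H by (auto intro: eval_H)
  have e1: "map (eval (upow P) (\<pi> \<circ> kpart w)) ts = map \<pi> ?gs"
    using wf H by (simp add: los_eval)
  have e2: "map (\<lambda>g. g F) ?gs = map (eval M (sec (kpart w) F)) ts" for F by simp
  show ?case
    unfolding psat_def k sat.simps e1 upow_rl[OF gs] e2 ..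
next
  case (RVRel p js)
  then have "rvp_ok P" by simp
  then have "map (ipart (upow P) (\<pi> \<circ> w)) js \<in> P p \<longleftrightarrow>
      eventually (\<lambda>F. map (ipart M (sec w F)) js \<in> rvp M p) U"
    unfolding rvp_ok_def using RVRel.prems(2) by blast
  moreover have "rvp (upow P) p = P p" by (simp add: upow_def)
  ultimately show ?case unfolding psat_def sat.simps by simp
next
  case (InClass t j)
  then have cl: "class_ok P" by simp
  have k: "kpart (\<pi> \<circ> w) = \<pi> \<circ> kpart w" "\<And>F. kpart (sec w F) = sec (kpart w) F"
    by (auto simp: kpart_def sec_def)
  have H: "kpart w i \<in> H" for i by (simp add: kpart_def InClass)
  have y: "(\<lambda>F. eval M (sec (kpart w) F) t) \<in> H"
    using InClass.prems H by (auto intro: eval_H)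
  have "\<pi> (\<lambda>F. eval M (sec (kpart w) F) t) \<in> rvd (upow P) (\<pi> (w (3 * j + 2))) (\<pi> (w (3 * j + 1))) \<longleftrightarrow>
      eventually (\<lambda>F. eval M (sec (kpart w) F) t \<in> rvd M (w (3 * j + 2) F) (w (3 * j + 1) F)) U"
    using cl[unfolded class_ok_def, THEN conjunct2, rule_format, OF y InClass.prems(2) InClass.prems(2)] .
  then show ?case using InClass.prems H
    unfolding psat_def k sat.simps wf_fm.simps ipart_def by (simp add: los_eval sec_def)
next
  case (Neg \<phi>)
  have "psat (upow P) (\<pi> \<circ> w) \<phi> \<longleftrightarrow> eventually (\<lambda>F. psat M (sec w F) \<phi>) U"
    by (rule Neg.IH) (use Neg.prems in auto)
  then show ?case unfolding psat_simps ultra_not[OF ultra] by (simp only: comp_def)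
next
  case (Conj \<phi> \<psi>)
  have "psat (upow P) (\<pi> \<circ> w) \<phi> \<longleftrightarrow> eventually (\<lambda>F. psat M (sec w F) \<phi>) U"
    by (rule Conj.IH(1)) (use Conj.prems in auto)
  moreover have "psat (upow P) (\<pi> \<circ> w) \<psi> \<longleftrightarrow> eventually (\<lambda>F. psat M (sec w F) \<psi>) U"
    by (rule Conj.IH(2)) (use Conj.prems in auto)
  ultimately show ?case unfolding psat_simps eventually_conj_iff by (simp only: comp_def)
next
  case (Ex i \<phi>)
  have IH: "psat (upow P) ((\<pi> \<circ> w)(3 * i := \<pi> h)) \<phi> \<longleftrightarrow>
      eventually (\<lambda>F. psat M ((sec w F)(3 * i := h F)) \<phi>) U" if "h \<in> H" for h
  proof -
    have "psat (upow P) (\<pi> \<circ> w(3 * i := h)) \<phi> \<longleftrightarrow> eventually (\<lambda>F. psat M (sec (w(3 * i := h)) F) \<phi>) U"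
      by (rule Ex.IH) (use Ex.prems that in auto)
    then show ?thesis unfolding comp_upd sec_upd .
  qed
  have "psat (upow P) (\<pi> \<circ> w) (Ex i \<phi>) \<longleftrightarrow> (\<exists>h\<in>H. psat (upow P) ((\<pi> \<circ> w)(3 * i := \<pi> h)) \<phi>)"
    unfolding psat_Ex upow_carrier by blast
  also have "\<dots> \<longleftrightarrow> (\<exists>h\<in>H. eventually (\<lambda>F. psat M ((sec w F)(3 * i := h F)) \<phi>) U)"
    using IH by blast
  also have "\<dots> \<longleftrightarrow> eventually (\<lambda>F. \<exists>x\<in>carrier M. psat M ((sec w F)(3 * i := x)) \<phi>) U"
  proof
    assume "\<exists>h\<in>H. eventually (\<lambda>F. psat M ((sec w F)(3 * i := h F)) \<phi>) U"
    then obtain h where h: "h \<in> H" "eventually (\<lambda>F. psat M ((sec w F)(3 * i := h F)) \<phi>) U" by blast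
    from h(2) show "eventually (\<lambda>F. \<exists>x\<in>carrier M. psat M ((sec w F)(3 * i := x)) \<phi>) U"
      by eventually_elim (use H_car[OF h(1)] in blast)
  next
    assume ev: "eventually (\<lambda>F. \<exists>x\<in>carrier M. psat M ((sec w F)(3 * i := x)) \<phi>) U"
    obtain h where h: "h \<in> H" "\<forall>F. (\<exists>x\<in>carrier M. \<exists>y\<in>carrier M. psat M ((sec w F)(3 * i := x)) \<phi>) \<longrightarrow>
        (\<exists>y\<in>carrier M. psat M ((sec w F)(3 * i := h F)) \<phi>)"
      using skolem[of \<phi> w "3 * i" "3 * i"] Ex.prems by auto
    from ev have "eventually (\<lambda>F. psat M ((sec w F)(3 * i := h F)) \<phi>) U"
      by eventually_elim (use h(2) in blast)
    with h(1) show "\<exists>h\<in>H. eventually (\<lambda>F. psat M ((sec w F)(3 * i := h F)) \<phi>) U" by blast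
  qed
  finally show ?case unfolding psat_Ex .
next
  case (ExRV j \<phi>)
  then have "valued_field (upow P)" by (simp add: class_ok_def)
  then interpret N: vfield "upow P" by unfold_locales
  let ?c = "3 * j + 1" and ?d = "3 * j + 2"
  have IH: "psat (upow P) ((\<pi> \<circ> w)(?c := \<pi> c, ?d := \<pi> d)) \<phi> \<longleftrightarrow>
      eventually (\<lambda>F. psat M ((sec w F)(?c := c F, ?d := d F)) \<phi>) U" if "c \<in> H" "d \<in> H" for c d
  proof -
    have "psat (upow P) (\<pi> \<circ> w(?c := c, ?d := d)) \<phi> \<longleftrightarrow>
        eventually (\<lambda>F. psat M (sec (w(?c := c, ?d := d)) F) \<phi>) U"
      by (rule ExRV.IH) (use ExRV.prems that in auto)
    then show ?thesis unfolding comp_upd sec_upd .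
  qed
  have "psat (upow P) (\<pi> \<circ> w) (ExRV j \<phi>) \<longleftrightarrow>
      (\<exists>c\<in>H. \<exists>d\<in>H. psat (upow P) ((\<pi> \<circ> w)(?c := \<pi> c, ?d := \<pi> d)) \<phi>)"
    unfolding N.psat_ExRV upow_carrier by blast
  also have "\<dots> \<longleftrightarrow> (\<exists>c\<in>H. \<exists>d\<in>H. eventually (\<lambda>F. psat M ((sec w F)(?c := c F, ?d := d F)) \<phi>) U)"
    using IH by blast
  also have "\<dots> \<longleftrightarrow> eventually (\<lambda>F. \<exists>x\<in>carrier M. \<exists>y\<in>carrier M. psat M ((sec w F)(?c := x, ?d := y)) \<phi>) U"
  proof
    assume "\<exists>c\<in>H. \<exists>d\<in>H. eventually (\<lambda>F. psat M ((sec w F)(?c := c F, ?d := d F)) \<phi>) U"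
    then obtain c d where h: "c \<in> H" "d \<in> H"
      "eventually (\<lambda>F. psat M ((sec w F)(?c := c F, ?d := d F)) \<phi>) U" by blast
    from h(3) show "eventually (\<lambda>F. \<exists>x\<in>carrier M. \<exists>y\<in>carrier M. psat M ((sec w F)(?c := x, ?d := y)) \<phi>) U"
      by eventually_elim (use H_car[OF h(1)] H_car[OF h(2)] in blast)
  next
    assume ev: "eventually (\<lambda>F. \<exists>x\<in>carrier M. \<exists>y\<in>carrier M. psat M ((sec w F)(?c := x, ?d := y)) \<phi>) U"
    \<comment> \<open>The choice of the radius may depend on the centre: a first application of
      \<open>skolem\<close> fixes the centre and keeps the radius quantified, a second one finds a
      radius for that centre.\<close>
    have tw: "v(?d := y, ?c := x) = v(?c := x, ?d := y)" for v :: "nat \<Rightarrow> 'u" and x y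
      by (rule fun_upd_twist) simp
    have "\<exists>h\<in>H. \<forall>F. (\<exists>x\<in>carrier M. \<exists>y\<in>carrier M. psat M ((sec w F)(?c := x, ?d := y)) \<phi>) \<longrightarrow>
        (\<exists>y\<in>carrier M. psat M ((sec w F)(?c := h F, ?d := y)) \<phi>)"
      using skolem[of \<phi> w ?d ?c] ExRV.prems unfolding tw by simp
    then obtain c where c: "c \<in> H" "\<forall>F. (\<exists>x\<in>carrier M. \<exists>y\<in>carrier M. psat M ((sec w F)(?c := x, ?d := y)) \<phi>) \<longrightarrow>
        (\<exists>y\<in>carrier M. psat M ((sec w F)(?c := c F, ?d := y)) \<phi>)"
      by blast
    have wc: "(w(?c := c)) i \<in> H" for i using ExRV.prems(2) c(1) by simp
    have wf: "wf_fm L \<phi>" using ExRV.prems(1) by simp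
    have "\<exists>h\<in>H. \<forall>F. (\<exists>x\<in>carrier M. \<exists>y\<in>carrier M. psat M ((sec w F)(?c := c F, ?d := x)) \<phi>) \<longrightarrow>
        (\<exists>y\<in>carrier M. psat M ((sec w F)(?c := c F, ?d := h F)) \<phi>)"
      using skolem[where w = "w(?c := c)" and k = "?d" and k' = "?d", OF wf wc] unfolding sec_upd fun_upd_upd .
    then obtain d where d: "d \<in> H" "\<forall>F. (\<exists>x\<in>carrier M. \<exists>y\<in>carrier M. psat M ((sec w F)(?c := c F, ?d := x)) \<phi>) \<longrightarrow>
        (\<exists>y\<in>carrier M. psat M ((sec w F)(?c := c F, ?d := d F)) \<phi>)"
      by blast
    from ev have "eventually (\<lambda>F. psat M ((sec w F)(?c := c F, ?d := d F)) \<phi>) U"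
      by eventually_elim (use c(2) d(2) in blast)
    with c(1) d(1) show "\<exists>c\<in>H. \<exists>d\<in>H. eventually (\<lambda>F. psat M ((sec w F)(?c := c F, ?d := d F)) \<phi>) U"
      by blast
  qed
  finally show ?case unfolding psat_ExRV .
qed

end

section \<open>The ultrapower as a valued field and as a model of the theory\<close>

definition env3 :: "'a \<Rightarrow> 'a \<Rightarrow> 'a \<Rightarrow> 'a \<Rightarrow> nat \<Rightarrow> 'a" where
  "env3 a b c d = (\<lambda>i. if i = 0 then a else if i = 1 then b else if i = 2 then c else d)"

lemma env3_simps [simp]: "env3 a b c d 0 = a" "env3 a b c d 1 = b" "env3 a b c d (Suc 0) = b"
  "env3 a b c d 2 = c" "env3 a b c d 3 = d" "env3 a b c d 4 = d"
  by (auto simp: env3_def)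

lemma env3_all: "Q a \<Longrightarrow> Q b \<Longrightarrow> Q c \<Longrightarrow> Q d \<Longrightarrow> Q (env3 a b c d i)"
  by (simp add: env3_def)

text \<open>Equality of classes and membership in RV are expressed on representatives, so that the
  formulas are \<open>konly\<close>. Variables 0, 1 and 2, 3 are radius and centre of the two
  classes.\<close>

definition eqF :: "('f, 'r, 'p) fm" where
  "eqF = All 4 (Iff (memF 0 1 4) (memF 2 3 4))"

definition inRVF :: "('f, 'r, 'p) fm" where
  "inRVF = Ex 2 (Conj (Eq (Var 2) One) (Ex 3 eqF))"

lemma konly_eqF: "konly eqF" "konly inRVF" "wf_fm L eqF" "wf_fm L inRVF"
  by (simp_all add: eqF_def inRVF_def fv_memF)

context vfield
begin

lemma sat_eqF:
  assumes "kenv N e"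
  shows "sat N e z eqF \<longleftrightarrow> rvd N (e 0) (e 1) = rvd N (e 2) (e 3)"
proof -
  have "sat N e z eqF \<longleftrightarrow>
      (\<forall>y\<in>carrier N. y \<in> rvd N (e 0) (e 1) \<longleftrightarrow> y \<in> rvd N (e 2) (e 3))"
    using kenvD[OF assms] by (simp add: eqF_def sat_memF in_rvd)
  moreover have "rvd N (e 0) (e 1) \<subseteq> carrier N" "rvd N (e 2) (e 3) \<subseteq> carrier N"
    by (intro RV_sort_subset rvd_in_sort kenvD[OF assms])+
  ultimately show ?thesis by blast
qed

lemma RV_rvd: "\<xi> \<in> RV N \<longleftrightarrow> (\<exists>c\<in>carrier N. \<xi> = rvd N \<one> c)"
  by (auto simp: RV_eq rvd_scale)

lemma sat_inRVF:
  assumes "kenv N e"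
  shows "sat N e z inRVF \<longleftrightarrow> rvd N (e 0) (e 1) \<in> RV N"
proof -
  have "sat N (e(2 := \<one>, 3 := c)) z eqF \<longleftrightarrow> rvd N (e 0) (e 1) = rvd N \<one> c" if "c \<in> carrier N" for c
    using that by (subst sat_eqF) (simp_all add: kenv_upd assms)
  then show ?thesis
    unfolding inRVF_def RV_rvd by (simp cong: bex_cong)
qed

end

context ultrapower
begin

lemma los_konly:
  assumes "konly \<phi>" "wf_fm L \<phi>" "\<And>i. e i \<in> H"
  shows "sat (upow P) (\<pi> \<circ> e) z \<phi> \<longleftrightarrow> eventually (\<lambda>F. sat M (sec e F) z' \<phi>) U"
proof -
  let ?w = "\<lambda>i. e (i div 3)"
  have k: "kpart (\<pi> \<circ> ?w) = \<pi> \<circ> e" "kpart (sec ?w F) = sec e F" for F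
    by (auto simp: kpart_def sec_def)
  have "psat (upow P) (\<pi> \<circ> ?w) \<phi> \<longleftrightarrow> eventually (\<lambda>F. psat M (sec ?w F) \<phi>) U"
    by (rule Los_theorem) (use assms in auto)
  moreover have "psat (upow P) (\<pi> \<circ> ?w) \<phi> \<longleftrightarrow> sat (upow P) (\<pi> \<circ> e) z \<phi>"
    unfolding psat_def k by (rule sat_cong) (simp_all add: konly_fv_RV assms(1))
  moreover have "psat M (sec ?w F) \<phi> \<longleftrightarrow> sat M (sec e F) z' \<phi>" for F
    unfolding psat_def k by (rule sat_cong) (simp_all add: konly_fv_RV assms(1))
  ultimately show ?thesis by (simp only:)
qed

lemma kenv_sec: "(\<And>i. e i \<in> H) \<Longrightarrow> kenv M (sec e F)"
  by (simp add: kenv_def sec_def H_car)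

lemma transfer_konly:
  assumes "konly \<phi>" "wf_fm L \<phi>" "\<And>e z. kenv M e \<Longrightarrow> sat M e z \<phi>" "kenv (upow P) e"
  shows "sat (upow P) e z \<phi>"
proof -
  have e: "e = \<pi> \<circ> (\<lambda>i. rp (e i))" "\<And>i. rp (e i) \<in> H"
    using kenvD[OF assms(4)] by (auto simp: upow_carrier \<pi>_rp rp_H)
  have "eventually (\<lambda>F. sat M (sec (\<lambda>i. rp (e i)) F) z \<phi>) U"
    by (intro always_eventually allI assms(3) kenv_sec e(2))
  then have "sat (upow P) (\<pi> \<circ> (\<lambda>i. rp (e i))) z \<phi>"
    by (rule iffD2[OF los_konly[where e = "\<lambda>i. rp (e i)" and z' = z, OF assms(1,2) e(2)]])
  then show ?thesis using e(1) by simp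
qed

text \<open>Every axiom is transferred as a \<open>konly\<close> formula in at most three variables.
  Closure of the carrier becomes an existential statement, since quantifiers range over the carrier;
  so do negatives and inverses, for which the language has no symbols.\<close>

lemma upow_valued_field: "valued_field (upow P)"
proof -
  define N where "N = upow P"
  have T: "sat N (env3 x y z z) (\<lambda>_. {}) \<phi>"
    if "konly \<phi>" "wf_fm L \<phi>" "\<And>e z. kenv M e \<Longrightarrow> sat M e z \<phi>"
      "x \<in> carrier N" "y \<in> carrier N" "z \<in> carrier N" for \<phi> x y z
    unfolding N_def by (rule transfer_konly[OF that(1-3)]) (use that in \<open>auto simp: N_def kenv_def intro: env3_all\<close>)
  note kD = kenvD[of M]
  obtain x0 where x0: "x0 \<in> carrier N" using H_ne by (auto simp: N_def upow_carrier)
  have zero: "\<zero>\<^bsub>N\<^esub> \<in> carrier N"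
    using T[of "Ex 3 (Eq (Var 3) Zero)" x0 x0 x0] x0 by simp
  have one: "\<one>\<^bsub>N\<^esub> \<in> carrier N"
    using T[of "Ex 3 (Eq (Var 3) One)" x0 x0 x0] x0 by simp
  have add: "x \<oplus>\<^bsub>N\<^esub> y \<in> carrier N" if "x \<in> carrier N" "y \<in> carrier N" for x y
    using T[of "Ex 3 (Eq (Var 3) (Add (Var 0) (Var 1)))" x y x] that by (simp add: kD)
  have mult: "x \<otimes>\<^bsub>N\<^esub> y \<in> carrier N" if "x \<in> carrier N" "y \<in> carrier N" for x y
    using T[of "Ex 3 (Eq (Var 3) (Mul (Var 0) (Var 1)))" x y x] that by (simp add: kD)
  have a_assoc': "x \<oplus>\<^bsub>N\<^esub> y \<oplus>\<^bsub>N\<^esub> z = x \<oplus>\<^bsub>N\<^esub> (y \<oplus>\<^bsub>N\<^esub> z)"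
    if "x \<in> carrier N" "y \<in> carrier N" "z \<in> carrier N" for x y z
    using T[of "Eq (Add (Add (Var 0) (Var 1)) (Var 2)) (Add (Var 0) (Add (Var 1) (Var 2)))" x y z] that
    by (simp add: kD a_assoc)
  have a_comm': "x \<oplus>\<^bsub>N\<^esub> y = y \<oplus>\<^bsub>N\<^esub> x" if "x \<in> carrier N" "y \<in> carrier N" for x y
    using T[of "Eq (Add (Var 0) (Var 1)) (Add (Var 1) (Var 0))" x y x] that
    by (simp add: kD a_comm)
  have l_zero': "\<zero>\<^bsub>N\<^esub> \<oplus>\<^bsub>N\<^esub> x = x" if "x \<in> carrier N" for x
    using T[of "Eq (Add Zero (Var 0)) (Var 0)" x x x] that by (simp add: kD)
  have neg': "\<exists>y\<in>carrier N. y \<oplus>\<^bsub>N\<^esub> x = \<zero>\<^bsub>N\<^esub>" if "x \<in> carrier N" for x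
  proof -
    have "\<exists>y\<in>carrier M. y \<oplus> u = \<zero>" if "u \<in> carrier M" for u
      using that by (intro bexI[of _ "\<ominus> u"]) (auto simp: l_neg)
    then show ?thesis
      using T[of "Ex 3 (Eq (Add (Var 3) (Var 0)) Zero)" x x x] \<open>x \<in> carrier N\<close> by (simp add: kD)
  qed
  have m_assoc': "x \<otimes>\<^bsub>N\<^esub> y \<otimes>\<^bsub>N\<^esub> z = x \<otimes>\<^bsub>N\<^esub> (y \<otimes>\<^bsub>N\<^esub> z)"
    if "x \<in> carrier N" "y \<in> carrier N" "z \<in> carrier N" for x y z
    using T[of "Eq (Mul (Mul (Var 0) (Var 1)) (Var 2)) (Mul (Var 0) (Mul (Var 1) (Var 2)))" x y z] that
    by (simp add: kD m_assoc)
  have m_comm': "x \<otimes>\<^bsub>N\<^esub> y = y \<otimes>\<^bsub>N\<^esub> x" if "x \<in> carrier N" "y \<in> carrier N" for x y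
    using T[of "Eq (Mul (Var 0) (Var 1)) (Mul (Var 1) (Var 0))" x y x] that
    by (simp add: kD m_comm)
  have l_one': "\<one>\<^bsub>N\<^esub> \<otimes>\<^bsub>N\<^esub> x = x" if "x \<in> carrier N" for x
    using T[of "Eq (Mul One (Var 0)) (Var 0)" x x x] that by (simp add: kD)
  have distr': "(x \<oplus>\<^bsub>N\<^esub> y) \<otimes>\<^bsub>N\<^esub> z = x \<otimes>\<^bsub>N\<^esub> z \<oplus>\<^bsub>N\<^esub> y \<otimes>\<^bsub>N\<^esub> z"
    if "x \<in> carrier N" "y \<in> carrier N" "z \<in> carrier N" for x y z
    using T[of "Eq (Mul (Add (Var 0) (Var 1)) (Var 2)) (Add (Mul (Var 0) (Var 2)) (Mul (Var 1) (Var 2)))" x y z] that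
    by (simp add: kD l_distr)
  have nontriv: "\<zero>\<^bsub>N\<^esub> \<noteq> \<one>\<^bsub>N\<^esub>"
    using T[of "Neg (Eq Zero One)" x0 x0 x0] x0 by simp
  have inv': "\<exists>y\<in>carrier N. x \<otimes>\<^bsub>N\<^esub> y = \<one>\<^bsub>N\<^esub> \<and> (x \<in> val_O N \<or> y \<in> val_O N)"
    if "x \<in> carrier N" "x \<noteq> \<zero>\<^bsub>N\<^esub>" for x
  proof -
    have "\<exists>y\<in>carrier M. u \<otimes> y = \<one> \<and> (u \<in> val_O M \<or> y \<in> val_O M)" if "u \<in> carrier M" "u \<noteq> \<zero>" for u
      using that O_total by (intro bexI[of _ "inv u"]) auto
    then show ?thesis
      using T[of "Imp (Neg (Eq (Var 0) Zero)) (Ex 3 (Conj (Eq (Mul (Var 0) (Var 3)) One) (Disj (InO (Var 0)) (InO (Var 3)))))" x x x]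
        that by (simp add: kD)
  qed
  have O1: "\<one>\<^bsub>N\<^esub> \<in> val_O N"
    using T[of "InO One" x0 x0 x0] x0 by simp
  have Oadd: "x \<oplus>\<^bsub>N\<^esub> y \<in> val_O N" if "x \<in> carrier N" "y \<in> carrier N" "x \<in> val_O N" "y \<in> val_O N" for x y
    using T[of "Imp (Conj (InO (Var 0)) (InO (Var 1))) (InO (Add (Var 0) (Var 1)))" x y x] that by simp
  have Omult: "x \<otimes>\<^bsub>N\<^esub> y \<in> val_O N" if "x \<in> carrier N" "y \<in> carrier N" "x \<in> val_O N" "y \<in> val_O N" for x y
    using T[of "Imp (Conj (InO (Var 0)) (InO (Var 1))) (InO (Mul (Var 0) (Var 1)))" x y x] that by simp
  have Oneg: "\<exists>y\<in>carrier N. y \<oplus>\<^bsub>N\<^esub> x = \<zero>\<^bsub>N\<^esub> \<and> y \<in> val_O N" if "x \<in> carrier N" "x \<in> val_O N" for x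
  proof -
    have "\<exists>y\<in>carrier M. y \<oplus> u = \<zero> \<and> y \<in> val_O M" if "u \<in> val_O M" for u
      using that by (intro bexI[of _ "\<ominus> u"]) (auto simp: l_neg)
    then show ?thesis
      using T[of "Imp (InO (Var 0)) (Ex 3 (Conj (Eq (Add (Var 3) (Var 0)) Zero) (InO (Var 3))))" x x x] that
      by simp
  qed
  have Osub: "val_O N \<subseteq> carrier N" by (auto simp: N_def upow_def)
  have "cring N"
  proof (rule cringI)
    show "abelian_group N"
      by (rule abelian_groupI) (use zero add a_assoc' a_comm' l_zero' neg' in auto)
    show "Group.comm_monoid N"
      by (rule comm_monoidI) (use one mult m_assoc' m_comm' l_one' in auto)
  qed (use distr' in auto)
  then interpret N: cring N .
  have "field N"
    by (rule N.cring_fieldI2) (use nontriv inv' in auto)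
  then interpret N: field N .
  have "subring (val_O N) N"
  proof (rule N.subringI)
    fix x assume x: "x \<in> val_O N"
    then have xc: "x \<in> carrier N" using Osub by blast
    obtain y where y: "y \<in> carrier N" "y \<oplus>\<^bsub>N\<^esub> x = \<zero>\<^bsub>N\<^esub>" "y \<in> val_O N"
      using Oneg[OF xc x] by blast
    then have "\<ominus>\<^bsub>N\<^esub> x = y" using N.minus_equality[OF y(2) xc y(1)] by simp
    with y show "\<ominus>\<^bsub>N\<^esub> x \<in> val_O N" by simp
  next
    fix x y assume xy: "x \<in> val_O N" "y \<in> val_O N"
    then have c: "x \<in> carrier N" "y \<in> carrier N" using Osub by auto
    show "x \<otimes>\<^bsub>N\<^esub> y \<in> val_O N" by (rule Omult[OF c xy])
    show "x \<oplus>\<^bsub>N\<^esub> y \<in> val_O N" by (rule Oadd[OF c xy])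
  qed (rule Osub, rule O1)
  moreover have "x \<in> val_O N \<or> inv\<^bsub>N\<^esub> x \<in> val_O N" if x: "x \<in> carrier N - {\<zero>\<^bsub>N\<^esub>}" for x
  proof -
    obtain y where y: "y \<in> carrier N" "x \<otimes>\<^bsub>N\<^esub> y = \<one>\<^bsub>N\<^esub>" "x \<in> val_O N \<or> y \<in> val_O N"
      using inv'[of x] x by auto
    then have "inv\<^bsub>N\<^esub> x = y" using x by (intro N.comm_inv_char) auto
    with y show ?thesis by simp
  qed
  ultimately have "valued_field N"
    unfolding valued_field_def using N.field_axioms by blast
  then show ?thesis by (simp add: N_def)
qed

lemma upow_vfield: "vfield (upow P)"
  by (rule vfield.intro) (rule upow_valued_field)

lemma upow_class:
  assumes "y \<in> H" "c \<in> H" "d \<in> H"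
  shows "\<pi> y \<in> rvd (upow P) (\<pi> d) (\<pi> c) \<longleftrightarrow> eventually (\<lambda>F. y F \<in> rvd M (d F) (c F)) U"
proof -
  interpret N: vfield "upow P" by (rule upow_vfield)
  let ?e = "env3 d c y y"
  have e: "?e i \<in> H" for i by (simp add: env3_def assms)
  have "\<pi> y \<in> rvd (upow P) (\<pi> d) (\<pi> c) \<longleftrightarrow> sat (upow P) (\<pi> \<circ> ?e) (\<lambda>_. {}) (memF 0 1 2)"
    using assms by (simp add: N.sat_memF N.in_rvd upow_carrier)
  also have "\<dots> \<longleftrightarrow> eventually (\<lambda>F. sat M (sec ?e F) (\<lambda>_. {}) (memF 0 1 2)) U"
    using e by (intro los_konly) (simp_all add: fv_memF)
  also have "\<dots> \<longleftrightarrow> eventually (\<lambda>F. y F \<in> rvd M (d F) (c F)) U"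
    using assms by (simp add: sat_memF in_rvd H_car sec_def)
  finally show ?thesis .
qed

lemma upow_class_ok: "class_ok P"
  unfolding class_ok_def using upow_valued_field upow_class by blast

lemma env3_comp: "\<pi> \<circ> env3 a b c d = env3 (\<pi> a) (\<pi> b) (\<pi> c) (\<pi> d)"
  by (auto simp: env3_def)

lemma sec_env3: "sec (env3 a b c d) F = env3 (a F) (b F) (c F) (d F)"
  by (auto simp: env3_def sec_def)

lemma upow_class_eq:
  assumes "c \<in> H" "d \<in> H" "c' \<in> H" "d' \<in> H"
  shows "rvd (upow P) (\<pi> d) (\<pi> c) = rvd (upow P) (\<pi> d') (\<pi> c') \<longleftrightarrow>
    eventually (\<lambda>F. rvd M (d F) (c F) = rvd M (d' F) (c' F)) U"
proof -
  interpret N: vfield "upow P" by (rule upow_vfield)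
  let ?e = "env3 d c d' c'"
  have e: "?e i \<in> H" for i by (simp add: env3_def assms)
  have k: "kenv (upow P) (\<pi> \<circ> ?e)" using e by (simp add: kenv_def upow_carrier)
  have "sat (upow P) (\<pi> \<circ> ?e) (\<lambda>_. {}) eqF \<longleftrightarrow> eventually (\<lambda>F. sat M (sec ?e F) (\<lambda>_. {}) eqF) U"
    by (rule los_konly) (use e in \<open>simp_all add: konly_eqF\<close>)
  then show ?thesis
    unfolding N.sat_eqF[OF k] sat_eqF[OF kenv_sec[OF e]] unfolding env3_comp sec_env3 by simp
qed

lemma upow_class_RV:
  assumes "c \<in> H" "d \<in> H"
  shows "rvd (upow P) (\<pi> d) (\<pi> c) \<in> RV (upow P) \<longleftrightarrow> eventually (\<lambda>F. rvd M (d F) (c F) \<in> RV M) U"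
proof -
  interpret N: vfield "upow P" by (rule upow_vfield)
  let ?e = "env3 d c c c"
  have e: "?e i \<in> H" for i by (simp add: env3_def assms)
  have k: "kenv (upow P) (\<pi> \<circ> ?e)" using e by (simp add: kenv_def upow_carrier)
  have "sat (upow P) (\<pi> \<circ> ?e) (\<lambda>_. {}) inRVF \<longleftrightarrow> eventually (\<lambda>F. sat M (sec ?e F) (\<lambda>_. {}) inRVF) U"
    by (rule los_konly) (use e in \<open>simp_all add: konly_eqF\<close>)
  then show ?thesis
    unfolding N.sat_inRVF[OF k] sat_inRVF[OF kenv_sec[OF e]] unfolding env3_comp sec_env3 by simp
qed

text \<open>Classes involve the valued field alone, which \<open>P\<close> does not affect. Hence
  \<open>rvpows\<close> can be defined with the classes for the empty interpretation and then serve
  as the interpretation itself.\<close>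

lemma rvd_upow: "rvd (upow P) = rvd (upow Q)"
proof -
  have O: "val_O (upow P) = val_O (upow Q)" "carrier (upow P) = carrier (upow Q)"
    "monoid.mult (upow P) = monoid.mult (upow Q)" "one (upow P) = one (upow Q)"
    "add (upow P) = add (upow Q)" "zero (upow P) = zero (upow Q)"
    by (simp_all add: upow_def)
  have "Units (val_ring (upow P)) = Units (val_ring (upow Q))"
    unfolding Units_def val_ring_def using O by simp
  then have v: "val (upow P) = val (upow Q)"
    unfolding val_def O by simp
  have "val_less (upow P) = val_less (upow Q)"
    unfolding val_less_def val_le_def O by simp
  then have r: "rv (upow P) = rv (upow Q)"
    unfolding rv_def open_ball0_def v O by simp
  have "rad (upow P) = rad (upow Q)"
    unfolding rad_def scale_def O by simp
  with v r show ?thesis unfolding rvd_def by simp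
qed

lemma ipart_upow: "ipart (upow P) = ipart (upow Q)"
  unfolding ipart_def rvd_upow[of P Q] ..

definition rvpows :: "'p \<Rightarrow> 'u set list set" where
  "rvpows p = {map (ipart (upow (\<lambda>_. {})) (\<pi> \<circ> w)) js | w js.
     (\<forall>i. w i \<in> H) \<and> eventually (\<lambda>F. map (ipart M (sec w F)) js \<in> rvp M p) U}"

lemma rvpows_iff:
  "\<xi>s \<in> rvpows p \<longleftrightarrow> (\<exists>w js. \<xi>s = map (ipart (upow rvpows) (\<pi> \<circ> w)) js \<and>
     (\<forall>i. w i \<in> H) \<and> eventually (\<lambda>F. map (ipart M (sec w F)) js \<in> rvp M p) U)"
  unfolding ipart_upow[of rvpows "\<lambda>_. {}"] unfolding rvpows_def mem_Collect_eq ..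

text \<open>The point is independence of representatives: lists of classes that coincide in the
  ultrapower coincide eventually, by \<open>upow_class_eq\<close>.\<close>

lemma upow_rvp_ok: "rvp_ok rvpows"
  unfolding rvp_ok_def
proof (intro allI impI iffI)
  fix w :: "nat \<Rightarrow> 'i \<Rightarrow> 'u" and p and js :: "nat list"
  assume w: "\<forall>i. w i \<in> H" and "map (ipart (upow rvpows) (\<pi> \<circ> w)) js \<in> rvpows p"
  then obtain w' js' where w': "\<forall>i. w' i \<in> H"
    "map (ipart (upow rvpows) (\<pi> \<circ> w)) js = map (ipart (upow rvpows) (\<pi> \<circ> w')) js'"
    and ev: "eventually (\<lambda>F. map (ipart M (sec w' F)) js' \<in> rvp M p) U"
    unfolding rvpows_iff by blast
  have len: "length js = length js'" using w'(2) map_eq_imp_length_eq by blast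
  then have "eventually (\<lambda>F. map (ipart M (sec w F)) js = map (ipart M (sec w' F)) js') U"
    using w'(2)
  proof (induction js js' rule: list_induct2)
    case (Cons j js j' js')
    have "ipart (upow rvpows) (\<pi> \<circ> w) j = ipart (upow rvpows) (\<pi> \<circ> w') j'"
      using Cons.prems unfolding list.map list.inject by blast
    then have "eventually (\<lambda>F. ipart M (sec w F) j = ipart M (sec w' F) j') U"
      using upow_class_eq[of "w (3 * j + 1)" "w (3 * j + 2)" "w' (3 * j' + 1)" "w' (3 * j' + 2)" rvpows]
        w w'(1) unfolding ipart_def sec_def by simp
    moreover have "eventually (\<lambda>F. map (ipart M (sec w F)) js = map (ipart M (sec w' F)) js') U"
      using Cons by simp
    ultimately show ?case by eventually_elim simp
  qed simp
  with ev show "eventually (\<lambda>F. map (ipart M (sec w F)) js \<in> rvp M p) U"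
    by eventually_elim simp
next
  fix w :: "nat \<Rightarrow> 'i \<Rightarrow> 'u" and p and js :: "nat list"
  assume "\<forall>i. w i \<in> H" "eventually (\<lambda>F. map (ipart M (sec w F)) js \<in> rvp M p) U"
  then show "map (ipart (upow rvpows) (\<pi> \<circ> w)) js \<in> rvpows p"
    unfolding rvpows_iff by blast
qed

lemma los_full:
  assumes "wf_fm L \<phi>" "\<And>i. w i \<in> H"
  shows "psat (upow rvpows) (\<pi> \<circ> w) \<phi> \<longleftrightarrow> eventually (\<lambda>F. psat M (sec w F) \<phi>) U"
  by (rule Los_theorem) (use assms upow_class_ok upow_rvp_ok in auto)

lemma upow_structure: "is_structure L (upow rvpows)"
proof -
  define N where "N = upow rvpows"
  interpret N: vfield N unfolding N_def by (rule upow_vfield)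
  have fun_cl: "fn N f xs \<in> carrier N" if f: "(f, n) \<in> funs L" and xs: "xs \<in> lists (carrier N)" "length xs = n" for f n xs
  proof -
    obtain h0 where h0: "h0 \<in> H" using H_ne by blast
    let ?e = "\<lambda>i. if i < n then rp (xs ! i) else h0"
    have "rp (xs ! i) \<in> H" if "i < n" for i
      using xs that by (intro rp_H) (auto simp: N_def upow_carrier in_lists_conv_set)
    then have "(\<lambda>F. eval M (sec ?e F) (Fun f (map Var [0..<n]))) \<in> H"
      using f h0 by (intro eval_H) (auto simp: list_all_iff)
    moreover have "map (eval M (sec ?e F)) (map Var [0..<n]) = map (\<lambda>x. rp x F) xs" for F
      by (rule nth_equalityI) (auto simp: sec_def xs)
    ultimately have "(\<lambda>F. fn M f (map (\<lambda>x. rp x F) xs)) \<in> H"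
      by (simp only: eval.simps)
    then show ?thesis by (simp add: N_def upow_def)
  qed
  have rv_cl: "\<xi>s \<in> lists (RV N)" if p: "(p, n) \<in> rvrels L" "\<xi>s \<in> rvp N p" "length \<xi>s = n" for p n \<xi>s
  proof -
    have "\<xi>s \<in> rvpows p" using p by (simp add: N_def upow_def)
    then obtain w js where w: "\<forall>i. w i \<in> H" "\<xi>s = map (ipart N (\<pi> \<circ> w)) js"
      and ev: "eventually (\<lambda>F. map (ipart M (sec w F)) js \<in> rvp M p) U"
      unfolding rvpows_iff N_def by blast
    have len: "length js = n" using w p by simp
    have M: "\<forall>(p, n)\<in>rvrels L. \<forall>\<xi>s\<in>rvp M p. length \<xi>s = n \<longrightarrow> \<xi>s \<in> lists (RV M)"
      using struct by (simp add: is_structure_def)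
    have M': "ys \<in> lists (RV M)" if "ys \<in> rvp M p" "length ys = n" for ys
      using bspec[OF M p(1)] that by simp
    have "ipart N (\<pi> \<circ> w) j \<in> RV N" if j: "j \<in> set js" for j
    proof -
      from ev have "eventually (\<lambda>F. rvd M (w (3 * j + 2) F) (w (3 * j + 1) F) \<in> RV M) U"
      proof eventually_elim
        case (elim F)
        have "map (ipart M (sec w F)) js \<in> lists (RV M)"
          by (rule M'[OF elim]) (simp add: len)
        then have "ipart M (sec w F) j \<in> RV M" using j by (auto simp: in_lists_conv_set)
        then show ?case by (simp add: ipart_def sec_def)
      qed
      then have "rvd N (\<pi> (w (3 * j + 2))) (\<pi> (w (3 * j + 1))) \<in> RV N"
        unfolding N_def using w(1) by (subst upow_class_RV) auto
      then show ?thesis by (simp add: ipart_def)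
    qed
    then show ?thesis unfolding w(2) by (auto simp: in_lists_conv_set)
  qed
  have 1: "val_O N \<subseteq> carrier N" using N.O_closed(1) by blast
  have 2: "\<forall>(f, n)\<in>funs L. \<forall>xs\<in>lists (carrier N). length xs = n \<longrightarrow> fn N f xs \<in> carrier N"
    using fun_cl by blast
  have 3: "\<forall>(p, n)\<in>rvrels L. \<forall>\<xi>s\<in>rvp N p. length \<xi>s = n \<longrightarrow> \<xi>s \<in> lists (RV N)"
    using rv_cl by blast
  have "is_structure L N"
    unfolding is_structure_def
    by (intro conjI 1 2 3 ballI N.a_closed N.m_closed N.zero_closed N.one_closed)
  then show ?thesis by (simp add: N_def)
qed

lemma upow_holds:
  assumes "sentence L \<phi>" "holds M \<phi>"
  shows "holds (upow rvpows) \<phi>"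
proof -
  obtain h where h: "h \<in> H" using H_ne by blast
  have "eventually (\<lambda>F. psat M (sec (\<lambda>_. h) F) \<phi>) U"
    using assms(2) by (intro always_eventually) (simp add: psat_def holds_def)
  then have *: "psat (upow rvpows) (\<pi> \<circ> (\<lambda>_. h)) \<phi>"
    using los_full[of \<phi> "\<lambda>_. h"] h assms(1) by (simp add: sentence_def)
  have "sat (upow rvpows) e z \<phi> \<longleftrightarrow> psat (upow rvpows) (\<pi> \<circ> (\<lambda>_. h)) \<phi>" for e z
    unfolding psat_def by (rule sat_cong) (use assms(1) in \<open>simp_all add: sentence_def\<close>)
  with * show ?thesis by (simp add: holds_def)
qed

end

section \<open>Compactness\<close>

context vfield
begin

lemma code_env:
  assumes "kenv N e" "ienv N z"
  shows "\<exists>v. kenv N v \<and> kpart v = e \<and> ipart N v = z"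
proof -
  have "\<exists>c d. c \<in> carrier N \<and> d \<in> carrier N \<and> z j = rvd N d c" for j
    using assms(2) RV_sort_rvd[of "z j"] by (auto simp: ienv_def)
  then obtain c d where cd: "\<And>j. c j \<in> carrier N" "\<And>j. d j \<in> carrier N" "\<And>j. z j = rvd N (d j) (c j)"
    by metis
  define v where "v = (\<lambda>k. if k mod 3 = 0 then e (k div 3) else if k mod 3 = 1 then c (k div 3) else d (k div 3))"
  have "kenv N v" using assms(1) cd by (simp add: kenv_def v_def)
  moreover have "kpart v = e" by (simp add: kpart_def v_def)
  moreover have "ipart N v = z"
  proof
    fix j :: nat
    have "(3 * j + 1) mod 3 = 1" "(3 * j + 1) div 3 = j" "(3 * j + 2) mod 3 = 2" "(3 * j + 2) div 3 = j"
      by presburger+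
    then have "v (3 * j + 1) = c j" "v (3 * j + 2) = d j" unfolding v_def by (simp_all only:) simp_all
    then show "ipart N v j = z j" by (simp only: ipart_def cd(3))
  qed
  ultimately show ?thesis by blast
qed

lemma ienv_ipart: "kenv N w \<Longrightarrow> ienv N (ipart N w)"
  by (simp add: ienv_def ipart_def rvd_in_sort kenvD)

end

text \<open>If no finite subset of \<open>R\<close> covered all assignments of \<open>M\<close>,
  each finite subset \<open>F\<close> would have an assignment \<open>V F\<close> refuting all its
  members. Along an ultrafilter finer than \<open>finite_subsets_at_top R\<close> these form one
  assignment in the ultrapower, which refutes all of \<open>R\<close> and contradicts
  \<open>all\<close>.\<close>

lemma compactness:
  fixes M :: "('u, 'f, 'r, 'p) vstruct"
  assumes lu: "large_universe TYPE('u) L" and vf: "valued_field M" and st: "is_structure L M"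
    and wfR: "\<And>r. r \<in> R \<Longrightarrow> wf_fm L r"
    and all: "\<And>(N :: ('u, 'f, 'r, 'p) vstruct) e z. is_structure L N \<Longrightarrow> valued_field N \<Longrightarrow>
      (\<And>\<phi>. sentence L \<phi> \<Longrightarrow> holds M \<phi> \<Longrightarrow> holds N \<phi>) \<Longrightarrow> kenv N e \<Longrightarrow> ienv N z \<Longrightarrow>
      \<exists>r\<in>R. sat N e z r"
  shows "\<exists>R0\<subseteq>R. finite R0 \<and> (\<forall>e z. kenv M e \<longrightarrow> ienv M z \<longrightarrow> (\<exists>r\<in>R0. sat M e z r))"
proof (rule ccontr)
  assume contra: "\<not> ?thesis"
  interpret vfield M by unfold_locales (rule vf)
  have ex: "\<exists>v. kenv M v \<and> (finite F \<and> F \<subseteq> R \<longrightarrow> (\<forall>r\<in>F. \<not> psat M v r))" for F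
  proof (cases "finite F \<and> F \<subseteq> R")
    case True
    then have "\<not> (\<forall>e z. kenv M e \<longrightarrow> ienv M z \<longrightarrow> (\<exists>r\<in>F. sat M e z r))"
      using contra by blast
    then obtain e z where e: "kenv M e" "ienv M z" "\<forall>r\<in>F. \<not> sat M e z r" by blast
    obtain v where "kenv M v" "kpart v = e" "ipart M v = z" using code_env[OF e(1,2)] by blast
    with e(3) show ?thesis by (auto simp: psat_def)
  next
    case False
    then show ?thesis by (intro exI[of _ "\<lambda>_. \<one>\<^bsub>M\<^esub>"]) (auto simp: kenv_def)
  qed
  define V where "V = (\<lambda>F. SOME v. kenv M v \<and> (finite F \<and> F \<subseteq> R \<longrightarrow> (\<forall>r\<in>F. \<not> psat M v r)))"
  have V: "kenv M (V F)" "finite F \<Longrightarrow> F \<subseteq> R \<Longrightarrow> r \<in> F \<Longrightarrow> \<not> psat M (V F) r" for F r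
    using someI_ex[OF ex, of F] unfolding V_def by blast+
  obtain U where U: "U \<le> finite_subsets_at_top R" "ultra U"
    using ultra_exists[OF finite_subsets_at_top_neq_bot] by blast
  define sk where "sk = (\<lambda>\<phi> k k' v. SOME x. x \<in> carrier M \<and>
    ((\<exists>x\<in>carrier M. \<exists>y\<in>carrier M. psat M (v(k' := y, k := x)) \<phi>) \<longrightarrow>
      (\<exists>y\<in>carrier M. psat M (v(k' := y, k := x)) \<phi>)))"
  have sk: "sk \<phi> k k' v \<in> carrier M" "(\<exists>x\<in>carrier M. \<exists>y\<in>carrier M. psat M (v(k' := y, k := x)) \<phi>) \<longrightarrow>
      (\<exists>y\<in>carrier M. psat M (v(k' := y, k := sk \<phi> k k' v)) \<phi>)" for \<phi> k k' v
  proof -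
    have "\<exists>x. x \<in> carrier M \<and> ((\<exists>x\<in>carrier M. \<exists>y\<in>carrier M. psat M (v(k' := y, k := x)) \<phi>) \<longrightarrow>
      (\<exists>y\<in>carrier M. psat M (v(k' := y, k := x)) \<phi>))"
      using zero_closed by blast
    from someI_ex[OF this] show "sk \<phi> k k' v \<in> carrier M"
      "(\<exists>x\<in>carrier M. \<exists>y\<in>carrier M. psat M (v(k' := y, k := x)) \<phi>) \<longrightarrow>
      (\<exists>y\<in>carrier M. psat M (v(k' := y, k := sk \<phi> k k' v)) \<phi>)"
      unfolding sk_def by blast+
  qed
  \<comment> \<open>The labels \<open>Inl i\<close> generate the coordinates of \<open>V\<close>,
    the labels \<open>Inr\<close> give Skolem functions; a list of arguments is continued by zero to
    an assignment.\<close>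
  define f :: "nat + (('f, 'r, 'p) fm \<times> nat \<times> nat) \<Rightarrow> (('f, 'r, 'p) fm set \<Rightarrow> 'u) list \<Rightarrow> ('f, 'r, 'p) fm set \<Rightarrow> 'u"
    where "f = (\<lambda>a xs. case a of Inl i \<Rightarrow> (\<lambda>F. V F i)
      | Inr (\<phi>, k, k') \<Rightarrow> (\<lambda>F. sk \<phi> k k' (\<lambda>i. if i < length xs then (xs ! i) F else \<zero>\<^bsub>M\<^esub>)))"
  define I :: "(nat + (('f, 'r, 'p) fm \<times> nat \<times> nat)) set" where "I = UNIV <+> {\<phi>. wf_fm L \<phi>} \<times> UNIV \<times> UNIV"
  have inf: "infinite (UNIV :: 'u set)" using lu by (simp add: large_universe_def)
  have nat: "(UNIV :: nat set) \<lesssim> (UNIV :: 'u set)"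
    using inj_nat[OF inf] lepoll_UNIV by blast
  have "I \<lesssim> (UNIV :: 'u set)"
    unfolding I_def by (intro lepoll_Plus_infinite lepoll_Times_infinite inf nat wf_fm_lepoll lu)
  from closure_lepoll[OF inf this, of f] obtain H0 where H0: "H0 \<lesssim> (UNIV :: 'u set)"
    "\<And>a xs. a \<in> I \<Longrightarrow> xs \<in> lists H0 \<Longrightarrow> f a xs \<in> H0" by blast
  \<comment> \<open>The closed set \<open>H0\<close> may contain functions with values outside the
    carrier; the coordinates of \<open>V\<close> and the Skolem functions survive the
    restriction.\<close>
  define H where "H = {g \<in> H0. \<forall>F. g F \<in> carrier M}"
  have gens: "(\<lambda>F. V F i) \<in> H" for i
  proof -
    have "f (Inl i) [] \<in> H0" by (rule H0(2)) (auto simp: I_def)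
    then show ?thesis using kenvD[OF V(1)] by (simp add: H_def f_def)
  qed
  have "H \<lesssim> (UNIV :: 'u set)"
    by (rule lepoll_trans[OF subset_imp_lepoll H0(1)]) (auto simp: H_def)
  then obtain \<iota> :: "(('f, 'r, 'p) fm set \<Rightarrow> 'u) \<Rightarrow> 'u" where \<iota>: "inj_on \<iota> H"
    unfolding lepoll_def by (elim exE conjE)
  \<comment> \<open>One function is chosen from each class modulo \<open>U\<close>, so that
    \<open>\<iota>\<close>, which is injective on functions, becomes injective on classes.\<close>
  define cr where "cr = (\<lambda>g. SOME h. h \<in> H \<and> eventually (\<lambda>F. h F = g F) U)"
  define \<pi> where "\<pi> = (\<lambda>g. \<iota> (cr g))"
  have cr: "cr g \<in> H" "eventually (\<lambda>F. cr g F = g F) U" if "g \<in> H" for g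
  proof -
    have "\<exists>h. h \<in> H \<and> eventually (\<lambda>F. h F = g F) U" using that by auto
    from someI_ex[OF this] show "cr g \<in> H" "eventually (\<lambda>F. cr g F = g F) U"
      unfolding cr_def by auto
  qed
  interpret ultrapower M L U H \<pi>
  proof (unfold_locales)
    show "is_structure L M" by (rule st)
    show "ultra U" by (rule U(2))
    show "g F \<in> carrier M" if "g \<in> H" for g F using that by (simp add: H_def)
    show "H \<noteq> {}" using gens by blast
  next
    fix g h assume gh: "g \<in> H" "h \<in> H"
    show "\<pi> g = \<pi> h \<longleftrightarrow> eventually (\<lambda>F. g F = h F) U"
    proof
      assume "\<pi> g = \<pi> h"
      then have eq: "cr g = cr h"
        unfolding \<pi>_def using inj_onD[OF \<iota>] cr gh by blast
      from cr(2)[OF gh(1)] cr(2)[OF gh(2)] show "eventually (\<lambda>F. g F = h F) U"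
        by eventually_elim (simp add: eq)
    next
      assume ev: "eventually (\<lambda>F. g F = h F) U"
      have "eventually (\<lambda>F. k F = g F) U \<longleftrightarrow> eventually (\<lambda>F. k F = h F) U" for k
      proof
        assume "eventually (\<lambda>F. k F = g F) U"
        with ev show "eventually (\<lambda>F. k F = h F) U" by eventually_elim simp
      next
        assume "eventually (\<lambda>F. k F = h F) U"
        with ev show "eventually (\<lambda>F. k F = g F) U" by eventually_elim simp
      qed
      then show "\<pi> g = \<pi> h" unfolding \<pi>_def cr_def by simp
    qed
  next
    fix \<phi> and w :: "nat \<Rightarrow> ('f, 'r, 'p) fm set \<Rightarrow> 'u" and k k'
    assume wf: "wf_fm L \<phi>" and w: "\<And>i. w i \<in> H"
    obtain n where n: "\<And>w w'. (\<forall>i<n. w i = w' i) \<Longrightarrow> psat M w \<phi> = psat M w' \<phi>"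
      using psat_bounded[of M \<phi>] by blast
    let ?xs = "map w [0..<n]"
    let ?v = "\<lambda>F i. if i < length ?xs then (?xs ! i) F else \<zero>\<^bsub>M\<^esub>"
    define h where "h = f (Inr (\<phi>, k, k')) ?xs"
    have hF: "h F = sk \<phi> k k' (?v F)" for F by (simp add: h_def f_def)
    have "h \<in> H0"
      unfolding h_def by (rule H0(2)) (use w wf in \<open>auto simp: I_def H_def\<close>)
    then have h: "h \<in> H" by (simp add: H_def hF sk(1))
    have eq: "psat M ((?v F)(k' := y, k := x)) \<phi> = psat M ((sec w F)(k' := y, k := x)) \<phi>" for F x y
      by (rule n) (auto simp: sec_def)
    show "\<exists>h\<in>H. \<forall>F. (\<exists>x\<in>carrier M. \<exists>y\<in>carrier M. psat M ((sec w F)(k' := y, k := x)) \<phi>) \<longrightarrow>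
        (\<exists>y\<in>carrier M. psat M ((sec w F)(k' := y, k := h F)) \<phi>)"
    proof (rule bexI[OF _ h], rule allI)
      fix F
      show "(\<exists>x\<in>carrier M. \<exists>y\<in>carrier M. psat M ((sec w F)(k' := y, k := x)) \<phi>) \<longrightarrow>
        (\<exists>y\<in>carrier M. psat M ((sec w F)(k' := y, k := h F)) \<phi>)"
        using sk(2)[of "?v F" k' k \<phi>] unfolding hF eq .
    qed
  qed
  define N where "N = upow rvpows"
  interpret N: vfield N unfolding N_def by (rule upow_vfield)
  let ?w = "\<lambda>i F. V F i"
  have w: "?w i \<in> H" for i by (rule gens)
  have kw: "kenv N (\<pi> \<circ> ?w)" using gens by (simp add: kenv_def N_def upow_carrier)
  have "\<exists>r\<in>R. sat N (kpart (\<pi> \<circ> ?w)) (ipart N (\<pi> \<circ> ?w)) r"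
  proof (rule all)
    show "is_structure L N" unfolding N_def by (rule upow_structure)
    show "valued_field N" unfolding N_def by (rule upow_valued_field)
    show "holds N \<phi>" if "sentence L \<phi>" "holds M \<phi>" for \<phi> unfolding N_def by (rule upow_holds[OF that])
    show "kenv N (kpart (\<pi> \<circ> ?w))" using kw by (simp add: kenv_def kpart_def)
    show "ienv N (ipart N (\<pi> \<circ> ?w))" by (rule N.ienv_ipart[OF kw])
  qed
  then obtain r where r: "r \<in> R" "psat N (\<pi> \<circ> ?w) r" unfolding psat_def by blast
  have "eventually (\<lambda>F. psat M (sec ?w F) r) U"
    using r(2) unfolding N_def by (subst (asm) los_full) (use wfR r(1) w in auto)
  moreover have "eventually (\<lambda>F. \<not> psat M (sec ?w F) r) U"
  proof (rule filter_leD[OF U(1)])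
    have "sec ?w F = V F" for F by (simp add: sec_def)
    then show "eventually (\<lambda>F. \<not> psat M (sec ?w F) r) (finite_subsets_at_top R)"
      unfolding eventually_finite_subsets_at_top using V(2) r(1) by (intro exI[of _ "{r}"]) auto
  qed
  ultimately show False using ultra_not[OF U(2)] by blast
qed

section \<open>Uniform preparation\<close>

text \<open>The condition on \<open>N\<close> refers to the sentences true in \<open>M\<close>
  rather than to a fixed theory, which makes the locale pass on to every such valued field
  \<open>N\<close>.\<close>

locale hmin_model = vfield M
  for M :: "('u, 'f, 'r, 'p) vstruct" (structure) +
  fixes L :: "('f, 'r, 'p) lang" and l :: nat
  assumes large: "large_universe TYPE('u) L" and struct: "is_structure L M"
    and hmin: "\<And>(N :: ('u, 'f, 'r, 'p) vstruct) \<gamma> A A' X. is_structure L N \<Longrightarrow>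
      (\<And>\<phi>. sentence L \<phi> \<Longrightarrow> holds M \<phi> \<Longrightarrow> holds N \<phi>) \<Longrightarrow>
      \<gamma> \<in> value_group N \<Longrightarrow> val_le N \<gamma> (val_one N) \<Longrightarrow> A \<subseteq> carrier N \<Longrightarrow>
      A' \<subseteq> RV_at N \<gamma> \<Longrightarrow> finite A' \<Longrightarrow> card A' \<le> l \<Longrightarrow> definable L N A (RV N \<union> A') X \<Longrightarrow>
      \<exists>C. finite C \<and> definable L N A {} C \<and> prepared N \<gamma> C X"

lemma solutions_cong:
  assumes "\<And>i. i \<in> fv \<phi> - {0} \<Longrightarrow> e i = e' i" "\<And>j. j \<in> fv_RV \<phi> \<Longrightarrow> z j = z' j"
  shows "solutions N e z \<phi> = solutions N e' z' \<phi>"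
proof -
  have "sat N (e(0 := x)) z \<phi> = sat N (e'(0 := x)) z' \<phi>" for x
    by (rule sat_cong) (use assms in auto)
  then show ?thesis by (simp add: solutions_def)
qed

text \<open>\<open>definable\<close> brings its own assignment. Sending each of its parameter
  variables to a variable in \<open>V\<close> of the same value gives a formula to be read under
  \<open>e\<close>, and such a formula can be kept while \<open>e\<close> varies.\<close>

lemma definable_solutions:
  assumes "definable L N (e ` V) {} C" "0 \<notin> V"
  shows "\<exists>\<theta>. wf_fm L \<theta> \<and> fv \<theta> \<subseteq> insert 0 V \<and> fv_RV \<theta> = {} \<and> (\<forall>z. solutions N e z \<theta> = C)"
proof -
  obtain \<theta>0 e0 z0 where \<theta>0: "wf_fm L \<theta>0" "\<And>i. i \<in> fv \<theta>0 - {0} \<Longrightarrow> e0 i \<in> e ` V"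
    "\<And>j. j \<in> fv_RV \<theta>0 \<Longrightarrow> z0 j \<in> {}" "C = solutions N e0 z0 \<theta>0"
    using assms(1) unfolding definable_def solutions_def by blast
  have RV: "fv_RV \<theta>0 = {}" using \<theta>0(3) by blast
  have "\<exists>k. k \<in> V \<and> e k = e0 i" if "i \<in> fv \<theta>0 - {0}" for i
    using \<theta>0(2)[OF that] by (metis imageE)
  then obtain t where t: "\<And>i. i \<in> fv \<theta>0 - {0} \<Longrightarrow> t i \<in> V \<and> e (t i) = e0 i" by metis
  define \<tau> where "\<tau> = t(0 := 0)"
  define \<theta> where "\<theta> = ren \<theta>0 \<tau> id"
  have \<tau>: "\<tau> i = (if i = 0 then 0 else t i)" for i by (simp add: \<tau>_def)
  have "sat N (e(0 := x)) z \<theta> = sat N (e0(0 := x)) z0 \<theta>0" for x z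
    unfolding \<theta>_def sat_ren
  proof (rule sat_cong)
    fix i assume i: "i \<in> fv \<theta>0"
    show "((e(0 := x)) \<circ> \<tau>) i = (e0(0 := x)) i"
    proof (cases "i = 0")
      case False
      then have "t i \<in> V \<and> e (t i) = e0 i" using t i by blast
      then show ?thesis using False assms(2) by (auto simp: \<tau>)
    qed (simp add: \<tau>)
  qed (simp add: RV)
  then have "solutions N e z \<theta> = C" for z by (simp add: solutions_def \<theta>0(4))
  moreover have "wf_fm L \<theta>" unfolding \<theta>_def by (rule wf_ren[OF \<theta>0(1)])
  moreover have "fv_RV \<theta> = {}" using fv_RV_ren[of \<theta>0 \<tau> id] RV by (auto simp: \<theta>_def)
  moreover have "fv \<theta> \<subseteq> insert 0 V"
  proof -
    have "\<tau> ` fv \<theta>0 \<subseteq> insert 0 V" using t by (auto simp: \<tau>)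
    then show ?thesis unfolding \<theta>_def by (rule order_trans[OF fv_ren])
  qed
  ultimately show ?thesis by blast
qed

context hmin_model
begin

lemma elementary_hmin_model:
  fixes N :: "('u, 'f, 'r, 'p) vstruct"
  assumes "is_structure L N" "valued_field N" "\<And>\<phi>. sentence L \<phi> \<Longrightarrow> holds M \<phi> \<Longrightarrow> holds N \<phi>"
  shows "hmin_model N L l"
proof (rule hmin_model.intro[OF vfield.intro[OF assms(2)]], rule hmin_model_axioms.intro)
  show "large_universe TYPE('u) L" by (rule large)
  show "is_structure L N" by (rule assms(1))
next
  fix N' :: "('u, 'f, 'r, 'p) vstruct" and \<gamma> A A' X
  assume *: "is_structure L N'" "\<And>\<phi>. sentence L \<phi> \<Longrightarrow> holds N \<phi> \<Longrightarrow> holds N' \<phi>"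
    "\<gamma> \<in> value_group N'" "val_le N' \<gamma> (val_one N')" "A \<subseteq> carrier N'"
    "A' \<subseteq> RV_at N' \<gamma>" "finite A'" "card A' \<le> l" "definable L N' A (RV N' \<union> A') X"
  show "\<exists>C. finite C \<and> definable L N' A {} C \<and> prepared N' \<gamma> C X"
    by (rule hmin[OF *(1) _ *(3-9)]) (use *(2) assms(3) in blast)
qed

text \<open>The hypothesis gives a \<open>\<theta>\<close> for each assignment in each model, and
  compactness leaves finitely many. Variable \<open>d\<close> holds an element of value \<lambda>
  and stays outside \<open>V\<close>, since the preparing set has to be definable from the field
  parameters without \<lambda>; the variables \<open>J'\<close> hold the at most \<open>l\<close>
  parameters in RV at \<lambda>.\<close>

lemma uniform_preparation:
  assumes \<chi>: "wf_fm L \<chi>" "fv \<chi> \<subseteq> insert 0 V" and V: "0 \<notin> V" "d \<notin> insert 0 V"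
    and J': "finite J'" "card J' \<le> l"
  shows "\<exists>T. finite T \<and> (\<forall>\<theta>\<in>T. wf_fm L \<theta> \<and> fv \<theta> \<subseteq> insert 0 V \<and> fv_RV \<theta> = {}) \<and>
    (\<forall>w z. kenv M w \<longrightarrow> scale M (w d) \<longrightarrow> ienv M z \<longrightarrow> (\<forall>j\<in>fv_RV \<chi> - J'. z j \<in> RV M) \<longrightarrow>
      (\<forall>j\<in>J'. z j \<in> RV_at M (val M (w d))) \<longrightarrow>
      (\<exists>\<theta>\<in>T. finite (solutions M w z \<theta>) \<and>
        prepared M (val M (w d)) (solutions M w z \<theta>) (solutions M w z \<chi>)))"
proof -
  obtain js1 where js1: "set js1 = fv_RV \<chi> - J'" using finite_list[of "fv_RV \<chi> - J'"] finite_fv_RV by auto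
  obtain js2 where js2: "set js2 = J'" using finite_list[OF J'(1)] by blast
  define side :: "('f, 'r, 'p) fm" where
    "side = Conj (scaleF d) (Conj (Conjs (map isRV js1)) (Conjs (map (\<lambda>j. atF j d) js2)))"
  have sat_side: "sat N e z side \<longleftrightarrow> scale N (e d) \<and> (\<forall>j\<in>fv_RV \<chi> - J'. z j \<in> RV N) \<and>
      (\<forall>j\<in>J'. z j \<in> RV_at N (val N (e d)))"
    if N: "valued_field N" "kenv N e" "ienv N z" for N :: "('u, 'f, 'r, 'p) vstruct" and e z
  proof -
    interpret N: vfield N by (rule vfield.intro[OF N(1)])
    have "sat N e z side \<longleftrightarrow> scale N (e d) \<and> (\<forall>j\<in>fv_RV \<chi> - J'. z j \<in> RV N) \<and>
      (\<forall>j\<in>J'. z j \<in> RV_at N (val N (rad N (e d))))"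
      using kenvD[OF N(2)] N.ienv_subset[OF N(3)]
      by (simp add: side_def N.sat_scaleF N.sat_isRV N.sat_atF js1 js2)
    then show ?thesis by (auto simp: rad_def)
  qed
  have wf_side: "wf_fm L side" by (simp add: side_def scaleF_def fv_atF)
  \<comment> \<open>Finiteness is not first order, so a bound \<open>n\<close> on the number of
    solutions is part of the formula.\<close>
  define rF where "rF = (\<lambda>(\<theta>, n). Imp side (Conj (atmost n \<theta>) (prepF d \<theta> \<chi>)))"
  define D where "D = {\<theta>. wf_fm L \<theta> \<and> fv \<theta> \<subseteq> insert 0 V \<and> fv_RV \<theta> = {}} \<times> (UNIV :: nat set)"
  have sat_rF: "sat N e z (rF (\<theta>, n)) \<longleftrightarrow> (scale N (e d) \<and> (\<forall>j\<in>fv_RV \<chi> - J'. z j \<in> RV N) \<and>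
      (\<forall>j\<in>J'. z j \<in> RV_at N (val N (e d))) \<longrightarrow>
      finite (solutions N e z \<theta>) \<and> card (solutions N e z \<theta>) \<le> n \<and>
      prepared N (val N (e d)) (solutions N e z \<theta>) (solutions N e z \<chi>))"
    if N: "valued_field N" "kenv N e" "ienv N z" for N :: "('u, 'f, 'r, 'p) vstruct" and e z \<theta> n
  proof -
    interpret N: vfield N by (rule vfield.intro[OF N(1)])
    have ne: "carrier N \<noteq> {}" using N.zero_closed by blast
    have "scale N (e d) \<Longrightarrow> rad N (e d) = e d" by (simp add: rad_def)
    then show ?thesis
      unfolding rF_def prod.case Imp_simps sat_side[OF N] sat.simps sat_atmost[OF ne] N.sat_prepF[OF N(2)]
      by auto
  qed
  have "\<exists>R0\<subseteq>rF ` D. finite R0 \<and> (\<forall>e z. kenv M e \<longrightarrow> ienv M z \<longrightarrow> (\<exists>r\<in>R0. sat M e z r))"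
  proof (rule compactness[OF large valued struct])
    show "wf_fm L r" if "r \<in> rF ` D" for r
      using that wf_side \<chi>(1) by (auto simp: rF_def D_def wf_prepF)
  next
    fix N :: "('u, 'f, 'r, 'p) vstruct" and e z
    assume N: "is_structure L N" "valued_field N" "\<And>\<phi>. sentence L \<phi> \<Longrightarrow> holds M \<phi> \<Longrightarrow> holds N \<phi>"
      "kenv N e" "ienv N z"
    interpret N: vfield N by (rule vfield.intro[OF N(2)])
    show "\<exists>r\<in>rF ` D. sat N e z r"
    proof (cases "scale N (e d) \<and> (\<forall>j\<in>fv_RV \<chi> - J'. z j \<in> RV N) \<and>
      (\<forall>j\<in>J'. z j \<in> RV_at N (val N (e d)))")
      case False
      have "(Eq Zero Zero, 0) \<in> D" by (simp add: D_def)
      moreover have "sat N e z (rF (Eq Zero Zero, 0))" using False unfolding sat_rF[OF N(2,4,5)] by blast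
      ultimately show ?thesis by blast
    next
      case True
      have "\<exists>C. finite C \<and> definable L N (e ` V) {} C \<and> prepared N (val N (e d)) C (solutions N e z \<chi>)"
      proof (rule hmin[OF N(1,3)])
        have "val N (e d) \<in> value_group N \<and> val_le N (val N (e d)) (val_one N)"
          unfolding N.value_group_iff using True by blast
        then show "val N (e d) \<in> value_group N" "val_le N (val N (e d)) (val_one N)" by auto
        show "e ` V \<subseteq> carrier N" using kenvD[OF N(4)] by blast
        show "z ` J' \<subseteq> RV_at N (val N (e d))" using True by blast
        show "finite (z ` J')" using J'(1) by simp
        show "card (z ` J') \<le> l" using card_image_le[OF J'(1), of z] J'(2) by simp
        show "definable L N (e ` V) (RV N \<union> z ` J') (solutions N e z \<chi>)"
          unfolding definable_def solutions_def
        proof (intro exI conjI ballI)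
          show "wf_fm L \<chi>" by (rule \<chi>(1))
          show "e i \<in> e ` V" if "i \<in> fv \<chi> - {0}" for i using that \<chi>(2) by blast
          show "z j \<in> RV N \<union> z ` J'" if "j \<in> fv_RV \<chi>" for j using that True by blast
        qed (rule refl)
      qed
      then obtain C where C: "finite C" "definable L N (e ` V) {} C"
        "prepared N (val N (e d)) C (solutions N e z \<chi>)" by blast
      obtain \<theta> where \<theta>: "wf_fm L \<theta>" "fv \<theta> \<subseteq> insert 0 V" "fv_RV \<theta> = {}" "\<forall>z. solutions N e z \<theta> = C"
        using definable_solutions[OF C(2) V(1)] by blast
      have "(\<theta>, card C) \<in> D" using \<theta> by (simp add: D_def)
      moreover have "sat N e z (rF (\<theta>, card C))"
        unfolding sat_rF[OF N(2,4,5)] using C \<theta>(4) by simp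
      ultimately show ?thesis by blast
    qed
  qed
  then obtain R0 where R0: "R0 \<subseteq> rF ` D" "finite R0"
    "\<And>e z. kenv M e \<Longrightarrow> ienv M z \<Longrightarrow> \<exists>r\<in>R0. sat M e z r" by blast
  obtain D0 where D0: "D0 \<subseteq> D" "finite D0" "R0 = rF ` D0"
    using finite_subset_image[OF R0(2,1)] by blast
  show ?thesis
  proof (intro exI[of _ "fst ` D0"] conjI allI impI)
    show "finite (fst ` D0)" using D0 by simp
    show "\<forall>\<theta>\<in>fst ` D0. wf_fm L \<theta> \<and> fv \<theta> \<subseteq> insert 0 V \<and> fv_RV \<theta> = {}"
      using D0(1) unfolding D_def by fastforce
    fix w z
    assume w: "kenv M w" "scale M (w d)" "ienv M z" "\<forall>j\<in>fv_RV \<chi> - J'. z j \<in> RV M"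
      "\<forall>j\<in>J'. z j \<in> RV_at M (val M (w d))"
    obtain r where "r \<in> R0" "sat M w z r" using R0(3)[OF w(1,3)] by blast
    then obtain \<theta> n where \<theta>: "(\<theta>, n) \<in> D0" "sat M w z (rF (\<theta>, n))" unfolding D0(3) by auto
    from \<theta>(2) have "finite (solutions M w z \<theta>) \<and>
        prepared M (val M (w d)) (solutions M w z \<theta>) (solutions M w z \<chi>)"
      unfolding sat_rF[OF valued w(1,3)] using w(2,4,5) by blast
    moreover have "\<theta> \<in> fst ` D0" using \<theta>(1) by force
    ultimately show "\<exists>\<theta>\<in>fst ` D0. finite (solutions M w z \<theta>) \<and>
        prepared M (val M (w d)) (solutions M w z \<theta>) (solutions M w z \<chi>)" by blast
  qed
qed

end

section \<open>Stable embeddedness of RV\<close>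

definition Disjs :: "('f, 'r, 'p) fm list \<Rightarrow> ('f, 'r, 'p) fm" where
  "Disjs \<phi>s = Neg (Conjs (map Neg \<phi>s))"

lemma Disjs_simps [simp]:
  "sat N e z (Disjs \<phi>s) \<longleftrightarrow> (\<exists>\<phi>\<in>set \<phi>s. sat N e z \<phi>)"
  "fv (Disjs \<phi>s) = \<Union> (fv ` set \<phi>s)"
  "fv_RV (Disjs \<phi>s) = \<Union> (fv_RV ` set \<phi>s)"
  "wf_fm L (Disjs \<phi>s) \<longleftrightarrow> (\<forall>\<phi>\<in>set \<phi>s. wf_fm L \<phi>)"
  by (auto simp: Disjs_def)

lemma solutions_Disjs: "solutions N e z (Disjs \<phi>s) = (\<Union>\<phi>\<in>set \<phi>s. solutions N e z \<phi>)"
  by (auto simp: solutions_def)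

lemma prepared_mono: "prepared N \<gamma> C X \<Longrightarrow> C \<subseteq> D \<Longrightarrow> prepared N \<gamma> D X"
  unfolding prepared_def by blast

text \<open>\<open>shiftF \<psi> j\<close> holds at \<open>c\<close> (variable 0) if \<open>\<psi>\<close> holds at some \<open>x\<close> such that \<open>x - c\<close> lies in the
  class \<open>j\<close>. The other variables are shifted by 2 to make room for \<open>x\<close> and \<open>x - c\<close>.\<close>

definition shiftF :: "('f, 'r, 'p) fm \<Rightarrow> nat \<Rightarrow> ('f, 'r, 'p) fm" where
  "shiftF \<psi> j = ren (Ex 0 (Ex 1 (Conj (Conj (Eq (Var 0) (Add (Var 2) (Var 1))) (InClass (Var 1) j))
     (ren \<psi> (\<lambda>i. if i = 0 then 0 else i + 2) id)))) (\<lambda>i. i - 2) id"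

lemma (in vfield) sat_shiftF:
  assumes "c \<in> carrier N"
  shows "sat N (e(0 := c)) z (shiftF \<psi> j) \<longleftrightarrow>
    (\<exists>x\<in>carrier N. x \<ominus> c \<in> z j \<and> sat N (e(0 := x)) z \<psi>)"
proof -
  define e' where "e' x s = ((e(0 := c)) \<circ> (\<lambda>i. i - 2))(0 := x, 1 := s)" for x s
  have "sat N (e(0 := c)) z (shiftF \<psi> j) \<longleftrightarrow> (\<exists>x\<in>carrier N. \<exists>s\<in>carrier N. (x = c \<oplus> s \<and> s \<in> z j) \<and>
      sat N (e' x s) z (ren \<psi> (\<lambda>i. if i = 0 then 0 else i + 2) id))"
    unfolding shiftF_def sat_ren[of N "e(0 := c)"] sat.simps e'_def by simp
  moreover have "sat N (e' x s) z (ren \<psi> (\<lambda>i. if i = 0 then 0 else i + 2) id) \<longleftrightarrow> sat N (e(0 := x)) z \<psi>" for x s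
    unfolding sat_ren e'_def by (rule sat_cong) auto
  moreover have "x = c \<oplus> s \<longleftrightarrow> s = x \<ominus> c" if "x \<in> carrier N" "s \<in> carrier N" for x s
  proof
    assume "x = c \<oplus> s"
    moreover have "s = (c \<oplus> s) \<ominus> c" using assms that by algebra
    ultimately show "s = x \<ominus> c" by simp
  next
    assume "s = x \<ominus> c"
    moreover have "x = c \<oplus> (x \<ominus> c)" using assms that by algebra
    ultimately show "x = c \<oplus> s" by simp
  qed
  ultimately have iff: "sat N (e(0 := c)) z (shiftF \<psi> j) \<longleftrightarrow>
      (\<exists>x\<in>carrier N. \<exists>s\<in>carrier N. (s = x \<ominus> c \<and> s \<in> z j) \<and> sat N (e(0 := x)) z \<psi>)"
    by (simp only: cong: bex_cong)
  have "x \<ominus> c \<in> carrier N" if "x \<in> carrier N" for x using that assms by simp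
  then show ?thesis unfolding iff by blast
qed

lemma fv_shiftF:
  assumes "fv \<psi> \<subseteq> insert 0 V"
  shows "fv (shiftF \<psi> j) \<subseteq> insert 0 V"
proof -
  have "fv (ren \<psi> (\<lambda>i. if i = 0 then 0 else i + 2) id) \<subseteq> (\<lambda>i. if i = 0 then 0 else i + 2) ` insert 0 V"
    using fv_ren assms by (meson image_mono order_trans)
  also have "\<dots> \<subseteq> insert 0 ((\<lambda>i. i + 2) ` V)" by (auto split: if_splits)
  finally have *: "fv (ren \<psi> (\<lambda>i. if i = 0 then 0 else i + 2) id) \<subseteq> insert 0 ((\<lambda>i. i + 2) ` V)" .
  have "fv (Ex 0 (Ex 1 (Conj (Conj (Eq (Var 0) (Add (Var 2) (Var 1))) (InClass (Var 1) j))
     (ren \<psi> (\<lambda>i. if i = 0 then 0 else i + 2) id)))) \<subseteq> insert 2 ((\<lambda>i. i + 2) ` V)"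
    using * by auto
  then have "(\<lambda>i. i - 2) ` fv (Ex 0 (Ex 1 (Conj (Conj (Eq (Var 0) (Add (Var 2) (Var 1))) (InClass (Var 1) j))
     (ren \<psi> (\<lambda>i. if i = 0 then 0 else i + 2) id)))) \<subseteq> (\<lambda>i. i - 2) ` insert 2 ((\<lambda>i. i + 2) ` V)"
    by (rule image_mono)
  also have "\<dots> = insert 0 V" by (simp add: image_image)
  finally show ?thesis unfolding shiftF_def by (rule order_trans[OF fv_ren])
qed

lemma fv_RV_shiftF: "fv_RV (shiftF \<psi> j) \<subseteq> insert j (fv_RV \<psi>)"
proof -
  have "fv_RV (Ex 0 (Ex 1 (Conj (Conj (Eq (Var 0) (Add (Var 2) (Var 1))) (InClass (Var 1) j))
     (ren \<psi> (\<lambda>i. if i = 0 then 0 else i + 2) id)))) \<subseteq> insert j (fv_RV \<psi>)"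
    using fv_RV_ren[of \<psi> "\<lambda>i. if i = 0 then 0 else i + 2" id] by auto
  then show ?thesis unfolding shiftF_def by (intro order_trans[OF fv_RV_ren]) (simp only: image_id id_apply)
qed

lemma wf_shiftF: "wf_fm L \<psi> \<Longrightarrow> wf_fm L (shiftF \<psi> j)"
  unfolding shiftF_def by (intro wf_ren) (simp add: wf_ren)

lemma fresh_index: "finite S \<Longrightarrow> \<exists>b::nat. \<forall>i\<in>S. i < b"
  by (simp add: finite_nat_set_iff_bounded)

context vfield
begin

lemma renv_upd: "renv N z \<Longrightarrow> \<xi> \<in> RV N \<Longrightarrow> renv N (z(j := \<xi>))"
  by (simp add: renv_def)

text \<open>Finitely many values of the tuple of variables \<open>J\<close> distinguish the given point \<open>c0\<close> from all
  points of \<open>D\<close> that define a different subset of \<open>RV\<close>.\<close>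

lemma separating_formula:
  assumes \<sigma>: "wf_fm L \<sigma>" "fv \<sigma> \<subseteq> insert 0 V" "fv_RV \<sigma> \<subseteq> insert k J"
    and J: "finite J" "k \<notin> J" and \<xi>: "\<xi> \<in> RV N" and "finite D"
  shows "\<exists>\<kappa> \<rho>. wf_fm L \<kappa> \<and> fv \<kappa> \<subseteq> insert 0 V \<and> fv_RV \<kappa> \<inter> J = {} \<and> renv N \<rho> \<and> \<rho> k = \<xi> \<and>
    sat N (w(0 := c0)) \<rho> \<kappa> \<and>
    (\<forall>c\<in>D. sat N (w(0 := c)) \<rho> \<kappa> \<longrightarrow> (\<forall>\<eta>. renv N \<eta> \<longrightarrow>
      sat N (w(0 := c)) (\<eta>(k := \<xi>)) \<sigma> = sat N (w(0 := c0)) (\<eta>(k := \<xi>)) \<sigma>))"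
  using \<open>finite D\<close>
proof (induction D rule: finite_induct)
  case empty
  have "renv N (\<lambda>_. \<xi>)" using \<xi> by (simp add: renv_def)
  then show ?case by (intro exI[of _ "Eq Zero Zero"] exI[of _ "\<lambda>_. \<xi>"]) simp
next
  case (insert c D)
  obtain \<kappa> \<rho> where \<kappa>: "wf_fm L \<kappa>" "fv \<kappa> \<subseteq> insert 0 V" "fv_RV \<kappa> \<inter> J = {}"
    and \<rho>: "renv N \<rho>" "\<rho> k = \<xi>" and c0: "sat N (w(0 := c0)) \<rho> \<kappa>"
    and D: "\<And>c \<eta>. c \<in> D \<Longrightarrow> sat N (w(0 := c)) \<rho> \<kappa> \<Longrightarrow> renv N \<eta> \<Longrightarrow>
      sat N (w(0 := c)) (\<eta>(k := \<xi>)) \<sigma> = sat N (w(0 := c0)) (\<eta>(k := \<xi>)) \<sigma>"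
    using insert.IH by blast
  show ?case
  proof (cases "\<forall>\<eta>. renv N \<eta> \<longrightarrow> sat N (w(0 := c)) (\<eta>(k := \<xi>)) \<sigma> = sat N (w(0 := c0)) (\<eta>(k := \<xi>)) \<sigma>")
    case True
    then show ?thesis using \<kappa> \<rho> c0 D by (intro exI[of _ \<kappa>] exI[of _ \<rho>]) blast
  next
    case False
    then obtain \<eta> where \<eta>: "renv N \<eta>"
      "sat N (w(0 := c)) (\<eta>(k := \<xi>)) \<sigma> \<noteq> sat N (w(0 := c0)) (\<eta>(k := \<xi>)) \<sigma>" by blast
    have "finite (insert k (J \<union> fv_RV \<kappa>))" using J(1) finite_fv_RV by blast
    from fresh_index[OF this] obtain b where b: "\<forall>i\<in>insert k (J \<union> fv_RV \<kappa>). i < b" by blast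
    \<comment> \<open>The values of \<open>\<eta>\<close> at \<open>J\<close>, which separate
      \<open>c\<close> from \<open>c0\<close>, become additional parameters at indices from
      \<open>b\<close> on, beyond \<open>J\<close>, \<open>k\<close> and the parameters already in
      use.\<close>
    define \<tau> where "\<tau> = (\<lambda>j. if j \<in> J then j + b else j)"
    define \<rho>' where "\<rho>' = (\<lambda>j. if b \<le> j then \<eta> (j - b) else \<rho> j)"
    \<comment> \<open>The sign is chosen so that \<open>c0\<close> satisfies the formula and
      \<open>c\<close> does not.\<close>
    define \<sigma>' where "\<sigma>' = (if sat N (w(0 := c0)) (\<eta>(k := \<xi>)) \<sigma> then ren \<sigma> id \<tau> else Neg (ren \<sigma> id \<tau>))"
    have *: "sat N (w(0 := u)) \<rho>' (ren \<sigma> id \<tau>) \<longleftrightarrow> sat N (w(0 := u)) (\<eta>(k := \<xi>)) \<sigma>" for u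
      unfolding sat_ren comp_id
    proof (rule sat_cong)
      fix j assume "j \<in> fv_RV \<sigma>"
      then consider "j \<in> J" | "j = k" using \<sigma>(3) by blast
      then show "(\<rho>' \<circ> \<tau>) j = (\<eta>(k := \<xi>)) j"
      proof cases
        case 1
        then have "j \<noteq> k" using J(2) by blast
        with 1 show ?thesis by (simp add: \<rho>'_def \<tau>_def)
      next
        case 2
        have "k < b" using b by blast
        with 2 show ?thesis using J(2) \<rho>(2) by (simp add: \<rho>'_def \<tau>_def)
      qed
    qed (rule refl)
    have \<sigma>'c0: "sat N (w(0 := c0)) \<rho>' \<sigma>'" and \<sigma>'c: "\<not> sat N (w(0 := c)) \<rho>' \<sigma>'"
      using \<eta>(2) by (auto simp: \<sigma>'_def *)
    have \<kappa>': "sat N (w(0 := u)) \<rho>' \<kappa> = sat N (w(0 := u)) \<rho> \<kappa>" for u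
    proof (rule sat_cong)
      fix j assume "j \<in> fv_RV \<kappa>"
      then have "j < b" using b by blast
      then show "\<rho>' j = \<rho> j" by (simp add: \<rho>'_def)
    qed (rule refl)
    have "fv_RV (ren \<sigma> id \<tau>) \<inter> J = {}"
    proof -
      have "\<tau> j \<notin> J" if "j \<in> insert k J" for j
      proof (cases "j \<in> J")
        case True
        have "j + b \<notin> J" using b by auto
        then show ?thesis using True by (simp add: \<tau>_def)
      next
        case False
        then show ?thesis using that J(2) by (simp add: \<tau>_def)
      qed
      then show ?thesis using fv_RV_ren[of \<sigma> id \<tau>] \<sigma>(3) by blast
    qed
    then have 1: "fv_RV (Conj \<kappa> \<sigma>') \<inter> J = {}" using \<kappa>(3) by (auto simp: \<sigma>'_def)
    have "fv (ren \<sigma> id \<tau>) \<subseteq> insert 0 V" using fv_ren[of \<sigma> id \<tau>] \<sigma>(2) by simp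
    then have 2: "fv (Conj \<kappa> \<sigma>') \<subseteq> insert 0 V" using \<kappa>(2) by (auto simp: \<sigma>'_def)
    have 3: "wf_fm L (Conj \<kappa> \<sigma>')" using \<kappa>(1) \<sigma>(1) by (simp add: \<sigma>'_def wf_ren)
    have 4: "renv N \<rho>'" using \<rho>(1) \<eta>(1) by (simp add: renv_def \<rho>'_def)
    have "k < b" using b by blast
    then have 5: "\<rho>' k = \<xi>" using \<rho>(2) by (simp add: \<rho>'_def)
    have 6: "sat N (w(0 := c0)) \<rho>' (Conj \<kappa> \<sigma>')" using c0 \<sigma>'c0 by (simp add: \<kappa>')
    have 7: "\<forall>u\<in>insert c D. sat N (w(0 := u)) \<rho>' (Conj \<kappa> \<sigma>') \<longrightarrow> (\<forall>\<eta>. renv N \<eta> \<longrightarrow>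
      sat N (w(0 := u)) (\<eta>(k := \<xi>)) \<sigma> = sat N (w(0 := c0)) (\<eta>(k := \<xi>)) \<sigma>)"
    proof (intro ballI impI allI)
      fix u \<zeta> assume u: "u \<in> insert c D" "sat N (w(0 := u)) \<rho>' (Conj \<kappa> \<sigma>')" and \<zeta>: "renv N \<zeta>"
      from u(2) have s: "sat N (w(0 := u)) \<rho> \<kappa>" "sat N (w(0 := u)) \<rho>' \<sigma>'" by (simp_all add: \<kappa>')
      then have "u \<in> D" using u(1) \<sigma>'c by blast
      then show "sat N (w(0 := u)) (\<zeta>(k := \<xi>)) \<sigma> = sat N (w(0 := c0)) (\<zeta>(k := \<xi>)) \<sigma>"
        using D s(1) \<zeta> by blast
    qed
    from 1 2 3 4 5 6 7 show ?thesis by blast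
  qed
qed

text \<open>A new variable \<open>s\<close> outside \<open>J\<close> serves as a switch among the
  parameters: \<open>InClass Zero s\<close> holds if \<open>s\<close> is the class of 0 and fails if
  it is the class of 1.\<close>

lemma combine_formulas:
  assumes "finite \<Phi>" "finite J" "\<And>\<chi>. \<chi> \<in> \<Phi> \<Longrightarrow> wf_fm L \<chi> \<and> fv \<chi> \<subseteq> V"
  shows "\<exists>\<chi>. wf_fm L \<chi> \<and> fv \<chi> \<subseteq> V \<and> (\<forall>\<chi>'\<in>\<Phi>. \<forall>\<rho>. renv N \<rho> \<longrightarrow> (\<exists>\<rho>'. renv N \<rho>' \<and>
    (\<forall>w \<eta>. sat N w (override_on \<rho> \<eta> J) \<chi>' = sat N w (override_on \<rho>' \<eta> J) \<chi>)))"
  using assms(1,3)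
proof (induction \<Phi> rule: finite_induct)
  case empty
  then show ?case by (intro exI[of _ "Eq Zero Zero"]) simp
next
  case (insert \<chi>1 \<Phi>)
  have "\<exists>\<chi>. wf_fm L \<chi> \<and> fv \<chi> \<subseteq> V \<and> (\<forall>\<chi>'\<in>\<Phi>. \<forall>\<rho>. renv N \<rho> \<longrightarrow> (\<exists>\<rho>'. renv N \<rho>' \<and>
    (\<forall>w \<eta>. sat N w (override_on \<rho> \<eta> J) \<chi>' = sat N w (override_on \<rho>' \<eta> J) \<chi>)))"
    by (rule insert.IH) (use insert.prems in simp)
  then obtain \<chi> where \<chi>: "wf_fm L \<chi>" "fv \<chi> \<subseteq> V"
    and IH: "\<forall>\<chi>'\<in>\<Phi>. \<forall>\<rho>. renv N \<rho> \<longrightarrow> (\<exists>\<rho>'. renv N \<rho>' \<and>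
    (\<forall>w \<eta>. sat N w (override_on \<rho> \<eta> J) \<chi>' = sat N w (override_on \<rho>' \<eta> J) \<chi>))"
    by (elim exE conjE)
  define s where "s = fresh (J \<union> fv_RV \<chi> \<union> fv_RV \<chi>1)"
  have s: "s \<notin> J \<union> fv_RV \<chi> \<union> fv_RV \<chi>1"
    unfolding s_def by (rule fresh_notin) (simp add: assms(2) finite_fv_RV)
  let ?\<psi> = "Disj (Conj (InClass Zero s) \<chi>1) (Conj (Neg (InClass Zero s)) \<chi>)"
  have 0: "rv N (val N \<one>) \<zero> \<in> RV N" "rv N (val N \<one>) \<one> \<in> RV N" by (auto simp: RV_eq)
  have z0: "\<zero> \<in> rv N (val N \<one>) \<zero>" by (simp add: rv_zero)
  have z1: "\<zero> \<notin> rv N (val N \<one>) \<one>"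
  proof
    assume "\<zero> \<in> rv N (val N \<one>) \<one>"
    then have "near N \<one> \<one> \<zero>" by (simp add: rv_iff)
    from near_sym[OF scale_one one_closed this] have "near N \<one> \<zero> \<one>" .
    then have "\<one> \<in> rv N (val N \<one>) \<zero>" by (simp add: rv_iff)
    then show False by (simp add: rv_zero)
  qed
  show ?case
  proof (intro exI[of _ ?\<psi>] conjI ballI allI impI)
    show "wf_fm L ?\<psi>" "fv ?\<psi> \<subseteq> V" using \<chi> insert.prems by auto
    fix \<chi>' \<rho> assume \<chi>': "\<chi>' \<in> insert \<chi>1 \<Phi>" and \<rho>: "renv N \<rho>"
    show "\<exists>\<rho>'. renv N \<rho>' \<and> (\<forall>w \<eta>. sat N w (override_on \<rho> \<eta> J) \<chi>' = sat N w (override_on \<rho>' \<eta> J) ?\<psi>)"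
    proof (cases "\<chi>' = \<chi>1")
      case True
      let ?\<rho>' = "\<rho>(s := rv N (val N \<one>) \<zero>)"
      have "sat N w (override_on \<rho> \<eta> J) \<chi>1 = sat N w (override_on ?\<rho>' \<eta> J) \<chi>1" for w \<eta>
        by (rule sat_cong) (use s in \<open>auto simp: override_on_def\<close>)
      moreover have "override_on ?\<rho>' \<eta> J s = rv N (val N \<one>) \<zero>" for \<eta> using s by simp
      ultimately have "\<forall>w \<eta>. sat N w (override_on \<rho> \<eta> J) \<chi>' = sat N w (override_on ?\<rho>' \<eta> J) ?\<psi>"
        using True z0 by simp
      then show ?thesis using renv_upd[OF \<rho> 0(1)] by blast
    next
      case False
      then obtain \<rho>1 where \<rho>1: "renv N \<rho>1"
        "\<And>w \<eta>. sat N w (override_on \<rho> \<eta> J) \<chi>' = sat N w (override_on \<rho>1 \<eta> J) \<chi>"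
        using IH \<chi>' \<rho> by blast
      let ?\<rho>' = "\<rho>1(s := rv N (val N \<one>) \<one>)"
      have "sat N w (override_on \<rho>1 \<eta> J) \<chi> = sat N w (override_on ?\<rho>' \<eta> J) \<chi>" for w \<eta>
        by (rule sat_cong) (use s in \<open>auto simp: override_on_def\<close>)
      moreover have "override_on ?\<rho>' \<eta> J s = rv N (val N \<one>) \<one>" for \<eta> using s by simp
      ultimately have "\<forall>w \<eta>. sat N w (override_on \<rho> \<eta> J) \<chi>' = sat N w (override_on ?\<rho>' \<eta> J) ?\<psi>"
        using z1 \<rho>1(2) by simp
      then show ?thesis using renv_upd[OF \<rho>1(1) 0(2)] by blast
    qed
  qed
qed

end

context hmin_model
begin

text \<open>The variables \<open>J\<close> are the arguments of the trace, all other imaginary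
  variables carry its code. Variable 0 is the field variable to be eliminated; afterwards it is
  reused, bound, for a point of the preparing set.\<close>

lemma eliminate_variable_local:
  assumes \<psi>: "wf_fm L \<psi>" "fv \<psi> \<subseteq> insert 0 V" "fv_RV \<psi> \<subseteq> J"
    and V: "finite V" "0 \<notin> V" and J: "finite J" and w: "kenv M w"
  shows "\<exists>\<chi> \<rho>. wf_fm L \<chi> \<and> fv \<chi> \<subseteq> V \<and> renv M \<rho> \<and>
    (\<forall>\<eta>. renv M \<eta> \<longrightarrow> sat M w \<eta> \<psi> = sat M w (override_on \<rho> \<eta> J) \<chi>)"
proof -
  define d where "d = fresh (insert 0 V)"
  have d: "d \<notin> insert 0 V" unfolding d_def by (rule fresh_notin) (simp add: V)
  obtain T where T: "finite T" "\<forall>\<theta>\<in>T. wf_fm L \<theta> \<and> fv \<theta> \<subseteq> insert 0 V \<and> fv_RV \<theta> = {}"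
    and prep: "\<forall>w z. kenv M w \<longrightarrow> scale M (w d) \<longrightarrow> ienv M z \<longrightarrow> (\<forall>j\<in>fv_RV \<psi> - {}. z j \<in> RV M) \<longrightarrow>
      (\<forall>j\<in>{}. z j \<in> RV_at M (val M (w d))) \<longrightarrow> (\<exists>\<theta>\<in>T. finite (solutions M w z \<theta>) \<and>
        prepared M (val M (w d)) (solutions M w z \<theta>) (solutions M w z \<psi>))"
    using uniform_preparation[OF \<psi>(1,2) V(2) d, of "{}"] by auto
  have prep1: "\<exists>\<theta>\<in>T. finite (solutions M w \<eta> \<theta>) \<and>
      prepared M (val M \<one>) (solutions M w \<eta> \<theta>) (solutions M w \<eta> \<psi>)" if \<eta>: "renv M \<eta>" for \<eta>
  proof -
    \<comment> \<open>Radius 1 makes the class of x - c an element of RV, as a code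
      requires.\<close>
    have k: "kenv M (w(d := \<one>))" using w by (simp add: kenv_def)
    have s: "solutions M (w(d := \<one>)) \<eta> \<phi> = solutions M w \<eta> \<phi>" if "fv \<phi> \<subseteq> insert 0 V" for \<phi>
      by (rule solutions_cong) (use that d in auto)
    obtain \<theta> where \<theta>: "\<theta> \<in> T" "finite (solutions M (w(d := \<one>)) \<eta> \<theta>)"
      "prepared M (val M \<one>) (solutions M (w(d := \<one>)) \<eta> \<theta>) (solutions M (w(d := \<one>)) \<eta> \<psi>)"
      using prep[rule_format, OF k _ renv_ienv[OF \<eta>]] \<eta> by (auto simp: renv_def)
    have "fv \<theta> \<subseteq> insert 0 V" using T(2) \<theta>(1) by blast
    with \<theta> show ?thesis by (auto simp: s \<psi>(2))
  qed
  define \<eta>0 where "\<eta>0 = (\<lambda>_::nat. rv M (val M \<one>) \<zero>)"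
  have nz: "solutions M w \<eta> \<theta> = solutions M w \<eta>0 \<theta>" if "\<theta> \<in> T" for \<theta> \<eta>
    by (rule solutions_cong) (use T(2) that in auto)
  \<comment> \<open>The formulas in \<open>T\<close> have no imaginary variables, so a single finite
    union of solution sets serves all \<open>\<eta>\<close>.\<close>
  define T' where "T' = {\<theta> \<in> T. finite (solutions M w \<eta>0 \<theta>)}"
  \<comment> \<open>The added formula puts 0 into the set, because \<open>nearest_center\<close>
    asks for a nonempty one.\<close>
  obtain ts where ts: "set ts = insert (Eq (Var 0) Zero) T'"
    using finite_list[of "insert (Eq (Var 0) Zero) T'"] T(1) by (auto simp: T'_def)
  define \<theta>C where "\<theta>C = Disjs ts"
  have \<theta>C: "wf_fm L \<theta>C" "fv \<theta>C \<subseteq> insert 0 V" "fv_RV \<theta>C = {}"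
    using T(2) by (auto simp: \<theta>C_def ts T'_def)
  define C where "C = solutions M w \<eta>0 \<theta>C"
  have C_eq: "C = insert \<zero> (\<Union>\<theta>\<in>T'. solutions M w \<eta>0 \<theta>)"
    unfolding C_def \<theta>C_def solutions_Disjs ts by (auto simp: solutions_def)
  have Cfin: "finite C" unfolding C_eq using T(1) by (auto simp: T'_def)
  have Cne: "C \<noteq> {}" unfolding C_eq by blast
  have Ccar: "C \<subseteq> carrier M" unfolding C_def solutions_def by blast
  have Cmem: "sat M (w(0 := c)) z \<theta>C \<longleftrightarrow> c \<in> C" if "c \<in> carrier M" for c z
  proof -
    have "sat M (w(0 := c)) z \<theta>C = sat M (w(0 := c)) \<eta>0 \<theta>C"
      by (rule sat_cong) (simp_all add: \<theta>C(3))
    then show ?thesis using that by (simp add: C_def solutions_def)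
  qed
  have Cprep: "prepared M (val M \<one>) C (solutions M w \<eta> \<psi>)" if r: "renv M \<eta>" for \<eta>
  proof -
    obtain \<theta> where \<theta>: "\<theta> \<in> T" "finite (solutions M w \<eta> \<theta>)"
      "prepared M (val M \<one>) (solutions M w \<eta> \<theta>) (solutions M w \<eta> \<psi>)" using prep1[OF r] by blast
    then have "\<theta> \<in> T'" "solutions M w \<eta> \<theta> \<subseteq> C" unfolding C_eq T'_def using nz[OF \<theta>(1), of \<eta>] by auto
    then show ?thesis using prepared_mono[OF \<theta>(3)] by blast
  qed
  have w0: "w 0 \<in> carrier M" by (rule kenvD[OF w])
  obtain c0 where c0: "c0 \<in> C" and near0: "\<And>y c'. y \<in> carrier M \<Longrightarrow>
      rv M (val M \<one>) (w 0 \<ominus> c0) = rv M (val M \<one>) (y \<ominus> c0) \<Longrightarrow> c' \<in> C \<Longrightarrow>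
      rv M (val M \<one>) (w 0 \<ominus> c') = rv M (val M \<one>) (y \<ominus> c')"
    using nearest_center[OF Cfin Cne Ccar w0] by blast
  have c0c: "c0 \<in> carrier M" using c0 Ccar by blast
  define \<xi> where "\<xi> = rv M (val M \<one>) (w 0 \<ominus> c0)"
  have \<xi>: "\<xi> \<in> RV M" using w0 c0c by (simp add: \<xi>_def RV_eq)
  define k where "k = fresh J"
  have k: "k \<notin> J" unfolding k_def by (rule fresh_notin[OF J])
  define \<sigma> where "\<sigma> = shiftF \<psi> k"
  have \<sigma>: "wf_fm L \<sigma>" "fv \<sigma> \<subseteq> insert 0 V" "fv_RV \<sigma> \<subseteq> insert k J"
    using wf_shiftF[OF \<psi>(1)] fv_shiftF[OF \<psi>(2)] fv_RV_shiftF[of \<psi> k] \<psi>(3) by (auto simp: \<sigma>_def)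
  \<comment> \<open>The points x with x - c0 in the class \<open>\<xi>\<close> cannot be
    distinguished from \<open>w 0\<close> by \<open>C\<close>, so one of them satisfies
    \<open>\<psi>\<close> only if \<open>w 0\<close> does.\<close>
  have trace: "sat M (w(0 := c0)) (\<eta>(k := \<xi>)) \<sigma> \<longleftrightarrow> sat M w \<eta> \<psi>" if \<eta>: "renv M \<eta>" for \<eta>
  proof -
    have k\<psi>: "sat M e (\<eta>(k := \<xi>)) \<psi> = sat M e \<eta> \<psi>" for e
      by (rule sat_cong) (use k \<psi>(3) in auto)
    have "sat M (w(0 := c0)) (\<eta>(k := \<xi>)) \<sigma> \<longleftrightarrow> (\<exists>x\<in>carrier M. x \<ominus> c0 \<in> \<xi> \<and> sat M (w(0 := x)) \<eta> \<psi>)"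
      unfolding \<sigma>_def sat_shiftF[OF c0c] k\<psi> by simp
    also have "\<dots> \<longleftrightarrow> sat M w \<eta> \<psi>"
    proof
      assume "sat M w \<eta> \<psi>"
      then have "sat M (w(0 := w 0)) \<eta> \<psi>" by simp
      moreover have "w 0 \<ominus> c0 \<in> \<xi>"
        unfolding \<xi>_def using w0 c0c near_refl by (simp add: rv_iff)
      ultimately show "\<exists>x\<in>carrier M. x \<ominus> c0 \<in> \<xi> \<and> sat M (w(0 := x)) \<eta> \<psi>" using w0 by blast
    next
      assume "\<exists>x\<in>carrier M. x \<ominus> c0 \<in> \<xi> \<and> sat M (w(0 := x)) \<eta> \<psi>"
      then obtain x where x: "x \<in> carrier M" "x \<ominus> c0 \<in> \<xi>" "sat M (w(0 := x)) \<eta> \<psi>" by blast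
      have cl: "w 0 \<ominus> c0 \<in> carrier M" "x \<ominus> c0 \<in> carrier M" using w0 x c0c by simp_all
      have "near M \<one> (w 0 \<ominus> c0) (x \<ominus> c0)"
        using x(2) rv_iff[OF scale_one cl(1)] unfolding \<xi>_def by blast
      then have eq: "rv M (val M \<one>) (w 0 \<ominus> c0) = rv M (val M \<one>) (x \<ominus> c0)"
        using rv_eq_iff[OF scale_one cl] by blast
      have "w 0 \<in> solutions M w \<eta> \<psi> \<longleftrightarrow> x \<in> solutions M w \<eta> \<psi>"
        using Cprep[OF \<eta>] near0[OF x(1) eq] w0 x(1) unfolding prepared_def by blast
      then show "sat M w \<eta> \<psi>" using x(1,3) w0 by (simp add: solutions_def)
    qed
    finally show ?thesis .
  qed
  obtain \<kappa> \<rho> where \<kappa>: "wf_fm L \<kappa>" "fv \<kappa> \<subseteq> insert 0 V" "fv_RV \<kappa> \<inter> J = {}"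
    and \<rho>: "renv M \<rho>" "\<rho> k = \<xi>" and \<kappa>c0: "sat M (w(0 := c0)) \<rho> \<kappa>"
    and sep: "\<And>c \<eta>. c \<in> C \<Longrightarrow> sat M (w(0 := c)) \<rho> \<kappa> \<Longrightarrow> renv M \<eta> \<Longrightarrow>
      sat M (w(0 := c)) (\<eta>(k := \<xi>)) \<sigma> = sat M (w(0 := c0)) (\<eta>(k := \<xi>)) \<sigma>"
    using separating_formula[OF \<sigma> J k \<xi> Cfin, of w c0] by blast
  \<comment> \<open>The point \<open>c0\<close> cannot be named, but every point of \<open>C\<close>
    satisfying \<open>\<kappa>\<close> gives the same trace, so any of them may take its
    place.\<close>
  define \<chi> where "\<chi> = Ex 0 (Conj (Conj \<theta>C \<kappa>) \<sigma>)"
  have "wf_fm L \<chi>" using \<theta>C \<kappa> \<sigma> by (simp add: \<chi>_def)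
  moreover have "fv \<chi> \<subseteq> V" using \<theta>C(2) \<kappa>(2) \<sigma>(2) by (auto simp: \<chi>_def)
  moreover have "sat M w \<eta> \<psi> = sat M w (override_on \<rho> \<eta> J) \<chi>" if \<eta>: "renv M \<eta>" for \<eta>
  proof -
    have 1: "sat M e (override_on \<rho> \<eta> J) \<kappa> = sat M e \<rho> \<kappa>" for e
    proof (rule sat_cong)
      fix j assume "j \<in> fv_RV \<kappa>"
      then have "j \<notin> J" using \<kappa>(3) by blast
      then show "override_on \<rho> \<eta> J j = \<rho> j" by simp
    qed (rule refl)
    have 2: "sat M e (override_on \<rho> \<eta> J) \<sigma> = sat M e (\<eta>(k := \<xi>)) \<sigma>" for e
    proof (rule sat_cong)
      fix j assume "j \<in> fv_RV \<sigma>"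
      then consider "j \<in> J" | "j = k" using \<sigma>(3) by blast
      then show "override_on \<rho> \<eta> J j = (\<eta>(k := \<xi>)) j"
        by cases (use k \<rho>(2) in \<open>auto simp: override_on_def\<close>)
    qed (rule refl)
    have "sat M w (override_on \<rho> \<eta> J) \<chi> \<longleftrightarrow> (\<exists>c\<in>carrier M. (c \<in> C \<and> sat M (w(0 := c)) \<rho> \<kappa>) \<and>
        sat M (w(0 := c)) (\<eta>(k := \<xi>)) \<sigma>)"
      unfolding \<chi>_def sat.simps 1 2 using Cmem by blast
    also have "\<dots> \<longleftrightarrow> sat M (w(0 := c0)) (\<eta>(k := \<xi>)) \<sigma>"
      using sep[OF _ _ \<eta>] c0 c0c \<kappa>c0 by blast
    finally show ?thesis using trace[OF \<eta>] by simp
  qed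
  ultimately show ?thesis using \<rho>(1) by blast
qed

text \<open>That some code works for a given \<open>\<chi>\<close> is a first-order statement,
  \<open>rF\<close>, and the local version provides such a \<open>\<chi>\<close> in every model.
  Compactness leaves finitely many, which \<open>combine_formulas\<close> merges into one.\<close>

lemma eliminate_variable_zero:
  assumes \<psi>: "wf_fm L \<psi>" "fv \<psi> \<subseteq> insert 0 V" "fv_RV \<psi> \<subseteq> J"
    and V: "finite V" "0 \<notin> V" and J: "finite J"
  shows "\<exists>\<chi>. wf_fm L \<chi> \<and> fv \<chi> \<subseteq> V \<and> (\<forall>w. kenv M w \<longrightarrow> (\<exists>\<rho>. renv M \<rho> \<and>
    (\<forall>\<eta>. renv M \<eta> \<longrightarrow> sat M w \<eta> \<psi> = sat M w (override_on \<rho> \<eta> J) \<chi>)))"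
proof -
  obtain js where js: "set js = J" using finite_list[OF J] by blast
  define ks where "ks \<chi> = (SOME xs. set xs = fv_RV \<chi>)" for \<chi> :: "('f, 'r, 'p) fm"
  have ks: "set (ks \<chi>) = fv_RV \<chi>" for \<chi>
    unfolding ks_def using finite_list[OF finite_fv_RV] by (rule someI_ex)
  define rF where "rF \<chi> = ExRVs (ks \<chi>) (AllRVs js (Iff \<psi> \<chi>))" for \<chi>
  define D where "D = {\<chi>. wf_fm L \<chi> \<and> fv \<chi> \<subseteq> V}"
  have sat_rF: "sat N w z (rF \<chi>) \<longleftrightarrow> (\<exists>\<rho>. renv N \<rho> \<and>
      (\<forall>\<eta>. renv N \<eta> \<longrightarrow> sat N w \<eta> \<psi> = sat N w (override_on \<rho> \<eta> J) \<chi>))"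
    if N: "valued_field N" "ienv N z" for N :: "('u, 'f, 'r, 'p) vstruct" and w z \<chi>
  proof -
    interpret N: vfield N by (rule vfield.intro[OF N(1)])
    have 1: "sat N w (override_on (override_on z \<rho> (set (ks \<chi>))) \<eta> (set js)) \<psi> = sat N w \<eta> \<psi>" for \<rho> \<eta>
      by (rule sat_cong) (use \<psi>(3) in \<open>auto simp: js override_on_def\<close>)
    have 2: "sat N w (override_on (override_on z \<rho> (set (ks \<chi>))) \<eta> (set js)) \<chi> =
        sat N w (override_on \<rho> \<eta> J) \<chi>" for \<rho> \<eta>
      by (rule sat_cong) (auto simp: js ks override_on_def)
    have i: "ienv N (override_on z \<rho> (set (ks \<chi>)))" if "renv N \<rho>" for \<rho>
      by (rule ienv_override[OF N(2) N.renv_ienv[OF that]])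
    show ?thesis
      unfolding rF_def N.sat_ExRVs[OF N(2)] using N.sat_AllRVs[OF i] by (simp add: 1 2 cong: conj_cong)
  qed
  have "\<exists>R0\<subseteq>rF ` D. finite R0 \<and> (\<forall>e z. kenv M e \<longrightarrow> ienv M z \<longrightarrow> (\<exists>r\<in>R0. sat M e z r))"
  proof (rule compactness[OF large valued struct])
    show "wf_fm L r" if "r \<in> rF ` D" for r
      using that \<psi>(1) by (auto simp: rF_def D_def)
  next
    fix N :: "('u, 'f, 'r, 'p) vstruct" and e z
    assume N: "is_structure L N" "valued_field N" "\<And>\<phi>. sentence L \<phi> \<Longrightarrow> holds M \<phi> \<Longrightarrow> holds N \<phi>"
      "kenv N e" "ienv N z"
    interpret N: hmin_model N L l by (rule elementary_hmin_model[OF N(1-3)])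
    obtain \<chi> \<rho> where "wf_fm L \<chi>" "fv \<chi> \<subseteq> V" "renv N \<rho>"
      "\<forall>\<eta>. renv N \<eta> \<longrightarrow> sat N e \<eta> \<psi> = sat N e (override_on \<rho> \<eta> J) \<chi>"
      using N.eliminate_variable_local[OF \<psi> V J N(4)] by blast
    then have "\<chi> \<in> D" "sat N e z (rF \<chi>)" unfolding sat_rF[OF N(2,5)] D_def by blast+
    then show "\<exists>r\<in>rF ` D. sat N e z r" by blast
  qed
  then obtain R0 where R0: "R0 \<subseteq> rF ` D" "finite R0"
    "\<And>e z. kenv M e \<Longrightarrow> ienv M z \<Longrightarrow> \<exists>r\<in>R0. sat M e z r" by blast
  obtain D0 where D0: "D0 \<subseteq> D" "finite D0" "R0 = rF ` D0"
    using finite_subset_image[OF R0(2,1)] by blast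
  obtain \<chi> where \<chi>: "wf_fm L \<chi>" "fv \<chi> \<subseteq> V" and comb: "\<And>\<chi>' \<rho>. \<chi>' \<in> D0 \<Longrightarrow> renv M \<rho> \<Longrightarrow>
      \<exists>\<rho>'. renv M \<rho>' \<and> (\<forall>w \<eta>. sat M w (override_on \<rho> \<eta> J) \<chi>' = sat M w (override_on \<rho>' \<eta> J) \<chi>)"
    using combine_formulas[OF D0(2) J, of L V] D0(1) unfolding D_def by blast
  have "\<exists>\<rho>. renv M \<rho> \<and> (\<forall>\<eta>. renv M \<eta> \<longrightarrow> sat M w \<eta> \<psi> = sat M w (override_on \<rho> \<eta> J) \<chi>)"
    if w: "kenv M w" for w
  proof -
    have i: "ienv M (\<lambda>_. rv M (val M \<one>) \<one>)"
      by (rule renv_ienv) (simp add: renv_def RV_eq)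
    obtain \<chi>' where \<chi>': "\<chi>' \<in> D0" "sat M w (\<lambda>_. rv M (val M \<one>) \<one>) (rF \<chi>')"
      using R0(3)[OF w i] unfolding D0(3) by blast
    obtain \<rho> where \<rho>: "renv M \<rho>" "\<And>\<eta>. renv M \<eta> \<Longrightarrow> sat M w \<eta> \<psi> = sat M w (override_on \<rho> \<eta> J) \<chi>'"
      using \<chi>'(2) unfolding sat_rF[OF valued i] by blast
    obtain \<rho>' where "renv M \<rho>'" "\<forall>w \<eta>. sat M w (override_on \<rho> \<eta> J) \<chi>' = sat M w (override_on \<rho>' \<eta> J) \<chi>"
      using comb[OF \<chi>'(1) \<rho>(1)] by blast
    with \<rho>(2) show ?thesis by (intro exI[of _ \<rho>']) simp
  qed
  with \<chi> show ?thesis by blast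
qed

text \<open>This is uniform stable embeddedness: \<open>\<rho>\<close> codes the trace of
  \<open>w\<close>, and since \<open>\<chi>\<close> has no free field variables, a code determines
  the trace without reference to \<open>w\<close>.\<close>

lemma eliminate_variables:
  assumes "finite V" "wf_fm L \<psi>" "fv \<psi> \<subseteq> V" "fv_RV \<psi> \<subseteq> J" "finite J"
  shows "\<exists>\<chi>. wf_fm L \<chi> \<and> fv \<chi> = {} \<and> (\<forall>w. kenv M w \<longrightarrow> (\<exists>\<rho>. renv M \<rho> \<and>
    (\<forall>\<eta>. renv M \<eta> \<longrightarrow> sat M w \<eta> \<psi> = sat M w (override_on \<rho> \<eta> J) \<chi>)))"
  using assms
proof (induction V arbitrary: \<psi> J rule: finite_induct)
  case empty
  have r: "renv M (\<lambda>_. rv M (val M \<one>) \<one>)" by (simp add: renv_def RV_eq)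
  have "sat M w \<eta> \<psi> = sat M w (override_on (\<lambda>_. rv M (val M \<one>) \<one>) \<eta> J) \<psi>" for w \<eta>
    by (rule sat_cong) (use empty.prems in \<open>auto simp: override_on_def\<close>)
  with r empty.prems show ?case by (intro exI[of _ \<psi>]) auto
next
  case (insert v V)
  \<comment> \<open>The variable to be eliminated is moved to 0, the others out of its way.\<close>
  define \<tau> where "\<tau> = (\<lambda>i. if i = v then 0 else Suc i)"
  define \<psi>0 where "\<psi>0 = ren \<psi> \<tau> id"
  have fv0: "fv \<psi>0 \<subseteq> insert 0 (Suc ` V)"
  proof -
    have "\<tau> ` fv \<psi> \<subseteq> insert 0 (Suc ` V)" using insert.prems(2) by (auto simp: \<tau>_def)
    then show ?thesis unfolding \<psi>0_def by (rule order_trans[OF fv_ren])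
  qed
  have RV0: "fv_RV \<psi>0 \<subseteq> J"
    using fv_RV_ren[of \<psi> \<tau> id] insert.prems(3) by (auto simp: \<psi>0_def)
  have wf0: "wf_fm L \<psi>0" unfolding \<psi>0_def by (rule wf_ren[OF insert.prems(1)])
  have "finite (Suc ` V)" "0 \<notin> Suc ` V" using insert.hyps by auto
  from eliminate_variable_zero[OF wf0 fv0 RV0 this insert.prems(4)] obtain \<chi>0 where
    \<chi>0: "wf_fm L \<chi>0" "fv \<chi>0 \<subseteq> Suc ` V" and el0: "\<And>w. kenv M w \<Longrightarrow> \<exists>\<rho>. renv M \<rho> \<and>
    (\<forall>\<eta>. renv M \<eta> \<longrightarrow> sat M w \<eta> \<psi>0 = sat M w (override_on \<rho> \<eta> J) \<chi>0)" by blast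
  define \<chi>1 where "\<chi>1 = ren \<chi>0 (\<lambda>i. i - 1) id"
  have fv1: "fv \<chi>1 \<subseteq> V"
  proof -
    have "(\<lambda>i. i - 1) ` fv \<chi>0 \<subseteq> V" using \<chi>0(2) by auto
    then show ?thesis unfolding \<chi>1_def by (rule order_trans[OF fv_ren])
  qed
  have wf1: "wf_fm L \<chi>1" unfolding \<chi>1_def by (rule wf_ren[OF \<chi>0(1)])
  \<comment> \<open>The code from the first elimination depends on \<open>w\<close>, so its
    variables have to become arguments of the trace in the next one; the final code contains
    both.\<close>
  define J1 where "J1 = J \<union> fv_RV \<chi>1"
  have J1: "finite J1" "fv_RV \<chi>1 \<subseteq> J1" "J \<subseteq> J1" using insert.prems(4) finite_fv_RV by (auto simp: J1_def)
  obtain \<chi> where \<chi>: "wf_fm L \<chi>" "fv \<chi> = {}" and el1: "\<And>w. kenv M w \<Longrightarrow> \<exists>\<rho>. renv M \<rho> \<and>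
    (\<forall>\<eta>. renv M \<eta> \<longrightarrow> sat M w \<eta> \<chi>1 = sat M w (override_on \<rho> \<eta> J1) \<chi>)"
    using insert.IH[OF wf1 fv1 J1(2,1)] by blast
  have "\<exists>\<rho>. renv M \<rho> \<and> (\<forall>\<eta>. renv M \<eta> \<longrightarrow> sat M w \<eta> \<psi> = sat M w (override_on \<rho> \<eta> J) \<chi>)"
    if w: "kenv M w" for w
  proof -
    define w0 where "w0 = (\<lambda>i. if i = 0 then w v else w (i - 1))"
    have "kenv M w0" using w by (simp add: kenv_def w0_def)
    from el0[OF this] obtain \<rho>0 where \<rho>0: "renv M \<rho>0"
      "\<And>\<eta>. renv M \<eta> \<Longrightarrow> sat M w0 \<eta> \<psi>0 = sat M w0 (override_on \<rho>0 \<eta> J) \<chi>0" by blast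
    obtain \<rho>1 where \<rho>1: "renv M \<rho>1"
      "\<And>\<eta>. renv M \<eta> \<Longrightarrow> sat M w \<eta> \<chi>1 = sat M w (override_on \<rho>1 \<eta> J1) \<chi>" using el1[OF w] by blast
    have "sat M w \<eta> \<psi> = sat M w (override_on (override_on \<rho>1 \<rho>0 J1) \<eta> J) \<chi>" if \<eta>: "renv M \<eta>" for \<eta>
    proof -
      have "w0 \<circ> \<tau> = w" by (auto simp: w0_def \<tau>_def)
      then have "sat M w \<eta> \<psi> = sat M w0 \<eta> \<psi>0" unfolding \<psi>0_def sat_ren by simp
      also have "\<dots> = sat M w0 (override_on \<rho>0 \<eta> J) \<chi>0" by (rule \<rho>0(2)[OF \<eta>])
      also have "\<dots> = sat M w (override_on \<rho>0 \<eta> J) \<chi>1"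
        unfolding \<chi>1_def sat_ren comp_id
        by (rule sat_cong) (use \<chi>0(2) in \<open>auto simp: w0_def\<close>)
      also have "\<dots> = sat M w (override_on \<rho>1 (override_on \<rho>0 \<eta> J) J1) \<chi>"
        by (rule \<rho>1(2)) (rule renv_override[OF \<rho>0(1) \<eta>])
      also have "override_on \<rho>1 (override_on \<rho>0 \<eta> J) J1 = override_on (override_on \<rho>1 \<rho>0 J1) \<eta> J"
        using J1(3) by (auto simp: override_on_def fun_eq_iff)
      finally show ?thesis .
    qed
    moreover have "renv M (override_on \<rho>1 \<rho>0 J1)" by (rule renv_override[OF \<rho>1(1) \<rho>0(1)])
    ultimately show ?thesis by blast
  qed
  with \<chi> show ?case by blast
qed

end

section \<open>Expansions by predicates on RV\<close>

lemma wf_tm_mono: "funs L \<subseteq> funs L' \<Longrightarrow> wf_tm L t \<Longrightarrow> wf_tm L' t"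
  by (induction t) (auto simp: list_all_iff)

lemma wf_fm_mono:
  assumes "funs L \<subseteq> funs L'" "rels L \<subseteq> rels L'" "rvrels L \<subseteq> rvrels L'"
  shows "wf_fm L \<phi> \<Longrightarrow> wf_fm L' \<phi>"
  by (induction \<phi>) (use assms wf_tm_mono[OF assms(1)] in \<open>auto simp: list_all_iff\<close>)

lemma wf_tm_funs: "funs L = funs L' \<Longrightarrow> wf_tm L t \<longleftrightarrow> wf_tm L' t"
  using wf_tm_mono[of L L'] wf_tm_mono[of L' L] by blast

text \<open>The substitute for invariance under automorphisms that fix RV pointwise: assignments on
  which \<open>P\<close> differs are told apart by the trace of one formula of
  \<open>L\<close>.\<close>

definition controlled :: "('f, 'r, 'p) lang \<Rightarrow> ('u, 'f, 'r, 'p) vstruct \<Rightarrow> ((nat \<Rightarrow> 'u) \<Rightarrow> bool) \<Rightarrow> bool" where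
  "controlled L M P \<longleftrightarrow> (\<exists>\<psi>. wf_fm L \<psi> \<and> (\<forall>w w'. kenv M w \<longrightarrow> kenv M w' \<longrightarrow>
    (\<forall>\<eta>. renv M \<eta> \<longrightarrow> sat M w \<eta> \<psi> = sat M w' \<eta> \<psi>) \<longrightarrow> P w = P w'))"

context hmin_model
begin

lemma controlled_finite:
  assumes "finite \<Psi>" "\<And>\<psi>. \<psi> \<in> \<Psi> \<Longrightarrow> wf_fm L \<psi>"
    "\<And>w w'. kenv M w \<Longrightarrow> kenv M w' \<Longrightarrow>
      (\<And>\<psi> \<eta>. \<psi> \<in> \<Psi> \<Longrightarrow> renv M \<eta> \<Longrightarrow> sat M w \<eta> \<psi> = sat M w' \<eta> \<psi>) \<Longrightarrow> P w = P w'"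
  shows "controlled L M P"
proof -
  \<comment> \<open>With the empty \<open>J\<close> the whole assignment counts as code, so that it
    may also set the switches.\<close>
  obtain \<chi> where \<chi>: "wf_fm L \<chi>" and comb: "\<And>\<psi> \<rho>. \<psi> \<in> \<Psi> \<Longrightarrow> renv M \<rho> \<Longrightarrow> \<exists>\<rho>'. renv M \<rho>' \<and>
    (\<forall>w \<eta>. sat M w (override_on \<rho> \<eta> {}) \<psi> = sat M w (override_on \<rho>' \<eta> {}) \<chi>)"
    using combine_formulas[OF assms(1), of "{}" L UNIV] assms(2) by auto
  have "P w = P w'" if w: "kenv M w" "kenv M w'" and eq: "\<forall>\<eta>. renv M \<eta> \<longrightarrow> sat M w \<eta> \<chi> = sat M w' \<eta> \<chi>"
    for w w'
  proof (rule assms(3)[OF w])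
    fix \<psi> \<eta> assume *: "\<psi> \<in> \<Psi>" "renv M \<eta>"
    obtain \<rho>' where "renv M \<rho>'" "\<forall>w. sat M w \<eta> \<psi> = sat M w \<rho>' \<chi>"
      using comb[OF *] by auto
    with eq show "sat M w \<eta> \<psi> = sat M w' \<eta> \<psi>" by blast
  qed
  with \<chi> show ?thesis unfolding controlled_def by blast
qed

lemma controlled_not: "controlled L M P \<Longrightarrow> controlled L M (\<lambda>w. \<not> P w)"
  unfolding controlled_def by (simp only: Not_eq_iff)

lemma controlled_conj:
  assumes "controlled L M P" "controlled L M Q"
  shows "controlled L M (\<lambda>w. P w \<and> Q w)"
proof -
  obtain \<psi> where \<psi>: "wf_fm L \<psi>" "\<And>w w'. kenv M w \<Longrightarrow> kenv M w' \<Longrightarrow>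
      (\<And>\<eta>. renv M \<eta> \<Longrightarrow> sat M w \<eta> \<psi> = sat M w' \<eta> \<psi>) \<Longrightarrow> P w = P w'"
    using assms(1) unfolding controlled_def by metis
  obtain \<chi> where \<chi>: "wf_fm L \<chi>" "\<And>w w'. kenv M w \<Longrightarrow> kenv M w' \<Longrightarrow>
      (\<And>\<eta>. renv M \<eta> \<Longrightarrow> sat M w \<eta> \<chi> = sat M w' \<eta> \<chi>) \<Longrightarrow> Q w = Q w'"
    using assms(2) unfolding controlled_def by metis
  show ?thesis
  proof (rule controlled_finite[of "{\<psi>, \<chi>}"])
    fix w w' assume w: "kenv M w" "kenv M w'"
      and eq: "\<And>\<phi> \<eta>. \<phi> \<in> {\<psi>, \<chi>} \<Longrightarrow> renv M \<eta> \<Longrightarrow> sat M w \<eta> \<phi> = sat M w' \<eta> \<phi>"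
    have "P w = P w'" by (rule \<psi>(2)[OF w]) (rule eq, simp)
    moreover have "Q w = Q w'" by (rule \<chi>(2)[OF w]) (rule eq, simp)
    ultimately show "(P w \<and> Q w) = (P w' \<and> Q w')" by simp
  qed (use \<psi>(1) \<chi>(1) in auto)
qed

lemma controlled_formula:
  assumes "wf_fm L \<psi>" "\<And>w. kenv M w \<Longrightarrow> P w \<longleftrightarrow> sat M w z \<psi>" "fv_RV \<psi> = {}"
  shows "controlled L M P"
proof (rule controlled_finite[of "{\<psi>}"])
  fix w w' assume w: "kenv M w" "kenv M w'"
    and eq: "\<And>\<phi> \<eta>. \<phi> \<in> {\<psi>} \<Longrightarrow> renv M \<eta> \<Longrightarrow> sat M w \<eta> \<phi> = sat M w' \<eta> \<phi>"
  have r: "renv M (\<lambda>_. rv M (val M \<one>) \<one>)" by (simp add: renv_def RV_eq)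
  have "sat M v z \<psi> = sat M v (\<lambda>_. rv M (val M \<one>) \<one>) \<psi>" for v
    by (rule sat_cong) (simp_all add: assms(3))
  then show "P w = P w'" using eq[of \<psi>, OF _ r] assms(2)[OF w(1)] assms(2)[OF w(2)] by simp
qed (use assms in auto)

text \<open>\<open>\<psi>'\<close> says of a code that some x gives \<open>\<psi>\<close> the trace
  with this code. If \<open>w\<close> and \<open>w'\<close> agree on \<open>\<psi>'\<close>, they
  realize the same codes, so an x for \<open>w\<close> has a counterpart for \<open>w'\<close> with
  the same trace of \<open>\<psi>\<close>, and \<open>P\<close> takes the same value at
  both.\<close>

lemma controlled_Ex:
  assumes "controlled L M P"
  shows "controlled L M (\<lambda>w. \<exists>x\<in>carrier M. P (w(k := x)))"
proof -
  obtain \<psi> where \<psi>: "wf_fm L \<psi>" "\<And>w w'. kenv M w \<Longrightarrow> kenv M w' \<Longrightarrow>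
      (\<And>\<eta>. renv M \<eta> \<Longrightarrow> sat M w \<eta> \<psi> = sat M w' \<eta> \<psi>) \<Longrightarrow> P w = P w'"
    using assms unfolding controlled_def by metis
  define J where "J = fv_RV \<psi>"
  have J: "finite J" "fv_RV \<psi> \<subseteq> J" by (simp_all add: J_def finite_fv_RV)
  obtain js where js: "set js = J" using finite_list[OF J(1)] by blast
  obtain \<chi> where \<chi>: "wf_fm L \<chi>" "fv \<chi> = {}" and el: "\<And>w. kenv M w \<Longrightarrow> \<exists>\<rho>. renv M \<rho> \<and>
    (\<forall>\<eta>. renv M \<eta> \<longrightarrow> sat M w \<eta> \<psi> = sat M w (override_on \<rho> \<eta> J) \<chi>)"
    using eliminate_variables[OF finite_fv \<psi>(1) order_refl J(2,1)] by blast
  define \<psi>' where "\<psi>' = Ex k (AllRVs js (Iff \<psi> \<chi>))"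
  have \<chi>w: "sat M w \<eta> \<chi> = sat M w' \<eta> \<chi>" for w w' \<eta>
    by (rule sat_cong) (simp_all add: \<chi>(2))
  have sat': "sat M w \<rho> \<psi>' \<longleftrightarrow> (\<exists>x\<in>carrier M. \<forall>\<eta>. renv M \<eta> \<longrightarrow>
      sat M (w(k := x)) \<eta> \<psi> = sat M w (override_on \<rho> \<eta> J) \<chi>)" if \<rho>: "renv M \<rho>" for w \<rho>
  proof -
    have 1: "sat M (w(k := x)) (override_on \<rho> \<eta> J) \<psi> = sat M (w(k := x)) \<eta> \<psi>" for x \<eta>
      by (rule sat_cong) (auto simp: J_def)
    show ?thesis
      unfolding \<psi>'_def sat.simps sat_AllRVs[OF renv_ienv[OF \<rho>]] js Iff_simps 1
      using \<chi>w[of "w(k := _)" _ w] by simp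
  qed
  have step: "\<exists>x\<in>carrier M. P (w'(k := x))"
    if w: "kenv M w" "kenv M w'" and eq: "\<And>\<eta>. renv M \<eta> \<Longrightarrow> sat M w \<eta> \<psi>' = sat M w' \<eta> \<psi>'"
      and x: "x \<in> carrier M" "P (w(k := x))" for w w' x
  proof -
    obtain \<rho> where \<rho>: "renv M \<rho>" "\<And>\<eta>. renv M \<eta> \<Longrightarrow>
        sat M (w(k := x)) \<eta> \<psi> = sat M (w(k := x)) (override_on \<rho> \<eta> J) \<chi>"
      using el[OF kenv_upd[OF w(1) x(1)]] by blast
    have \<rho>w: "sat M (w(k := x)) \<eta> \<psi> = sat M w (override_on \<rho> \<eta> J) \<chi>" if "renv M \<eta>" for \<eta>
      using \<rho>(2)[OF that] \<chi>w[of "w(k := x)" _ w] by simp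
    then have "sat M w \<rho> \<psi>'" unfolding sat'[OF \<rho>(1)] using x(1) by blast
    then have "sat M w' \<rho> \<psi>'" using eq[OF \<rho>(1)] by simp
    then obtain x' where x': "x' \<in> carrier M" "\<And>\<eta>. renv M \<eta> \<Longrightarrow>
        sat M (w'(k := x')) \<eta> \<psi> = sat M w' (override_on \<rho> \<eta> J) \<chi>"
      unfolding sat'[OF \<rho>(1)] by blast
    have "P (w(k := x)) = P (w'(k := x'))"
    proof (rule \<psi>(2)[OF kenv_upd[OF w(1) x(1)] kenv_upd[OF w(2) x'(1)]])
      fix \<eta> assume \<eta>: "renv M \<eta>"
      show "sat M (w(k := x)) \<eta> \<psi> = sat M (w'(k := x')) \<eta> \<psi>"
        unfolding \<rho>w[OF \<eta>] x'(2)[OF \<eta>] by (rule \<chi>w)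
    qed
    with x(2) x'(1) show ?thesis by blast
  qed
  show ?thesis
  proof (rule controlled_finite[of "{\<psi>'}"])
    show "wf_fm L \<phi>" if "\<phi> \<in> {\<psi>'}" for \<phi> using that \<psi>(1) \<chi>(1) by (simp add: \<psi>'_def)
    fix w w' assume w: "kenv M w" "kenv M w'"
      and eq: "\<And>\<phi> \<eta>. \<phi> \<in> {\<psi>'} \<Longrightarrow> renv M \<eta> \<Longrightarrow> sat M w \<eta> \<phi> = sat M w' \<eta> \<phi>"
    have eq1: "sat M w \<eta> \<psi>' = sat M w' \<eta> \<psi>'" if "renv M \<eta>" for \<eta>
      by (rule eq) (simp_all add: that)
    show "(\<exists>x\<in>carrier M. P (w(k := x))) = (\<exists>x\<in>carrier M. P (w'(k := x)))"
      using step[OF w eq1] step[OF w(2,1) eq1[symmetric]] by blast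
  qed simp
qed

lemma sat_ren_kpart: "sat M w z (ren \<phi> (\<lambda>i. 3 * i) id) \<longleftrightarrow> sat M (kpart w) z \<phi>"
  unfolding sat_ren by (simp add: kpart_def comp_def)

text \<open>The additional predicates occur only in the atom \<open>RVRel\<close>. It can hold only
  for classes in RV, and the trace of \<open>clsF\<close> shows which element of RV a class is.
  Imaginary quantifiers range over representatives, so \<open>controlled_Ex\<close> covers both
  kinds.\<close>

lemma controlled_psat:
  assumes L': "funs L' = funs L" "rels L' = rels L" "is_structure L' M" and "wf_fm L' \<phi>"
  shows "controlled L M (\<lambda>w. psat M w \<phi>)"
  using assms(4)
proof (induction \<phi>)
  case (Eq s t)
  show ?case
  proof (rule controlled_formula)
    show "wf_fm L (ren (Eq s t) (\<lambda>i. 3 * i) id)"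
      by (rule wf_ren) (use Eq wf_tm_funs[OF L'(1)] in simp)
    show "psat M w (Eq s t) \<longleftrightarrow> sat M w (\<lambda>_. {}) (ren (Eq s t) (\<lambda>i. 3 * i) id)" for w
      unfolding psat_def sat_ren_kpart by simp
  qed simp
next
  case (InO t)
  show ?case
  proof (rule controlled_formula)
    show "wf_fm L (ren (InO t) (\<lambda>i. 3 * i) id)"
      by (rule wf_ren) (use InO wf_tm_funs[OF L'(1)] in simp)
    show "psat M w (InO t) \<longleftrightarrow> sat M w (\<lambda>_. {}) (ren (InO t) (\<lambda>i. 3 * i) id)" for w
      unfolding psat_def sat_ren_kpart by simp
  qed simp
next
  case (Rel r ts)
  show ?case
  proof (rule controlled_formula)
    show "wf_fm L (ren (Rel r ts) (\<lambda>i. 3 * i) id)"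
      by (rule wf_ren) (use Rel L'(2) wf_tm_funs[OF L'(1)] in \<open>simp add: list_all_iff\<close>)
    show "psat M w (Rel r ts) \<longleftrightarrow> sat M w (\<lambda>_. {}) (ren (Rel r ts) (\<lambda>i. 3 * i) id)" for w
      unfolding psat_def sat_ren_kpart by simp
  qed simp
next
  case (InClass t j)
  \<comment> \<open>The atom needs an imaginary variable, so the class represented in
    \<open>w\<close> is bound to variable 0.\<close>
  define \<psi> :: "('f, 'r, 'p) fm" where
    "\<psi> = ExRV 0 (Conj (clsF 0 (3 * j + 2) (3 * j + 1)) (ren (InClass t 0) (\<lambda>i. 3 * i) id))"
  show ?case
  proof (rule controlled_formula)
    have "wf_fm L (ren (InClass t 0 :: ('f, 'r, 'p) fm) (\<lambda>i. 3 * i) id)"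
      by (rule wf_ren) (use InClass wf_tm_funs[OF L'(1)] in simp)
    then show "wf_fm L \<psi>" by (simp add: \<psi>_def fv_clsF)
    have "fv_RV (clsF 0 (3 * j + 2) (3 * j + 1)) \<subseteq> {0}" by (rule fv_clsF)
    then show "fv_RV \<psi> = {}" unfolding \<psi>_def by auto
    fix w :: "nat \<Rightarrow> 'u" assume w: "kenv M w"
    have "sat M w (\<lambda>_. {}) \<psi> \<longleftrightarrow> (\<exists>\<xi>\<in>RV_sort M. \<xi> = ipart M w j \<and> eval M (kpart w) t \<in> \<xi>)"
      unfolding \<psi>_def sat.simps sat_ren_kpart
      using kenvD[OF w] RV_sort_subset by (auto simp: sat_clsF ipart_def)
    then show "psat M w (InClass t j) \<longleftrightarrow> sat M w (\<lambda>_. {}) \<psi>"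
      unfolding psat_def using ienv_ipart[OF w] by (auto simp: ienv_def)
  qed
next
  case (RVRel p js)
  let ?c = "\<lambda>j. clsF 0 (3 * j + 2) (3 * j + 1)"
  have cls: "sat M w \<eta> (?c j) \<longleftrightarrow> \<eta> 0 = ipart M w j" if "kenv M w" "renv M \<eta>" for w \<eta> j
    using kenvD[OF that(1)] ienv_subset[OF renv_ienv[OF that(2)]] by (simp add: sat_clsF ipart_def)
  have M: "\<forall>(p, n)\<in>rvrels L'. \<forall>\<xi>s\<in>rvp M p. length \<xi>s = n \<longrightarrow> \<xi>s \<in> lists (RV M)"
    using L'(3) unfolding is_structure_def by blast
  have M': "ys \<in> lists (RV M)" if "ys \<in> rvp M p" "length ys = length js" for ys
    using bspec[OF M, of "(p, length js)"] that RVRel by simp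
  show ?case
  proof (rule controlled_finite[of "?c ` set js"])
    fix w w' assume w: "kenv M w" "kenv M w'"
      and eq: "\<And>\<phi> \<eta>. \<phi> \<in> ?c ` set js \<Longrightarrow> renv M \<eta> \<Longrightarrow> sat M w \<eta> \<phi> = sat M w' \<eta> \<phi>"
    \<comment> \<open>A class in RV may itself be taken as the value of variable 0; equality of the
      traces at this value forces the class under \<open>u'\<close> to be the same.\<close>
    have same: "ipart M u' j = ipart M u j"
      if j: "j \<in> set js" "ipart M u j \<in> RV M" and u: "kenv M u" "kenv M u'"
        and eq: "\<And>\<phi> \<eta>. \<phi> \<in> ?c ` set js \<Longrightarrow> renv M \<eta> \<Longrightarrow> sat M u \<eta> \<phi> = sat M u' \<eta> \<phi>" for j u u'
    proof -
      have r: "renv M (\<lambda>_. ipart M u j)" using j(2) by (simp add: renv_def)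
      have "sat M u (\<lambda>_. ipart M u j) (?c j)" using cls[OF u(1) r] by simp
      then have "sat M u' (\<lambda>_. ipart M u j) (?c j)" using eq[OF _ r, of "?c j"] j(1) by blast
      then show ?thesis using cls[OF u(2) r] by simp
    qed
    have step: "map (ipart M u') js \<in> rvp M p"
      if p: "map (ipart M u) js \<in> rvp M p" and u: "kenv M u" "kenv M u'"
        and eq: "\<And>\<phi> \<eta>. \<phi> \<in> ?c ` set js \<Longrightarrow> renv M \<eta> \<Longrightarrow> sat M u \<eta> \<phi> = sat M u' \<eta> \<phi>" for u u'
    proof -
      have "map (ipart M u) js \<in> lists (RV M)" by (rule M'[OF p]) simp
      then have "ipart M u j \<in> RV M" if "j \<in> set js" for j using that by (auto simp: in_lists_conv_set)
      then have "map (ipart M u') js = map (ipart M u) js"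
        using same[OF _ _ u eq] by (intro map_cong refl) blast
      then show ?thesis using p by (simp only:)
    qed
    show "psat M w (RVRel p js) = psat M w' (RVRel p js)"
      unfolding psat_def sat.simps using step[OF _ w eq] step[OF _ w(2,1) eq[symmetric]] by blast
  qed (auto simp: fv_clsF)
next
  case (Neg \<phi>)
  then show ?case unfolding psat_simps by (intro controlled_not) simp
next
  case (Conj \<phi> \<psi>)
  then show ?case unfolding psat_simps by (intro controlled_conj) simp_all
next
  case (Ex i \<phi>)
  then show ?case unfolding psat_Ex by (intro controlled_Ex) simp
next
  case (ExRV j \<phi>)
  then have "controlled L M (\<lambda>w. psat M w \<phi>)" by simp
  then have "controlled L M (\<lambda>w. \<exists>d\<in>carrier M. psat M (w(3 * j + 2 := d)) \<phi>)" by (rule controlled_Ex)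
  then have "controlled L M (\<lambda>w. \<exists>c\<in>carrier M. \<exists>d\<in>carrier M. psat M ((w(3 * j + 1 := c))(3 * j + 2 := d)) \<phi>)"
    by (rule controlled_Ex)
  then show ?case unfolding psat_ExRV .
qed

text \<open>For a code \<open>\<rho>\<close> consider the points x at which the parameters in
  \<open>z\<close> have representatives such that \<open>\<rho>\<close> codes the trace of
  \<open>\<psi>\<close>. These sets cover the field, membership in \<open>X\<close> is constant on
  each, and they form one family definable in \<open>L\<close> with the codes as parameters from RV.
  A finite set that prepares the whole family prepares \<open>X\<close>.\<close>

lemma expansion_prepared:
  assumes L': "funs L' = funs L" "rels L' = rels L" "is_structure L' M"
    and d0: "scale M d0" and A: "A \<subseteq> carrier M"
    and A': "A' \<subseteq> RV_at M (val M d0)" "finite A'" "card A' \<le> l"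
    and X: "definable L' M A (RV M \<union> A') X"
  shows "\<exists>C. finite C \<and> definable L M A {} C \<and> prepared M (val M d0) C X"
proof -
  let ?\<xi>0 = "rv M (val M \<one>) \<one>"
  have \<xi>0: "?\<xi>0 \<in> RV M" by (simp add: RV_eq)
  obtain \<phi> e1 z1 where \<phi>: "wf_fm L' \<phi>" and e1: "\<And>i. i \<in> fv \<phi> - {0} \<Longrightarrow> e1 i \<in> A"
    and z1: "\<And>j. j \<in> fv_RV \<phi> \<Longrightarrow> z1 j \<in> RV M \<union> A'"
    and X1: "X = {x \<in> carrier M. sat M (e1(0 := x)) z1 \<phi>}"
    using X unfolding definable_def by blast
  \<comment> \<open>Outside the free variables of \<open>\<phi>\<close> both assignments are reset
    to values within the structure.\<close>
  define e where "e = (\<lambda>i. if i \<in> fv \<phi> - {0} then e1 i else \<zero>)"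
  define z where "z = (\<lambda>j. if j \<in> fv_RV \<phi> then z1 j else ?\<xi>0)"
  have e: "kenv M e" using e1 A by (auto simp: kenv_def e_def)
  have eA: "e i \<in> A" if "i \<in> fv \<phi> - {0}" for i using e1[OF that] that by (simp add: e_def)
  have z: "z j \<in> RV M \<union> A'" for j using z1 \<xi>0 by (simp add: z_def)
  have iz: "ienv M z"
    using z RV_subset_sort RV_at_subset_sort[OF d0] A'(1) unfolding ienv_def by blast
  have X2: "x \<in> X \<longleftrightarrow> sat M (e(0 := x)) z \<phi>" if "x \<in> carrier M" for x
  proof -
    have "sat M (e1(0 := x)) z1 \<phi> = sat M (e(0 := x)) z \<phi>"
      by (rule sat_cong) (auto simp: e_def z_def)
    then show ?thesis using that by (simp add: X1)
  qed

  obtain \<psi> where \<psi>: "wf_fm L \<psi>" "\<And>w w'. kenv M w \<Longrightarrow> kenv M w' \<Longrightarrow>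
      (\<And>\<eta>. renv M \<eta> \<Longrightarrow> sat M w \<eta> \<psi> = sat M w' \<eta> \<psi>) \<Longrightarrow> psat M w \<phi> = psat M w' \<phi>"
    using controlled_psat[OF L' \<phi>] unfolding controlled_def by metis
  define J where "J = fv_RV \<psi>"
  have J: "finite J" "fv_RV \<psi> \<subseteq> J" by (simp_all add: J_def finite_fv_RV)
  obtain js where js: "set js = J" using finite_list[OF J(1)] by blast
  obtain \<chi> where \<chi>: "wf_fm L \<chi>" "fv \<chi> = {}" and el: "\<And>w. kenv M w \<Longrightarrow> \<exists>\<rho>. renv M \<rho> \<and>
    (\<forall>\<eta>. renv M \<eta> \<longrightarrow> sat M w \<eta> \<psi> = sat M w (override_on \<rho> \<eta> J) \<chi>)"
    using eliminate_variables[OF finite_fv \<psi>(1) order_refl J(2,1)] by blast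
  have \<chi>w: "sat M w \<eta> \<chi> = sat M w' \<eta> \<chi>" for w w' \<eta>
    by (rule sat_cong) (simp_all add: \<chi>(2))

  have "finite (J \<union> fv_RV \<chi>)" using J(1) finite_fv_RV by blast
  from fresh_index[OF this] obtain b where b: "\<forall>i\<in>J \<union> fv_RV \<chi>. i < b" by blast
  obtain as where as: "set as = A'" "length as = card A'"
    using finite_distinct_list[OF A'(2)] distinct_card by metis
  define r where "r = length as"
  have r: "r \<le> l" using as(2) A'(3) by (simp add: r_def)
  have "\<exists>k. k < r \<and> as ! k = \<xi>" if "\<xi> \<in> A'" for \<xi>
    using that as(1) unfolding r_def by (metis in_set_conv_nth)
  then obtain idx where idx: "\<And>\<xi>. \<xi> \<in> A' \<Longrightarrow> idx \<xi> < r \<and> as ! idx \<xi> = \<xi>" by metis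
  \<comment> \<open>Indices below \<open>b\<close> hold the code, the next \<open>r\<close> the
    elements of \<open>A'\<close>, later ones the remaining imaginary parameters. All occurrences of
    one element of \<open>A'\<close> share an index, because preparation admits only
    \<open>l\<close> variables with values in RV at \<lambda>, whereas \<open>\<phi>\<close> may
    have more of them.\<close>
  define \<tau> where "\<tau> = (\<lambda>j. if z j \<in> A' then b + idx (z j) else b + r + j)"
  \<comment> \<open>A position whose parameter is held by the block for \<open>A'\<close> receives a
    default value in RV.\<close>
  define Z where "Z = (\<lambda>\<rho> i. if i < b then \<rho> i else if i < b + r then as ! (i - b)
    else if z (i - b - r) \<in> A' then ?\<xi>0 else z (i - b - r))"
  have Z\<tau>: "Z \<rho> (\<tau> j) = z j" for \<rho> j
    using idx[of "z j"] by (auto simp: Z_def \<tau>_def)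
  have Zlow: "Z \<rho> i = \<rho> i" if "i < b" for \<rho> i using that by (simp add: Z_def)
  have ZJ': "Z \<rho> i \<in> A'" if "i \<in> {b..<b + r}" for \<rho> i
  proof -
    have "as ! (i - b) \<in> set as" using that by (intro nth_mem) (auto simp: r_def)
    then show ?thesis using that as(1) by (simp add: Z_def)
  qed
  have ZRV: "Z \<rho> i \<in> RV M" if "i \<notin> {b..<b + r}" "renv M \<rho>" for \<rho> i
    using that z[of "i - b - r"] \<xi>0 by (auto simp: Z_def renv_def)
  have iZ: "ienv M (Z \<rho>)" if "renv M \<rho>" for \<rho>
    unfolding ienv_def
  proof
    fix i
    show "Z \<rho> i \<in> RV_sort M"
    proof (cases "i \<in> {b..<b + r}")
      case True
      then show ?thesis using ZJ' A'(1) RV_at_subset_sort[OF d0] by blast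
    next
      case False
      then show ?thesis using ZRV[OF False that] RV_subset_sort by blast
    qed
  qed

  obtain ks where ks: "set ks = fv_RV \<phi>" using finite_list[OF finite_fv_RV] by blast
  define body where "body = Conj (Conjs (map (\<lambda>j. clsF (\<tau> j) (3 * j + 2) (3 * j + 1)) ks))
    (AllRVs js (Iff \<psi> \<chi>))"
  have sat_body: "sat M w (Z \<rho>) body \<longleftrightarrow> (\<forall>j\<in>fv_RV \<phi>. z j = ipart M w j) \<and>
      (\<forall>\<eta>. renv M \<eta> \<longrightarrow> sat M w \<eta> \<psi> = sat M w (override_on \<rho> \<eta> J) \<chi>)"
    if w: "kenv M w" and \<rho>: "renv M \<rho>" for w \<rho>
  proof -
    have 1: "sat M w (Z \<rho>) (clsF (\<tau> j) (3 * j + 2) (3 * j + 1)) \<longleftrightarrow> z j = ipart M w j" for j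
      using sat_clsF[of w "3 * j + 2" "3 * j + 1" "Z \<rho>" "\<tau> j",
          OF kenvD[OF w] kenvD[OF w] ienv_subset[OF iZ[OF \<rho>]]] unfolding Z\<tau> ipart_def .
    have 2: "sat M w (override_on (Z \<rho>) \<eta> J) \<psi> = sat M w \<eta> \<psi>" for \<eta>
      by (rule sat_cong) (auto simp: J_def)
    have 3: "sat M w (override_on (Z \<rho>) \<eta> J) \<chi> = sat M w (override_on \<rho> \<eta> J) \<chi>" for \<eta>
      by (rule sat_cong) (use b in \<open>auto simp: override_on_def Zlow\<close>)
    show ?thesis
      unfolding body_def sat.simps sat_AllRVs[OF iZ[OF \<rho>]] js Iff_simps 2 3 Conjs_simps
      using 1 by (simp add: ks)
  qed
  have wf_body: "wf_fm L body" using \<psi>(1) \<chi>(1) by (simp add: body_def fv_clsF)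
  \<comment> \<open>Field variables of \<open>\<phi>\<close> sit at multiples of 3, which leaves
    index 1 for the radius. Where 1 occurs in \<open>body\<close>, it belongs to a representative
    and will be bound in \<open>\<Xi>\<close>.\<close>
  define V where "V = (\<lambda>i. 3 * i) ` (fv \<phi> - {0})"
  have V0: "0 \<notin> V" by (auto simp: V_def)
  have V1: "1 \<notin> insert 0 V" 
  proof -
    have "(1::nat) \<noteq> 3 * i" for i by presburger
    then show ?thesis unfolding V_def by auto
  qed
  \<comment> \<open>All representatives are quantified away, which leaves the point variable 0 and
    the variables for parameters from \<open>A\<close>.\<close>
  obtain vs where vs: "set vs = fv body - insert 0 V" using finite_list[of "fv body - insert 0 V"] finite_fv by blast
  define \<Xi> where "\<Xi> = Exs vs body"
  have \<Xi>: "wf_fm L \<Xi>" "fv \<Xi> \<subseteq> insert 0 V" using wf_body vs by (auto simp: \<Xi>_def)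
  define W where "W = (\<lambda>i. if i = 1 then d0 else e (i div 3))"
  have W: "kenv M W" using e d0 by (simp add: kenv_def W_def)
  have Wx: "(W(0 := x)) (3 * i) = (e(0 := x)) i" for x i
  proof -
    have "3 * i \<noteq> 1" by presburger
    then show ?thesis by (simp add: W_def)
  qed
  have kp: "insert 0 V \<supseteq> (\<lambda>i. 3 * i) ` fv \<phi>" by (auto simp: V_def)

  have code: "\<exists>\<rho>. renv M \<rho> \<and> x \<in> solutions M W (Z \<rho>) \<Xi> \<and>
      (\<forall>x'. x' \<in> solutions M W (Z \<rho>) \<Xi> \<longrightarrow> (x \<in> X \<longleftrightarrow> x' \<in> X))" if x: "x \<in> carrier M" for x
  proof -
    obtain w where w: "kenv M w" "kpart w = e(0 := x)" "ipart M w = z"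
      using code_env[OF kenv_upd[OF e x] iz] by blast
    obtain \<rho> where \<rho>: "renv M \<rho>" and tr: "\<And>\<eta>. renv M \<eta> \<Longrightarrow> sat M w \<eta> \<psi> = sat M w (override_on \<rho> \<eta> J) \<chi>"
      using el[OF w(1)] by blast
    have kx: "kenv M (W(0 := y))" if "y \<in> carrier M" for y by (rule kenv_upd[OF W that])
    have sat_\<Xi>: "y \<in> solutions M W (Z \<rho>) \<Xi> \<longleftrightarrow> (\<exists>w'. kenv M w' \<and>
        sat M (override_on (W(0 := y)) w' (set vs)) (Z \<rho>) body)" if y: "y \<in> carrier M" for y
      unfolding solutions_def \<Xi>_def mem_Collect_eq
      using sat_Exs[of "W(0 := y)" M "Z \<rho>" vs body] kenvD[OF kx[OF y]] y by (simp add: kenv_def)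
    have "sat M w (Z \<rho>) body" unfolding sat_body[OF w(1) \<rho>] using w(3) tr by blast
    moreover have "sat M (override_on (W(0 := x)) w (set vs)) (Z \<rho>) body = sat M w (Z \<rho>) body"
    proof (rule sat_cong)
      fix i assume i: "i \<in> fv body"
      show "override_on (W(0 := x)) w (set vs) i = w i"
      proof (cases "i \<in> set vs")
        case False
        then have "i \<in> insert 0 V" using i vs by blast
        then obtain k where k: "i = 3 * k" unfolding V_def by auto
        have "w i = (W(0 := x)) i" unfolding k Wx using w(2) by (metis kpart_def)
        with False show ?thesis by simp
      qed simp
    qed (rule refl)
    ultimately have sx: "x \<in> solutions M W (Z \<rho>) \<Xi>" unfolding sat_\<Xi>[OF x] using w(1) by blast
    have "x \<in> X \<longleftrightarrow> x' \<in> X" if x': "x' \<in> solutions M W (Z \<rho>) \<Xi>" for x'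
    proof -
      have xc: "x' \<in> carrier M" using x' by (simp add: solutions_def)
      obtain w' where w': "kenv M w'" "sat M (override_on (W(0 := x')) w' (set vs)) (Z \<rho>) body"
        using x' unfolding sat_\<Xi>[OF xc] by blast
      let ?w = "override_on (W(0 := x')) w' (set vs)"
      have kw: "kenv M ?w" by (rule kenv_override[OF kx[OF xc] w'(1)])
      from w'(2) have ip: "\<forall>j\<in>fv_RV \<phi>. z j = ipart M ?w j"
        and tr': "\<And>\<eta>. renv M \<eta> \<Longrightarrow> sat M ?w \<eta> \<psi> = sat M ?w (override_on \<rho> \<eta> J) \<chi>"
        unfolding sat_body[OF kw \<rho>] by blast+
      \<comment> \<open>Both assignments have the trace coded by \<open>\<rho>\<close>, and this
        trace decides \<open>\<phi>\<close>.\<close>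
      have "psat M w \<phi> = psat M ?w \<phi>"
      proof (rule \<psi>(2)[OF w(1) kw])
        fix \<eta> assume \<eta>: "renv M \<eta>"
        show "sat M w \<eta> \<psi> = sat M ?w \<eta> \<psi>" unfolding tr[OF \<eta>] tr'[OF \<eta>] by (rule \<chi>w)
      qed
      moreover have "psat M w \<phi> \<longleftrightarrow> x \<in> X" unfolding psat_def w(2,3) X2[OF x] ..
      moreover have "psat M ?w \<phi> \<longleftrightarrow> x' \<in> X"
        unfolding psat_def X2[OF xc]
      proof (rule sat_cong)
        fix i assume "i \<in> fv \<phi>"
        then have "3 * i \<notin> set vs" using kp vs by blast
        then show "kpart ?w i = (e(0 := x')) i" unfolding Wx[symmetric] by (simp add: kpart_def)
      next
        fix j assume "j \<in> fv_RV \<phi>"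
        then show "ipart M ?w j = z j" using ip by simp
      qed
      ultimately show ?thesis by blast
    qed
    with \<rho> sx show ?thesis by blast
  qed

  have J': "finite {b..<b + r}" "card {b..<b + r} \<le> l" using r by simp_all
  obtain T where T: "finite T" "\<forall>\<theta>\<in>T. wf_fm L \<theta> \<and> fv \<theta> \<subseteq> insert 0 V \<and> fv_RV \<theta> = {}"
    and prep: "\<forall>w z. kenv M w \<longrightarrow> scale M (w 1) \<longrightarrow> ienv M z \<longrightarrow> (\<forall>j\<in>fv_RV \<Xi> - {b..<b + r}. z j \<in> RV M) \<longrightarrow>
      (\<forall>j\<in>{b..<b + r}. z j \<in> RV_at M (val M (w 1))) \<longrightarrow> (\<exists>\<theta>\<in>T. finite (solutions M w z \<theta>) \<and>
        prepared M (val M (w 1)) (solutions M w z \<theta>) (solutions M w z \<Xi>))"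
    using uniform_preparation[OF \<Xi> V0 V1 J'] by blast
  have W1: "W 1 = d0" by (simp add: W_def)
  have nz: "solutions M W \<zeta> \<theta> = solutions M W z \<theta>" if "\<theta> \<in> T" for \<theta> \<zeta>
    by (rule solutions_cong) (use T(2) that in auto)
  \<comment> \<open>The solutions of \<open>\<theta>\<close> do not depend on the code, so the
    finite union serves all codes at once.\<close>
  define T' where "T' = {\<theta> \<in> T. finite (solutions M W z \<theta>)}"
  obtain ts where ts: "set ts = T'" using finite_list[of T'] T(1) by (auto simp: T'_def)
  define C where "C = solutions M W z (Disjs ts)"
  have C_eq: "C = (\<Union>\<theta>\<in>T'. solutions M W z \<theta>)" unfolding C_def solutions_Disjs ts ..
  have "finite C" unfolding C_eq using T(1) by (auto simp: T'_def)
  moreover have "definable L M A {} C"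
    unfolding definable_def C_def solutions_def
  proof (intro exI conjI ballI)
    show "wf_fm L (Disjs ts)" using T(2) ts by (auto simp: T'_def)
    fix i assume "i \<in> fv (Disjs ts) - {0}"
    then have "i \<in> V" using T(2) ts by (auto simp: T'_def)
    then obtain k where k: "i = 3 * k" "k \<in> fv \<phi> - {0}" unfolding V_def by blast
    have "i \<noteq> 1" unfolding k(1) by presburger
    then show "W i \<in> A" using eA[OF k(2)] k(1) by (simp add: W_def)
  next
    fix j assume "j \<in> fv_RV (Disjs ts)"
    then show "z j \<in> {}" using T(2) ts by (auto simp: T'_def)
  qed (rule refl)
  moreover have "prepared M (val M d0) C X"
    unfolding prepared_def
  proof (intro ballI impI)
    fix x x' assume x: "x \<in> carrier M" "x' \<in> carrier M"
      and eq: "\<forall>c\<in>C. rv M (val M d0) (x \<ominus> c) = rv M (val M d0) (x' \<ominus> c)"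
    obtain \<rho> where \<rho>: "renv M \<rho>" "x \<in> solutions M W (Z \<rho>) \<Xi>"
      "\<And>y. y \<in> solutions M W (Z \<rho>) \<Xi> \<Longrightarrow> x \<in> X \<longleftrightarrow> y \<in> X" using code[OF x(1)] by blast
    have "\<exists>\<theta>\<in>T. finite (solutions M W (Z \<rho>) \<theta>) \<and>
        prepared M (val M (W 1)) (solutions M W (Z \<rho>) \<theta>) (solutions M W (Z \<rho>) \<Xi>)"
    proof (rule prep[rule_format, OF W])
      show "scale M (W 1)" using d0 by (simp only: W1)
      show "ienv M (Z \<rho>)" by (rule iZ[OF \<rho>(1)])
      show "Z \<rho> j \<in> RV M" if "j \<in> fv_RV \<Xi> - {b..<b + r}" for j using ZRV[OF _ \<rho>(1)] that by blast
      show "Z \<rho> j \<in> RV_at M (val M (W 1))" if "j \<in> {b..<b + r}" for j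
        unfolding W1 using ZJ'[OF that] A'(1) by blast
    qed
    then obtain \<theta> where \<theta>0: "\<theta> \<in> T" "finite (solutions M W (Z \<rho>) \<theta>)"
      "prepared M (val M (W 1)) (solutions M W (Z \<rho>) \<theta>) (solutions M W (Z \<rho>) \<Xi>)"
      by blast
    then have \<theta>: "\<theta> \<in> T" "finite (solutions M W z \<theta>)"
      "prepared M (val M d0) (solutions M W z \<theta>) (solutions M W (Z \<rho>) \<Xi>)"
      by (simp_all only: W1 nz[OF \<theta>0(1), of "Z \<rho>"])
    then have "solutions M W z \<theta> \<subseteq> C" unfolding C_eq T'_def by blast
    then have "\<forall>c\<in>solutions M W z \<theta>. rv M (val M d0) (x \<ominus> c) = rv M (val M d0) (x' \<ominus> c)"
      using eq by blast
    then have "x' \<in> solutions M W (Z \<rho>) \<Xi>"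
      using \<theta>(3) x \<rho>(2) unfolding prepared_def by blast
    then show "x \<in> X \<longleftrightarrow> x' \<in> X" by (rule \<rho>(3))
  qed
  ultimately show ?thesis by blast
qed

end

lemma large_universe_mono:
  assumes "large_universe TYPE('u) L'" "funs L \<subseteq> funs L'" "rels L \<subseteq> rels L'" "rvrels L \<subseteq> rvrels L'"
  shows "large_universe TYPE('u) L"
proof -
  have "funs L <+> rels L <+> rvrels L \<subseteq> funs L' <+> rels L' <+> rvrels L'"
    using assms(2-4) by blast
  from lepoll_trans[OF subset_imp_lepoll[OF this]] show ?thesis
    using assms(1) unfolding large_universe_def by blast
qed

theorem theorem2p2p5:
  fixes K :: "('a, 'f, 'r, 'p) vstruct" and L L' :: "('f, 'r, 'p) lang" and l :: nat
  assumes "large_universe TYPE('u) L'"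
    and "is_structure L K" and "equichar0_valued_field K"
    and "h_minimal TYPE('u) L l (Th L K)"
    and "RV_expansion L L'" and "is_structure L' K"
  shows "h_minimal TYPE('u) L' l (Th L' K)"
  unfolding h_minimal_def
proof (intro allI impI conjI)
  have sub: "funs L' = funs L" "rels L' = rels L" "rvrels L \<subseteq> rvrels L'"
    using assms(5) by (simp_all add: RV_expansion_def)
  have mono: "wf_fm L' \<phi>" if "wf_fm L \<phi>" for \<phi>
    by (rule wf_fm_mono[OF _ _ _ that]) (simp_all add: sub)
  fix M :: "('u, 'f, 'r, 'p) vstruct"
  assume M: "is_model L' (Th L' K) M"
  have M': "is_structure L' M" using M by (simp add: is_model_def)
  \<comment> \<open>A record interprets all symbols of both languages, so \<open>N\<close> is its
    own reduct.\<close>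
  have struct: "is_structure L N" if "is_structure L' N" for N :: "('u, 'f, 'r, 'p) vstruct"
  proof -
    have "\<forall>(p, n)\<in>rvrels L. \<forall>\<xi>s\<in>rvp N p. length \<xi>s = n \<longrightarrow> \<xi>s \<in> lists (RV N)"
      using that sub(3) unfolding is_structure_def by blast
    then show ?thesis using that unfolding is_structure_def sub by blast
  qed
  have holdsM: "holds M \<phi>" if "\<phi> \<in> Th L K" for \<phi>
  proof -
    have "\<phi> \<in> Th L' K" using that mono by (simp add: Th_def sentence_def)
    then show ?thesis using M by (simp add: is_model_def)
  qed
  have "is_model L (Th L K) M" using struct[OF M'] holdsM by (simp add: is_model_def)
  then show eq0: "equichar0_valued_field M" using assms(4) unfolding h_minimal_def by blast
  then have vf: "valued_field M" by (simp add: equichar0_valued_field_def)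
  interpret hmin_model M L l
  proof (rule hmin_model.intro[OF vfield.intro[OF vf]], rule hmin_model_axioms.intro)
    show "large_universe TYPE('u) L"
      by (rule large_universe_mono[OF assms(1)]) (simp_all add: sub)
    show "is_structure L M" by (rule struct[OF M'])
  next
    fix N :: "('u, 'f, 'r, 'p) vstruct" and \<gamma> A A' X
    assume N: "is_structure L N" "\<And>\<phi>. sentence L \<phi> \<Longrightarrow> holds M \<phi> \<Longrightarrow> holds N \<phi>"
      "\<gamma> \<in> value_group N" "val_le N \<gamma> (val_one N)" "A \<subseteq> carrier N"
      "A' \<subseteq> RV_at N \<gamma>" "finite A'" "card A' \<le> l" "definable L N A (RV N \<union> A') X"
    have "holds N \<phi>" if "\<phi> \<in> Th L K" for \<phi>
      using N(2) holdsM[OF that] that by (simp add: Th_def)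
    then have "is_model L (Th L K) N" using N(1) by (simp add: is_model_def)
    moreover have "\<gamma> \<in> value_group N \<and> val_le N \<gamma> (val_one N) \<and> A \<subseteq> carrier N \<and>
        A' \<subseteq> RV_at N \<gamma> \<and> finite A' \<and> card A' \<le> l \<and> definable L N A (RV N \<union> A') X"
      by (intro conjI N(3-9))
    ultimately show "\<exists>C. finite C \<and> definable L N A {} C \<and> prepared N \<gamma> C X"
      by (rule conjunct2[OF mp[OF spec[OF assms(4)[unfolded h_minimal_def]]], THEN spec, THEN spec,
            THEN spec, THEN spec, THEN mp])
  qed
  fix \<gamma> A A' X
  assume *: "\<gamma> \<in> value_group M \<and> val_le M \<gamma> (val_one M) \<and> A \<subseteq> carrier M \<and> A' \<subseteq> RV_at M \<gamma> \<and>
    finite A' \<and> card A' \<le> l \<and> definable L' M A (RV M \<union> A') X"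
  then have "\<exists>d. scale M d \<and> \<gamma> = val M d" unfolding value_group_iff[symmetric] by simp
  then obtain d where d: "scale M d" "\<gamma> = val M d" by blast
  have "\<exists>C. finite C \<and> definable L M A {} C \<and> prepared M (val M d) C X"
    by (rule expansion_prepared[where A' = A', OF sub(1,2) M' d(1)]) (use * d(2) in simp_all)
  then obtain C where C: "finite C" "definable L M A {} C" "prepared M \<gamma> C X" using d(2) by blast
  have "definable L' M A {} C"
    using C(2) mono unfolding definable_def by blast
  with C show "\<exists>C. finite C \<and> definable L' M A {} C \<and> prepared M \<gamma> C X" by blast
qed

end
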